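(* Let $\lambda$ be a regular cardinal and let $F:\mathcal{K}\to\mathcal{M}$ and $G:\mathcal{L}\to\mathcal{M}$ be strongly class-$\lambda$-accessible functors. Then their pseudopullback $\operatorname{PsPb}(F,G)$ is a class-$\lambda^+$-accessible category and the projections $\bar{F}:\operatorname{PsPb}(F,G)\to\mathcal{L}$ and $\bar{G}:\operatorname{PsPb}(F,G)\to\mathcal{K}$ are strongly class-$\lambda^+$-accessible functors.
   Context: Sets and classes are distinguished (Gödel–Bernays set theory); a category may have a proper class of objects but has hom-sets between any two objects. Colimits are small. $\lambda^+$ denotes the successor cardinal of $\lambda$. For a regular cardinal $\lambda$, an object $K$ of a category $\mathcal{K}$ is $\lambda$-presentable if $\hom(K,-):\mathcal{K}\to\mathbf{Set}$ preserves $\lambda$-filtered colimits. $\mathcal{K}$ is class-$\lambda$-accessible if it has $\lambda$-filtered colimits and there is a class $\mathcal{A}$ of $\lambda$-presentable objects of $\mathcal{K}$ such that every object of $\mathcal{K}$ is a $\lambda$-filtered colimit of objects from $\mathcal{A}$. A functor $F:\mathcal{K}\to\mathcal{L}$ is class-$\lambda$-accessible if $\mathcal{K}$ and $\mathcal{L}$ are class-$\lambda$-accessible and $F$ preserves $\lambda$-filtered colimits; it is strongly class-$\lambda$-accessible if moreover it preserves $\lambda$-presentable objects. The pseudopullback $\operatorname{PsPb}(F,G)$ has as objects the 5-tuples $(K,L,M,f,g)$ with $K\in\mathcal{K}$, $L\in\mathcal{L}$, $M\in\mathcal{M}$ and isomorphisms $f:FK\to M$, $g:GL\to M$; morphisms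 $(K,L,M,f,g)\to(K',L',M',f',g')$ are triples of morphisms $K\to K'$, $L\to L'$, $M\to M'$ compatible with $f,f'$ and $g,g'$. The functors $\bar{F}$ and $\bar{G}$ send $(K,L,M,f,g)$ to $L$ and to $K$, respectively. *)

theory Defs
  imports Main "HOL-Library.FuncSet"
begin

unbundle cardinal_syntax

section \<open>Sets and classes\<close>

text \<open>
  Goedel--Bernays set theory is modelled by a strongly inaccessible cardinal \<open>\<kappa>\<close>: the sets are
  (up to bijection) the HOL sets of cardinality \<open>< \<kappa>\<close>, the classes those of cardinality \<open>\<le> \<kappa>\<close>.
  Cardinals are represented, as in the HOL library, by cardinal orders, so that the successor of
  \<open>lam :: 'l rel\<close> is \<open>cardSuc lam :: 'l set rel\<close>. The underlying type of \<open>\<kappa> :: 'u rel\<close> has at least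
  \<open>\<kappa>\<close> elements; hence every small category is isomorphic to one whose objects and arrows are
  elements of \<open>'u\<close>, and quantifying over those covers all small diagrams.
\<close>

definition inaccessible :: "'u rel \<Rightarrow> bool" where
  "inaccessible \<kappa> \<longleftrightarrow>
     Card_order \<kappa> \<and> natLeq <o \<kappa> \<and> regularCard \<kappa> \<and>
     (\<forall>A :: 'u set. |A| <o \<kappa> \<longrightarrow> |Pow A| <o \<kappa>)"

definition small :: "'u rel \<Rightarrow> 'x set \<Rightarrow> bool" where
  "small \<kappa> A \<longleftrightarrow> |A| <o \<kappa>"

definition class_sized :: "'u rel \<Rightarrow> 'x set \<Rightarrow> bool" where
  "class_sized \<kappa> A \<longleftrightarrow> |A| \<le>o \<kappa>"

definition regular_cardinal :: "'u rel \<Rightarrow> 'l rel \<Rightarrow> bool" where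
  "regular_cardinal \<kappa> lam \<longleftrightarrow> Cinfinite lam \<and> regularCard lam \<and> lam <o \<kappa>"

section \<open>Categories and functors\<close>

record ('o, 'a) cat =
  Obj :: "'o set"
  Arr :: "'a set"
  Dom :: "'a \<Rightarrow> 'o"
  Cod :: "'a \<Rightarrow> 'o"
  Ident :: "'o \<Rightarrow> 'a"
  Comp :: "'a \<Rightarrow> 'a \<Rightarrow> 'a"  \<comment> \<open>\<open>Comp C g f\<close> is \<open>f\<close> followed by \<open>g\<close>\<close>

definition hom :: "('o, 'a) cat \<Rightarrow> 'o \<Rightarrow> 'o \<Rightarrow> 'a set" where
  "hom C x y = {f \<in> Arr C. Dom C f = x \<and> Cod C f = y}"

definition category :: "('o, 'a) cat \<Rightarrow> bool" where
  "category C \<longleftrightarrow>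
     (\<forall>f \<in> Arr C. Dom C f \<in> Obj C \<and> Cod C f \<in> Obj C) \<and>
     (\<forall>x \<in> Obj C. Ident C x \<in> hom C x x) \<and>
     (\<forall>x y z f g. f \<in> hom C x y \<longrightarrow> g \<in> hom C y z \<longrightarrow> Comp C g f \<in> hom C x z) \<and>
     (\<forall>x y f. f \<in> hom C x y \<longrightarrow> Comp C f (Ident C x) = f \<and> Comp C (Ident C y) f = f) \<and>
     (\<forall>w x y z f g h. f \<in> hom C w x \<longrightarrow> g \<in> hom C x y \<longrightarrow> h \<in> hom C y z \<longrightarrow>
        Comp C h (Comp C g f) = Comp C (Comp C h g) f)"

text \<open>A possibly proper class of objects, but sets of arrows between any two of them.\<close>

definition class_category :: "'u rel \<Rightarrow> ('o, 'a) cat \<Rightarrow> bool" where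
  "class_category \<kappa> C \<longleftrightarrow>
     category C \<and> class_sized \<kappa> (Obj C) \<and>
     (\<forall>x \<in> Obj C. \<forall>y \<in> Obj C. small \<kappa> (hom C x y))"

definition small_category :: "'u rel \<Rightarrow> ('o, 'a) cat \<Rightarrow> bool" where
  "small_category \<kappa> C \<longleftrightarrow> category C \<and> small \<kappa> (Obj C) \<and> small \<kappa> (Arr C)"

definition is_iso :: "('o, 'a) cat \<Rightarrow> 'o \<Rightarrow> 'o \<Rightarrow> 'a \<Rightarrow> bool" where
  "is_iso C x y f \<longleftrightarrow>
     f \<in> hom C x y \<and>
     (\<exists>g \<in> hom C y x. Comp C g f = Ident C x \<and> Comp C f g = Ident C y)"

record ('o, 'a, 'p, 'b) fctr =
  obj_map :: "'o \<Rightarrow> 'p"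
  arr_map :: "'a \<Rightarrow> 'b"

definition is_functor ::
    "('o, 'a) cat \<Rightarrow> ('p, 'b) cat \<Rightarrow> ('o, 'a, 'p, 'b) fctr \<Rightarrow> bool" where
  "is_functor C D F \<longleftrightarrow>
     category C \<and> category D \<and>
     (\<forall>x \<in> Obj C. obj_map F x \<in> Obj D) \<and>
     (\<forall>x y f. f \<in> hom C x y \<longrightarrow> arr_map F f \<in> hom D (obj_map F x) (obj_map F y)) \<and>
     (\<forall>x \<in> Obj C. arr_map F (Ident C x) = Ident D (obj_map F x)) \<and>
     (\<forall>x y z f g. f \<in> hom C x y \<longrightarrow> g \<in> hom C y z \<longrightarrow>
        arr_map F (Comp C g f) = Comp D (arr_map F g) (arr_map F f))"

definition comp_functor ::
    "('p, 'b, 'q, 'c) fctr \<Rightarrow> ('o, 'a, 'p, 'b) fctr \<Rightarrow> ('o, 'a, 'q, 'c) fctr" where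
  "comp_functor G F =
     \<lparr>obj_map = obj_map G \<circ> obj_map F, arr_map = arr_map G \<circ> arr_map F\<rparr>"

section \<open>Filtered colimits\<close>

definition cocone ::
    "('i, 'j) cat \<Rightarrow> ('o, 'a) cat \<Rightarrow> ('i, 'j, 'o, 'a) fctr \<Rightarrow> 'o \<Rightarrow> ('i \<Rightarrow> 'a) \<Rightarrow> bool" where
  "cocone I C D c \<iota> \<longleftrightarrow>
     c \<in> Obj C \<and>
     (\<forall>i \<in> Obj I. \<iota> i \<in> hom C (obj_map D i) c) \<and>
     (\<forall>i j u. u \<in> hom I i j \<longrightarrow> Comp C (\<iota> j) (arr_map D u) = \<iota> i)"

definition colimit ::
    "('i, 'j) cat \<Rightarrow> ('o, 'a) cat \<Rightarrow> ('i, 'j, 'o, 'a) fctr \<Rightarrow> 'o \<Rightarrow> ('i \<Rightarrow> 'a) \<Rightarrow> bool" where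
  "colimit I C D c \<iota> \<longleftrightarrow>
     cocone I C D c \<iota> \<and>
     (\<forall>c' \<iota>'. cocone I C D c' \<iota>' \<longrightarrow>
        (\<exists>!h. h \<in> hom C c c' \<and> (\<forall>i \<in> Obj I. Comp C h (\<iota> i) = \<iota>' i)))"

text \<open>
  \<open>lam\<close>-filtered: fewer than \<open>lam\<close> objects have an upper bound, and fewer than \<open>lam\<close> parallel
  arrows are coequalized by some arrow. Nonemptiness is the case \<open>S = {}\<close> of the first clause.
\<close>

definition filtered :: "'l rel \<Rightarrow> ('i, 'j) cat \<Rightarrow> bool" where
  "filtered lam I \<longleftrightarrow>
     category I \<and>
     (\<forall>S \<subseteq> Obj I. |S| <o lam \<longrightarrow> (\<exists>k \<in> Obj I. \<forall>i \<in> S. hom I i k \<noteq> {})) \<and>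
     (\<forall>i \<in> Obj I. \<forall>j \<in> Obj I. \<forall>S \<subseteq> hom I i j. |S| <o lam \<longrightarrow>
        (\<exists>k \<in> Obj I. \<exists>w \<in> hom I j k. \<forall>u \<in> S. \<forall>v \<in> S. Comp I w u = Comp I w v))"

text \<open>Diagrams indexed by small \<open>lam\<close>-filtered categories.\<close>

definition filtered_diagram ::
    "'u rel \<Rightarrow> 'l rel \<Rightarrow> ('u, 'u) cat \<Rightarrow> ('o, 'a) cat \<Rightarrow> ('u, 'u, 'o, 'a) fctr \<Rightarrow> bool" where
  "filtered_diagram \<kappa> lam I C D \<longleftrightarrow>
     small_category \<kappa> I \<and> filtered lam I \<and> is_functor I C D"

definition has_filtered_colimits :: "'u rel \<Rightarrow> 'l rel \<Rightarrow> ('o, 'a) cat \<Rightarrow> bool" where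
  "has_filtered_colimits \<kappa> lam C \<longleftrightarrow>
     (\<forall>I D. filtered_diagram \<kappa> lam I C D \<longrightarrow> (\<exists>c \<iota>. colimit I C D c \<iota>))"

definition preserves_filtered_colimits ::
    "'u rel \<Rightarrow> 'l rel \<Rightarrow> ('o, 'a) cat \<Rightarrow> ('p, 'b) cat \<Rightarrow> ('o, 'a, 'p, 'b) fctr \<Rightarrow> bool" where
  "preserves_filtered_colimits \<kappa> lam C D F \<longleftrightarrow>
     (\<forall>I X c \<iota>. filtered_diagram \<kappa> lam I C X \<longrightarrow> colimit I C X c \<iota> \<longrightarrow>
        colimit I D (comp_functor F X) (obj_map F c) (arr_map F \<circ> \<iota>))"

section \<open>The category of sets and hom-functors\<close>

text \<open>
  The category of those sets whose elements are taken from the type \<open>'x\<close>. Arrows carry their domain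
  and codomain; the underlying functions are extensional so that equality of arrows is correct.
\<close>

definition Sets :: "'u rel \<Rightarrow> ('x set, 'x set \<times> ('x \<Rightarrow> 'x) \<times> 'x set) cat" where
  "Sets \<kappa> =
     \<lparr>Obj = {A. small \<kappa> A},
      Arr = {(A, f, B). small \<kappa> A \<and> small \<kappa> B \<and> f \<in> A \<rightarrow>\<^sub>E B},
      Dom = (\<lambda>(A, f, B). A),
      Cod = (\<lambda>(A, f, B). B),
      Ident = (\<lambda>A. (A, restrict (\<lambda>x. x) A, A)),
      Comp = (\<lambda>(B, g, C) (A, f, B'). (A, compose A g f, C))\<rparr>"

text \<open>
  The functor \<open>hom(K, -)\<close> with values in the sets over \<open>'a + 'u\<close>. The hom-sets live in the left
  summand; the summand \<open>'u\<close> only ensures that the type is large enough for \<open>Sets \<kappa>\<close> to contain a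
  copy of every small set, even when the arrow type \<open>'a\<close> of the category has few elements.
\<close>

definition hom_functor ::
    "('o, 'a) cat \<Rightarrow> 'o \<Rightarrow>
     ('o, 'a, ('a + 'u) set, ('a + 'u) set \<times> ('a + 'u \<Rightarrow> 'a + 'u) \<times> ('a + 'u) set) fctr" where
  "hom_functor C K =
     \<lparr>obj_map = (\<lambda>X. Inl ` hom C K X),
      arr_map = (\<lambda>u. (Inl ` hom C K (Dom C u),
                      restrict (\<lambda>z. Inl (Comp C u (projl z))) (Inl ` hom C K (Dom C u)),
                      Inl ` hom C K (Cod C u)))\<rparr>"

section \<open>Class-accessible categories and functors\<close>

definition presentable :: "'u rel \<Rightarrow> 'l rel \<Rightarrow> ('o, 'a) cat \<Rightarrow> 'o \<Rightarrow> bool" where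
  "presentable \<kappa> lam C K \<longleftrightarrow>
     K \<in> Obj C \<and>
     preserves_filtered_colimits \<kappa> lam C (Sets \<kappa>)
       (hom_functor C K ::
         ('o, 'a, ('a + 'u) set, ('a + 'u) set \<times> ('a + 'u \<Rightarrow> 'a + 'u) \<times> ('a + 'u) set) fctr)"

definition class_accessible :: "'u rel \<Rightarrow> 'l rel \<Rightarrow> ('o, 'a) cat \<Rightarrow> bool" where
  "class_accessible \<kappa> lam C \<longleftrightarrow>
     class_category \<kappa> C \<and> has_filtered_colimits \<kappa> lam C \<and>
     (\<exists>\<A>. class_sized \<kappa> \<A> \<and> (\<forall>A \<in> \<A>. presentable \<kappa> lam C A) \<and>
        (\<forall>X \<in> Obj C. \<exists>I D \<iota>. filtered_diagram \<kappa> lam I C D \<and>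
           (\<forall>i \<in> Obj I. obj_map D i \<in> \<A>) \<and> colimit I C D X \<iota>))"

definition class_accessible_functor ::
    "'u rel \<Rightarrow> 'l rel \<Rightarrow> ('o, 'a) cat \<Rightarrow> ('p, 'b) cat \<Rightarrow> ('o, 'a, 'p, 'b) fctr \<Rightarrow> bool" where
  "class_accessible_functor \<kappa> lam C D F \<longleftrightarrow>
     class_accessible \<kappa> lam C \<and> class_accessible \<kappa> lam D \<and> is_functor C D F \<and>
     preserves_filtered_colimits \<kappa> lam C D F"

definition strongly_class_accessible_functor ::
    "'u rel \<Rightarrow> 'l rel \<Rightarrow> ('o, 'a) cat \<Rightarrow> ('p, 'b) cat \<Rightarrow> ('o, 'a, 'p, 'b) fctr \<Rightarrow> bool" where
  "strongly_class_accessible_functor \<kappa> lam C D F \<longleftrightarrow>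
     class_accessible_functor \<kappa> lam C D F \<and>
     (\<forall>X. presentable \<kappa> lam C X \<longrightarrow> presentable \<kappa> lam D (obj_map F X))"

section \<open>Pseudopullbacks\<close>

text \<open>
  An arrow is a compatible triple together with its domain and codomain, since the same triple may
  be compatible with several choices of the isomorphisms \<open>f\<close>, \<open>g\<close>.
\<close>

type_synonym ('k, 'l, 'm, 'mm) pspb_obj = "'k \<times> 'l \<times> 'm \<times> 'mm \<times> 'mm"

type_synonym ('k, 'kk, 'l, 'll, 'm, 'mm) pspb_arr =
  "('k, 'l, 'm, 'mm) pspb_obj \<times> ('kk \<times> 'll \<times> 'mm) \<times> ('k, 'l, 'm, 'mm) pspb_obj"

definition pspb_objects ::
    "('k, 'kk) cat \<Rightarrow> ('l, 'll) cat \<Rightarrow> ('m, 'mm) cat \<Rightarrow>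
     ('k, 'kk, 'm, 'mm) fctr \<Rightarrow> ('l, 'll, 'm, 'mm) fctr \<Rightarrow> ('k, 'l, 'm, 'mm) pspb_obj set" where
  "pspb_objects \<K> \<L> \<M> F G =
     {(K, L, M, f, g). K \<in> Obj \<K> \<and> L \<in> Obj \<L> \<and> M \<in> Obj \<M> \<and>
        is_iso \<M> (obj_map F K) M f \<and> is_iso \<M> (obj_map G L) M g}"

definition PsPb ::
    "('k, 'kk) cat \<Rightarrow> ('l, 'll) cat \<Rightarrow> ('m, 'mm) cat \<Rightarrow>
     ('k, 'kk, 'm, 'mm) fctr \<Rightarrow> ('l, 'll, 'm, 'mm) fctr \<Rightarrow>
     (('k, 'l, 'm, 'mm) pspb_obj, ('k, 'kk, 'l, 'll, 'm, 'mm) pspb_arr) cat" where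
  "PsPb \<K> \<L> \<M> F G =
     \<lparr>Obj = pspb_objects \<K> \<L> \<M> F G,
      Arr = {((K, L, M, f, g), (a, b, c), (K', L', M', f', g')) | K L M f g a b c K' L' M' f' g'.
               (K, L, M, f, g) \<in> pspb_objects \<K> \<L> \<M> F G \<and>
               (K', L', M', f', g') \<in> pspb_objects \<K> \<L> \<M> F G \<and>
               a \<in> hom \<K> K K' \<and> b \<in> hom \<L> L L' \<and> c \<in> hom \<M> M M' \<and>
               Comp \<M> c f = Comp \<M> f' (arr_map F a) \<and>
               Comp \<M> c g = Comp \<M> g' (arr_map G b)},
      Dom = (\<lambda>(X, t, Y). X),
      Cod = (\<lambda>(X, t, Y). Y),
      Ident = (\<lambda>(K, L, M, f, g).
                 ((K, L, M, f, g), (Ident \<K> K, Ident \<L> L, Ident \<M> M), (K, L, M, f, g))),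
      Comp = (\<lambda>(Y, (a', b', c'), Z) (X, (a, b, c), Y').
                 (X, (Comp \<K> a' a, Comp \<L> b' b, Comp \<M> c' c), Z))\<rparr>"

definition F_bar ::
    "(('k, 'l, 'm, 'mm) pspb_obj, ('k, 'kk, 'l, 'll, 'm, 'mm) pspb_arr, 'l, 'll) fctr" where
  "F_bar = \<lparr>obj_map = (\<lambda>(K, L, M, f, g). L), arr_map = (\<lambda>(X, (a, b, c), Y). b)\<rparr>"

definition G_bar ::
    "(('k, 'l, 'm, 'mm) pspb_obj, ('k, 'kk, 'l, 'll, 'm, 'mm) pspb_arr, 'k, 'kk) fctr" where
  "G_bar = \<lparr>obj_map = (\<lambda>(K, L, M, f, g). K), arr_map = (\<lambda>(X, (a, b, c), Y). a)\<rparr>"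

end

theory Submission
  imports Defs
begin

text \<open>
  An object \<open>(K, L, M, f, g)\<close> of the pseudopullback is determined up to isomorphism by its comparison
  \<open>g\<inverse> f : F K \<rightarrow> G L\<close>, and an arrow is a pair of arrows compatible with the comparisons. As \<open>F\<close> and \<open>G\<close>
  preserve \<open>lam\<close>-filtered colimits, these exist in the pseudopullback and are formed in both factors
  (\<open>pspb_colimit_exists\<close>, \<open>pspb_colimitI\<close>), and an object is \<open>lam\<^sup>+\<close>-presentable as soon as \<open>K\<close>, \<open>L\<close> and
  \<open>F K\<close> are (\<open>pspb_presentable\<close>). The heart of the matter is to obtain every object as a
  \<open>lam\<^sup>+\<close>-filtered colimit of objects of this kind (\<open>pspb_approximation\<close>).

  Write \<open>K\<close> and \<open>L\<close> as \<open>lam\<close>-filtered colimits of \<open>lam\<close>-presentable objects \<open>A v\<close> and \<open>B w\<close>. The objects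
  \<open>F (A v)\<close> and \<open>G (B w)\<close> are again \<open>lam\<close>-presentable, and they form two presentations of one object
  \<open>F K \<cong> G L\<close>. Hence an arrow \<open>F (A v) \<rightarrow> G (B w)\<close> over the comparison is answered by an arrow
  \<open>G (B w) \<rightarrow> F (A v')\<close> at a later stage, this one by a further arrow \<open>F (A v') \<rightarrow> G (B w')\<close>, and so on
  (\<open>interleavings_bound\<close>). No finite stage provides an isomorphism, but along a chain of length \<open>lam\<close>
  the alternating arrows become mutually inverse in the colimit (\<open>chain_comparison\<close>), so that the
  colimits of the two chains form an object of the pseudopullback. It is \<open>lam\<^sup>+\<close>-presentable, being a
  colimit of \<open>lam\<close> many presentable objects (\<open>presentable_colimit\<close>).

  This is also where the successor of \<open>lam\<close> comes from. In a \<open>lam\<close>-directed system \<open>lam\<close> many elements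
  lie below a single chain of length \<open>lam\<close> (\<open>chain_above\<close>): each step of the recursion has to bound
  fewer than \<open>lam\<close> elements only. So the chains form a \<open>lam\<^sup>+\<close>-directed preorder. Its colimit is the
  given object, because presentable objects cannot tell the difference: they see the colimit of
  the chains stage by stage, and this characterizes filtered colimits in an accessible category
  (\<open>stagewise_imp_colimit\<close>).

  A \<open>lam\<^sup>+\<close>-presentable object of the pseudopullback is a retract of one of the approximating objects,
  and therefore has \<open>lam\<^sup>+\<close>-presentable components. That the two factors are themselves
  class-\<open>lam\<^sup>+\<close>-accessible is the case of two identity functors (\<open>class_accessible_cardSuc\<close>).

  Filtered index categories are replaced by sets with a transitive relation for which fewer than
  \<open>lam\<close> elements have a common strict upper bound (\<open>filtered_strict_refinement\<close>). The relation need not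
  be reflexive, and the system has no identities. Chains in it are nevertheless honest diagrams,
  and parallel arrows have disappeared from the index.
\<close>

section \<open>Categories, isomorphisms and colimits\<close>

lemma homD:
  assumes "f \<in> hom C x y"
  shows "f \<in> Arr C" "Dom C f = x" "Cod C f = y"
  using assms by (auto simp: hom_def)

lemma arr_in_hom: "f \<in> Arr C \<Longrightarrow> f \<in> hom C (Dom C f) (Cod C f)"
  by (simp add: hom_def)

lemma hom_objD:
  assumes "category C" "f \<in> hom C x y"
  shows "x \<in> Obj C" "y \<in> Obj C"
  using assms by (auto simp: category_def hom_def)

lemma ident_hom: "category C \<Longrightarrow> x \<in> Obj C \<Longrightarrow> Ident C x \<in> hom C x x"
  by (simp add: category_def)

lemma comp_hom:
  "category C \<Longrightarrow> f \<in> hom C x y \<Longrightarrow> g \<in> hom C y z \<Longrightarrow> Comp C g f \<in> hom C x z"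
  by (auto simp: category_def)

lemma ident_right: "category C \<Longrightarrow> f \<in> hom C x y \<Longrightarrow> Comp C f (Ident C x) = f"
  by (auto simp: category_def)

lemma ident_left: "category C \<Longrightarrow> f \<in> hom C x y \<Longrightarrow> Comp C (Ident C y) f = f"
  by (auto simp: category_def)

lemma comp_assoc:
  assumes "category C" "f \<in> hom C w x" "g \<in> hom C x y" "h \<in> hom C y z"
  shows "Comp C h (Comp C g f) = Comp C (Comp C h g) f"
  using assms unfolding category_def by blast

definition mutually_inverse :: "('o, 'a) cat \<Rightarrow> 'o \<Rightarrow> 'o \<Rightarrow> 'a \<Rightarrow> 'a \<Rightarrow> bool" where
  "mutually_inverse C x y f g \<longleftrightarrow> f \<in> hom C x y \<and> g \<in> hom C y x \<and>
     Comp C g f = Ident C x \<and> Comp C f g = Ident C y"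

lemma is_iso_iff: "is_iso C x y f \<longleftrightarrow> (\<exists>g. mutually_inverse C x y f g)"
  by (auto simp: is_iso_def mutually_inverse_def)

lemma mutually_inverseD:
  assumes "mutually_inverse C x y f g"
  shows "f \<in> hom C x y" "g \<in> hom C y x" "Comp C g f = Ident C x" "Comp C f g = Ident C y"
  using assms by (auto simp: mutually_inverse_def)

lemma mutually_inverse_sym: "mutually_inverse C x y f g \<Longrightarrow> mutually_inverse C y x g f"
  by (auto simp: mutually_inverse_def)

lemma mutually_inverse_ident:
  "category C \<Longrightarrow> x \<in> Obj C \<Longrightarrow> mutually_inverse C x x (Ident C x) (Ident C x)"
  by (simp add: mutually_inverse_def ident_hom ident_left[OF _ ident_hom])

lemma inverse_cancel_left:
  assumes "category C" "mutually_inverse C x y f g" "h \<in> hom C w x"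
  shows "Comp C g (Comp C f h) = h"
  using comp_assoc[OF assms(1,3) mutually_inverseD(1,2)[OF assms(2)]]
    mutually_inverseD(3)[OF assms(2)] ident_left[OF assms(1,3)] by simp

lemma inverse_cancel_right:
  assumes "category C" "mutually_inverse C x y f g" "h \<in> hom C x z"
  shows "Comp C (Comp C h g) f = h"
  using comp_assoc[OF assms(1) mutually_inverseD(1,2)[OF assms(2)] assms(3)]
    mutually_inverseD(3)[OF assms(2)] ident_right[OF assms(1,3)] by simp

lemma mutually_inverse_comp:
  assumes C: "category C" and fg: "mutually_inverse C x y f g" and hk: "mutually_inverse C y z h k"
  shows "mutually_inverse C x z (Comp C h f) (Comp C g k)"
proof -
  note f = mutually_inverseD[OF fg] and h = mutually_inverseD[OF hk]
  have "Comp C (Comp C g k) (Comp C h f) = Ident C x"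
    using comp_assoc[OF C comp_hom[OF C f(1) h(1)] h(2) f(2)] inverse_cancel_left[OF C hk f(1)] f(3)
    by simp
  moreover have "Comp C (Comp C h f) (Comp C g k) = Ident C z"
    using comp_assoc[OF C comp_hom[OF C h(2) f(2)] f(1) h(1)]
      inverse_cancel_left[OF C mutually_inverse_sym[OF fg] h(2)] h(4) by simp
  ultimately show ?thesis
    using comp_hom[OF C f(1) h(1)] comp_hom[OF C h(2) f(2)] by (simp add: mutually_inverse_def)
qed

lemma functorD:
  assumes "is_functor C D F"
  shows "category C" "category D"
    and "x \<in> Obj C \<Longrightarrow> obj_map F x \<in> Obj D"
    and "f \<in> hom C x y \<Longrightarrow> arr_map F f \<in> hom D (obj_map F x) (obj_map F y)"
    and "x \<in> Obj C \<Longrightarrow> arr_map F (Ident C x) = Ident D (obj_map F x)"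
    and "f \<in> hom C x y \<Longrightarrow> g \<in> hom C y z \<Longrightarrow>
      arr_map F (Comp C g f) = Comp D (arr_map F g) (arr_map F f)"
  using assms by (auto simp: is_functor_def)

lemma comp_functor_simps [simp]:
  "obj_map (comp_functor G F) x = obj_map G (obj_map F x)"
  "arr_map (comp_functor G F) f = arr_map G (arr_map F f)"
  by (simp_all add: comp_functor_def)

lemma comp_functor_assoc: "comp_functor (comp_functor H G) F = comp_functor H (comp_functor G F)"
  by (simp add: comp_functor_def o_assoc)

lemma comp_functor_is_functor:
  "is_functor B C F \<Longrightarrow> is_functor C D G \<Longrightarrow> is_functor B D (comp_functor G F)"
  unfolding is_functor_def comp_functor_simps by metis

lemma functor_mutually_inverse:
  assumes F: "is_functor C D F" and fg: "mutually_inverse C x y f g"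
  shows "mutually_inverse D (obj_map F x) (obj_map F y) (arr_map F f) (arr_map F g)"
proof -
  note h = mutually_inverseD[OF fg] and C = functorD(1)[OF F]
  show ?thesis
    unfolding mutually_inverse_def
    using functorD(4)[OF F h(1)] functorD(4)[OF F h(2)] functorD(6)[OF F h(1,2)]
      functorD(6)[OF F h(2,1)] functorD(5)[OF F] hom_objD[OF C h(1)] h(3,4) by simp
qed

lemma cocone_cong:
  assumes eq: "\<And>i. i \<in> Obj I \<Longrightarrow> \<iota> i = \<iota>' i" and I: "category I"
  shows "cocone I C D c \<iota> \<longleftrightarrow> cocone I C D c \<iota>'"
proof -
  have "\<iota> i = \<iota>' i \<and> \<iota> j = \<iota>' j" if "u \<in> hom I i j" for i j u
    using eq hom_objD[OF I that] by blast
  then show ?thesis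
    unfolding cocone_def using eq by (intro conj_cong ball_cong all_cong1 imp_cong refl) auto
qed

lemma colimit_cong:
  "(\<And>i. i \<in> Obj I \<Longrightarrow> \<iota> i = \<iota>' i) \<Longrightarrow> category I \<Longrightarrow> colimit I C D c \<iota> \<longleftrightarrow> colimit I C D c \<iota>'"
  unfolding colimit_def using cocone_cong[of I \<iota> \<iota>' C D c] by simp

lemma coconeD:
  assumes "cocone I C D c \<iota>"
  shows "c \<in> Obj C" "i \<in> Obj I \<Longrightarrow> \<iota> i \<in> hom C (obj_map D i) c"
    "u \<in> hom I i j \<Longrightarrow> Comp C (\<iota> j) (arr_map D u) = \<iota> i"
  using assms by (auto simp: cocone_def)

lemma cocone_comp:
  assumes D: "is_functor I C D" and c: "cocone I C D c \<iota>" and h: "h \<in> hom C c d"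
  shows "cocone I C D d (\<lambda>i. Comp C h (\<iota> i))"
proof -
  note C = functorD(2)[OF D]
  have "Comp C (Comp C h (\<iota> j)) (arr_map D u) = Comp C h (\<iota> i)" if u: "u \<in> hom I i j" for i j u
    using comp_assoc[OF C functorD(4)[OF D u] coconeD(2)[OF c hom_objD(2)[OF functorD(1)[OF D] u]] h]
      coconeD(3)[OF c u] by simp
  then show ?thesis
    unfolding cocone_def using hom_objD(2)[OF C h] comp_hom[OF C coconeD(2)[OF c] h] by blast
qed

lemma functor_cocone:
  assumes D: "is_functor I C D" and F: "is_functor C E F" and c: "cocone I C D c \<iota>"
  shows "cocone I E (comp_functor F D) (obj_map F c) (\<lambda>i. arr_map F (\<iota> i))"
proof -
  have "Comp E (arr_map F (\<iota> j)) (arr_map F (arr_map D u)) = arr_map F (\<iota> i)"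
    if u: "u \<in> hom I i j" for i j u
    using functorD(6)[OF F functorD(4)[OF D u] coconeD(2)[OF c hom_objD(2)[OF functorD(1)[OF D] u]]]
      coconeD(3)[OF c u] by simp
  then show ?thesis
    unfolding cocone_def
    using functorD(3)[OF F coconeD(1)[OF c]] functorD(4)[OF F coconeD(2)[OF c]] by simp
qed

lemma colimit_imp_cocone: "colimit I C D c \<iota> \<Longrightarrow> cocone I C D c \<iota>"
  by (simp add: colimit_def)

lemma colimit_factor:
  assumes "colimit I C D c \<iota>" "cocone I C D c' \<iota>'"
  obtains h where "h \<in> hom C c c'" "\<And>i. i \<in> Obj I \<Longrightarrow> Comp C h (\<iota> i) = \<iota>' i"
  using assms(1)[unfolded colimit_def, THEN conjunct2, rule_format, OF assms(2)] that by blast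

lemma colimit_ext:
  assumes D: "is_functor I C D" and c: "colimit I C D c \<iota>"
    and h: "h \<in> hom C c d" and k: "k \<in> hom C c d"
    and eq: "\<And>i. i \<in> Obj I \<Longrightarrow> Comp C h (\<iota> i) = Comp C k (\<iota> i)"
  shows "h = k"
proof -
  have "cocone I C D d (\<lambda>i. Comp C h (\<iota> i))"
    by (rule cocone_comp[OF D colimit_imp_cocone[OF c] h])
  then have "\<exists>!m. m \<in> hom C c d \<and> (\<forall>i \<in> Obj I. Comp C m (\<iota> i) = Comp C h (\<iota> i))"
    by (rule c[unfolded colimit_def, THEN conjunct2, rule_format])
  then obtain m where
    m: "\<And>y. y \<in> hom C c d \<and> (\<forall>i \<in> Obj I. Comp C y (\<iota> i) = Comp C h (\<iota> i)) \<Longrightarrow> y = m"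
    by (elim ex1E) blast
  show ?thesis using m[of h] m[of k] h k eq by simp
qed

lemma colimitI:
  assumes "cocone I C D c \<iota>"
    and "\<And>d \<delta>. cocone I C D d \<delta> \<Longrightarrow> \<exists>h \<in> hom C c d. \<forall>i \<in> Obj I. Comp C h (\<iota> i) = \<delta> i"
    and "\<And>d h k. h \<in> hom C c d \<Longrightarrow> k \<in> hom C c d \<Longrightarrow>
      (\<And>i. i \<in> Obj I \<Longrightarrow> Comp C h (\<iota> i) = Comp C k (\<iota> i)) \<Longrightarrow> h = k"
  shows "colimit I C D c \<iota>"
  unfolding colimit_def
proof (intro conjI allI impI assms(1))
  fix d \<delta> assume "cocone I C D d \<delta>"
  then obtain h where h: "h \<in> hom C c d" "\<forall>i \<in> Obj I. Comp C h (\<iota> i) = \<delta> i"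
    using assms(2) by blast
  show "\<exists>!h. h \<in> hom C c d \<and> (\<forall>i \<in> Obj I. Comp C h (\<iota> i) = \<delta> i)"
  proof (rule ex1I[of _ h])
    fix k assume "k \<in> hom C c d \<and> (\<forall>i \<in> Obj I. Comp C k (\<iota> i) = \<delta> i)"
    then show "k = h" by (intro assms(3)[of k d h]) (use h in simp_all)
  qed (use h in blast)
qed

lemma colimits_isomorphic:
  assumes D: "is_functor I C D" and c: "colimit I C D c \<iota>" and d: "colimit I C D d \<delta>"
  obtains f g where "mutually_inverse C c d f g" "\<And>i. i \<in> Obj I \<Longrightarrow> Comp C f (\<iota> i) = \<delta> i"
    "\<And>i. i \<in> Obj I \<Longrightarrow> Comp C g (\<delta> i) = \<iota> i"
proof -
  note C = functorD(2)[OF D] and cc = colimit_imp_cocone[OF c] and dc = colimit_imp_cocone[OF d]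
  obtain f where f: "f \<in> hom C c d" "\<And>i. i \<in> Obj I \<Longrightarrow> Comp C f (\<iota> i) = \<delta> i"
    using colimit_factor[OF c dc] by blast
  obtain g where g: "g \<in> hom C d c" "\<And>i. i \<in> Obj I \<Longrightarrow> Comp C g (\<delta> i) = \<iota> i"
    using colimit_factor[OF d cc] by blast
  have "Comp C g f = Ident C c"
  proof (rule colimit_ext[OF D c comp_hom[OF C f(1) g(1)] ident_hom[OF C coconeD(1)[OF cc]]])
    fix i assume i: "i \<in> Obj I"
    show "Comp C (Comp C g f) (\<iota> i) = Comp C (Ident C c) (\<iota> i)"
      using comp_assoc[OF C coconeD(2)[OF cc i] f(1) g(1)] f(2)[OF i] g(2)[OF i]
        ident_left[OF C coconeD(2)[OF cc i]] by simp
  qed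
  moreover have "Comp C f g = Ident C d"
  proof (rule colimit_ext[OF D d comp_hom[OF C g(1) f(1)] ident_hom[OF C coconeD(1)[OF dc]]])
    fix i assume i: "i \<in> Obj I"
    show "Comp C (Comp C f g) (\<delta> i) = Comp C (Ident C d) (\<delta> i)"
      using comp_assoc[OF C coconeD(2)[OF dc i] g(1) f(1)] f(2)[OF i] g(2)[OF i]
        ident_left[OF C coconeD(2)[OF dc i]] by simp
  qed
  ultimately show ?thesis
    using that f g unfolding mutually_inverse_def by blast
qed

text \<open>Both the apex of a colimit and the objects of its diagram may be replaced by isomorphic
  ones; this is the form in which colimits are moved along the structural isomorphisms of a
  pseudopullback.\<close>

lemma colimit_iso_apex:
  assumes D: "is_functor I C D" and c: "colimit I C D c \<iota>" and fg: "mutually_inverse C c d f g"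
  shows "colimit I C D d (\<lambda>i. Comp C f (\<iota> i))"
proof (rule colimitI)
  note C = functorD(2)[OF D] and cc = colimit_imp_cocone[OF c] and f = mutually_inverseD[OF fg]
  show "cocone I C D d (\<lambda>i. Comp C f (\<iota> i))"
    by (rule cocone_comp[OF D cc f(1)])
  show "\<exists>h \<in> hom C d e. \<forall>i \<in> Obj I. Comp C h (Comp C f (\<iota> i)) = \<epsilon> i"
    if e: "cocone I C D e \<epsilon>" for e \<epsilon>
  proof -
    obtain h where h: "h \<in> hom C c e" "\<And>i. i \<in> Obj I \<Longrightarrow> Comp C h (\<iota> i) = \<epsilon> i"
      using colimit_factor[OF c e] by blast
    have "Comp C (Comp C h g) (Comp C f (\<iota> i)) = \<epsilon> i" if i: "i \<in> Obj I" for i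
      using comp_assoc[OF C coconeD(2)[OF cc i] f(1) comp_hom[OF C f(2) h(1)]] h(2)[OF i]
        inverse_cancel_right[OF C fg h(1)] by simp
    then show ?thesis by (intro bexI[OF _ comp_hom[OF C f(2) h(1)]] ballI)
  qed
  show "h = k" if h: "h \<in> hom C d e" and k: "k \<in> hom C d e"
    and eq: "\<And>i. i \<in> Obj I \<Longrightarrow> Comp C h (Comp C f (\<iota> i)) = Comp C k (Comp C f (\<iota> i))" for e h k
  proof -
    have "Comp C h f = Comp C k f"
    proof (rule colimit_ext[OF D c comp_hom[OF C f(1) h] comp_hom[OF C f(1) k]])
      fix i assume i: "i \<in> Obj I"
      show "Comp C (Comp C h f) (\<iota> i) = Comp C (Comp C k f) (\<iota> i)"
        using eq[OF i] comp_assoc[OF C coconeD(2)[OF cc i] f(1) h]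
          comp_assoc[OF C coconeD(2)[OF cc i] f(1) k] by simp
    qed
    then show ?thesis
      using inverse_cancel_right[OF C mutually_inverse_sym[OF fg] h]
        inverse_cancel_right[OF C mutually_inverse_sym[OF fg] k] by metis
  qed
qed

lemma colimit_iso_diagram:
  assumes D: "is_functor I C D" and D': "is_functor I C D'"
    and \<eta>: "\<And>i. i \<in> Obj I \<Longrightarrow> mutually_inverse C (obj_map D' i) (obj_map D i) (\<eta> i) (\<theta> i)"
    and nat: "\<And>i j u. u \<in> hom I i j \<Longrightarrow>
      Comp C (arr_map D u) (\<eta> i) = Comp C (\<eta> j) (arr_map D' u)"
    and c: "colimit I C D c \<iota>"
  shows "colimit I C D' c (\<lambda>i. Comp C (\<iota> i) (\<eta> i))"
proof (rule colimitI)
  note C = functorD(2)[OF D] and I = functorD(1)[OF D] and cc = colimit_imp_cocone[OF c]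
  note e = mutually_inverseD[OF \<eta>]
  show "cocone I C D' c (\<lambda>i. Comp C (\<iota> i) (\<eta> i))"
    unfolding cocone_def
  proof (intro conjI ballI allI impI)
    show "c \<in> Obj C" by (rule coconeD(1)[OF cc])
    show "Comp C (\<iota> i) (\<eta> i) \<in> hom C (obj_map D' i) c" if "i \<in> Obj I" for i
      by (rule comp_hom[OF C e(1)[OF that] coconeD(2)[OF cc that]])
    fix i j u assume u: "u \<in> hom I i j"
    note o = hom_objD[OF I u]
    show "Comp C (Comp C (\<iota> j) (\<eta> j)) (arr_map D' u) = Comp C (\<iota> i) (\<eta> i)"
      using comp_assoc[OF C functorD(4)[OF D' u] e(1)[OF o(2)] coconeD(2)[OF cc o(2)]]
        comp_assoc[OF C e(1)[OF o(1)] functorD(4)[OF D u] coconeD(2)[OF cc o(2)]]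
        coconeD(3)[OF cc u] nat[OF u] by simp
  qed
  show "\<exists>h \<in> hom C c d. \<forall>i \<in> Obj I. Comp C h (Comp C (\<iota> i) (\<eta> i)) = \<delta> i"
    if d: "cocone I C D' d \<delta>" for d \<delta>
  proof -
    have "cocone I C D d (\<lambda>i. Comp C (\<delta> i) (\<theta> i))"
      unfolding cocone_def
    proof (intro conjI ballI allI impI)
      show "d \<in> Obj C" by (rule coconeD(1)[OF d])
      show "Comp C (\<delta> i) (\<theta> i) \<in> hom C (obj_map D i) d" if "i \<in> Obj I" for i
        by (rule comp_hom[OF C e(2)[OF that] coconeD(2)[OF d that]])
      fix i j u assume u: "u \<in> hom I i j"
      note o = hom_objD[OF I u]
      note Du = functorD(4)[OF D u] and D'u = functorD(4)[OF D' u]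
      have "Comp C (\<theta> j) (arr_map D u) = Comp C (arr_map D' u) (\<theta> i)"
      proof -
        have "arr_map D u = Comp C (Comp C (arr_map D u) (\<eta> i)) (\<theta> i)"
          using inverse_cancel_right[OF C mutually_inverse_sym[OF \<eta>[OF o(1)]] Du] by simp
        also have "\<dots> = Comp C (\<eta> j) (Comp C (arr_map D' u) (\<theta> i))"
          using nat[OF u] comp_assoc[OF C e(2)[OF o(1)] D'u e(1)[OF o(2)]] by simp
        finally show ?thesis
          using inverse_cancel_left[OF C \<eta>[OF o(2)] comp_hom[OF C e(2)[OF o(1)] D'u]] by simp
      qed
      then show "Comp C (Comp C (\<delta> j) (\<theta> j)) (arr_map D u) = Comp C (\<delta> i) (\<theta> i)"
        using comp_assoc[OF C Du e(2)[OF o(2)] coconeD(2)[OF d o(2)]]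
          comp_assoc[OF C e(2)[OF o(1)] D'u coconeD(2)[OF d o(2)]] coconeD(3)[OF d u] by simp
    qed
    then obtain h where h: "h \<in> hom C c d"
      "\<And>i. i \<in> Obj I \<Longrightarrow> Comp C h (\<iota> i) = Comp C (\<delta> i) (\<theta> i)"
      using colimit_factor[OF c] by blast
    have "Comp C h (Comp C (\<iota> i) (\<eta> i)) = \<delta> i" if i: "i \<in> Obj I" for i
      using comp_assoc[OF C e(1)[OF i] coconeD(2)[OF cc i] h(1)] h(2)[OF i]
        inverse_cancel_right[OF C \<eta>[OF i] coconeD(2)[OF d i]] by simp
    then show ?thesis by (intro bexI[OF _ h(1)] ballI)
  qed
  show "h = k" if h: "h \<in> hom C c d" and k: "k \<in> hom C c d"
    and eq: "\<And>i. i \<in> Obj I \<Longrightarrow> Comp C h (Comp C (\<iota> i) (\<eta> i)) = Comp C k (Comp C (\<iota> i) (\<eta> i))"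
    for d h k
  proof (rule colimit_ext[OF D c h k])
    fix i assume i: "i \<in> Obj I"
    note ci = coconeD(2)[OF cc i]
    show "Comp C h (\<iota> i) = Comp C k (\<iota> i)"
      using eq[OF i] comp_assoc[OF C e(1)[OF i] ci h] comp_assoc[OF C e(1)[OF i] ci k]
        inverse_cancel_right[OF C mutually_inverse_sym[OF \<eta>[OF i]] comp_hom[OF C ci h]]
        inverse_cancel_right[OF C mutually_inverse_sym[OF \<eta>[OF i]] comp_hom[OF C ci k]] by metis
  qed
qed

section \<open>Small sets\<close>

lemma small_subset: "A \<subseteq> B \<Longrightarrow> small \<kappa> B \<Longrightarrow> small \<kappa> A"
  unfolding small_def using card_of_mono1 ordLeq_ordLess_trans by blast

lemma small_image: "small \<kappa> A \<Longrightarrow> small \<kappa> (f ` A)"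
  unfolding small_def using card_of_image ordLeq_ordLess_trans by blast

lemma card_less_image: "|A| <o r \<Longrightarrow> |f ` A| <o r"
  using card_of_image ordLeq_ordLess_trans by blast

lemma small_inj:
  assumes "inj_on f A" "f ` A \<subseteq> B" "small \<kappa> B"
  shows "small \<kappa> A"
  using card_of_ordLeqI[of f A B] assms ordLeq_ordLess_trans unfolding small_def by blast

lemma Cinfinite_stable: "Cinfinite r \<Longrightarrow> regularCard r \<Longrightarrow> stable r"
  by (simp add: cinfinite_def regularCard_stable)

lemma card_less_UNION:
  assumes "Cinfinite r" "regularCard r" "|A| <o r" "\<And>a. a \<in> A \<Longrightarrow> |F a| <o r"
  shows "|\<Union>a\<in>A. F a| <o r"
  using stable_UNION[OF Cinfinite_stable] assms by blast

lemma card_less_Sigma: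
  assumes "Cinfinite r" "regularCard r" "|A| <o r" "\<And>a. a \<in> A \<Longrightarrow> |F a| <o r"
  shows "|SIGMA a:A. F a| <o r"
  using stable_elim[OF Cinfinite_stable] assms by blast

lemma card_less_finite: "Cinfinite r \<Longrightarrow> finite A \<Longrightarrow> |A| <o r"
  by (metis finite_iff_ordLess_natLeq natLeq_ordLeq_cinfinite ordLess_ordLeq_trans)

lemma card_less_Un: "Cinfinite r \<Longrightarrow> |A| <o r \<Longrightarrow> |B| <o r \<Longrightarrow> |A \<union> B| <o r"
  by (rule Un_Cinfinite_bound_strict)

lemma inaccessibleD:
  assumes "inaccessible \<kappa>"
  shows "Cinfinite \<kappa>" "regularCard \<kappa>"
proof -
  have "Card_order \<kappa>" "natLeq <o \<kappa>" "regularCard \<kappa>" using assms by (auto simp: inaccessible_def)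
  moreover have "cinfinite \<kappa>"
    using \<open>natLeq <o \<kappa>\<close> natLeq_cinfinite cinfinite_mono ordLess_imp_ordLeq by blast
  ultimately show "Cinfinite \<kappa>" "regularCard \<kappa>" by auto
qed

lemma small_embeds:
  fixes \<kappa> :: "'u rel"
  assumes "inaccessible \<kappa>" "small \<kappa> A"
  obtains f :: "'x \<Rightarrow> 'u" where "inj_on f A"
proof -
  have "|A| \<le>o |Field \<kappa>|"
    using assms inaccessibleD(1)[OF assms(1)] card_of_Field_ordIso ordIso_symmetric
      ordLess_imp_ordLeq ordLeq_ordIso_trans unfolding small_def by blast
  then show thesis using card_of_ordLeq[of A "Field \<kappa>"] that by blast
qed

lemma small_Pow:
  fixes \<kappa> :: "'u rel"
  assumes \<kappa>: "inaccessible \<kappa>" and A: "small \<kappa> A"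
  shows "small \<kappa> (Pow A)"
proof -
  obtain f :: "_ \<Rightarrow> 'u" where f: "inj_on f A" using small_embeds[OF \<kappa> A] .
  have "small \<kappa> (Pow (f ` A))"
    using \<kappa> small_image[OF A, of f] unfolding inaccessible_def small_def by blast
  moreover have "inj_on ((`) f) (Pow A)" using f by (simp add: inj_on_image_Pow)
  ultimately show ?thesis using small_inj[of "(`) f" "Pow A" "Pow (f ` A)" \<kappa>] by blast
qed

lemma small_Sigma:
  assumes "inaccessible \<kappa>" "small \<kappa> A" "\<And>a. a \<in> A \<Longrightarrow> small \<kappa> (B a)"
  shows "small \<kappa> (SIGMA a:A. B a)"
  using card_less_Sigma[OF inaccessibleD[OF assms(1)]] assms(2,3) unfolding small_def by blast

lemma small_PiE:
  assumes \<kappa>: "inaccessible \<kappa>" and A: "small \<kappa> A" and B: "small \<kappa> B"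
  shows "small \<kappa> (A \<rightarrow>\<^sub>E B)"
proof -
  let ?g = "\<lambda>f. {(a, f a) | a. a \<in> A}"
  have "inj_on ?g (A \<rightarrow>\<^sub>E B)"
  proof (rule inj_onI)
    fix f h assume f: "f \<in> A \<rightarrow>\<^sub>E B" and h: "h \<in> A \<rightarrow>\<^sub>E B" and eq: "?g f = ?g h"
    have "f a = h a" if "a \<in> A" for a
      using eq that by blast
    then show "f = h" using f h by (meson PiE_ext)
  qed
  moreover have "?g ` (A \<rightarrow>\<^sub>E B) \<subseteq> Pow (A \<times> B)" by fastforce
  moreover have "small \<kappa> (Pow (A \<times> B))"
    by (rule small_Pow[OF \<kappa> small_Sigma[OF \<kappa> A B]])
  ultimately show ?thesis using small_inj by blast
qed

section \<open>Filtered categories\<close>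

lemma filteredD:
  assumes "filtered lam I"
  shows "category I"
    and "S \<subseteq> Obj I \<Longrightarrow> |S| <o lam \<Longrightarrow> \<exists>k \<in> Obj I. \<forall>i \<in> S. hom I i k \<noteq> {}"
    and "i \<in> Obj I \<Longrightarrow> j \<in> Obj I \<Longrightarrow> T \<subseteq> hom I i j \<Longrightarrow> |T| <o lam \<Longrightarrow>
      \<exists>k \<in> Obj I. \<exists>w \<in> hom I j k. \<forall>u \<in> T. \<forall>v \<in> T. Comp I w u = Comp I w v"
  using assms unfolding filtered_def by blast+

lemma filtered_mono:
  assumes "filtered mu I" "lam \<le>o mu"
  shows "filtered lam I"
  using assms ordLess_ordLeq_trans[OF _ assms(2)] unfolding filtered_def by meson

lemma filtered_bound:
  assumes I: "filtered lam I" and f: "\<And>s. s \<in> S \<Longrightarrow> f s \<in> Obj I" and S: "|S| <o lam"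
  obtains k v where "k \<in> Obj I" "\<And>s. s \<in> S \<Longrightarrow> v s \<in> hom I (f s) k"
proof -
  have "f ` S \<subseteq> Obj I" "|f ` S| <o lam"
    using f card_less_image[OF S] by auto
  then obtain k where k: "k \<in> Obj I" "\<forall>i \<in> f ` S. hom I i k \<noteq> {}"
    using filteredD(2)[OF I] by blast
  then have "\<forall>s \<in> S. \<exists>v. v \<in> hom I (f s) k" by blast
  then obtain v where "\<forall>s \<in> S. v s \<in> hom I (f s) k" using bchoice by metis
  then show thesis using that k(1) by blast
qed

text \<open>Bring the codomains together first, then coequalize the composites.\<close>

lemma filtered_span:
  assumes I: "filtered lam I" and lam: "Cinfinite lam" and i: "i \<in> Obj I"
    and u: "\<And>s. s \<in> S \<Longrightarrow> u s \<in> hom I i (j s)" and S: "|S| <o lam"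
  shows "\<exists>k w v. w \<in> hom I i k \<and> (\<forall>s \<in> S. v s \<in> hom I (j s) k \<and> Comp I (v s) (u s) = w)"
proof -
  note cI = filteredD(1)[OF I]
  let ?f = "\<lambda>s. case s of None \<Rightarrow> i | Some s \<Rightarrow> j s"
  have "|insert None (Some ` S)| <o lam"
    using card_less_Un[OF lam card_less_finite[OF lam, of "{None}"] card_less_image[OF S]] by simp
  moreover have "?f s \<in> Obj I" if "s \<in> insert None (Some ` S)" for s
    using that i hom_objD(2)[OF cI u] by auto
  ultimately obtain k v where k: "k \<in> Obj I"
    and v: "\<And>s. s \<in> insert None (Some ` S) \<Longrightarrow> v s \<in> hom I (?f s) k"
    using filtered_bound[OF I, of "insert None (Some ` S)" ?f] by blast
  have v0: "v None \<in> hom I i k" using v[of None] by simp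
  have vs: "v (Some s) \<in> hom I (j s) k" if "s \<in> S" for s using v[of "Some s"] that by simp
  let ?T = "insert (v None) ((\<lambda>s. Comp I (v (Some s)) (u s)) ` S)"
  have "|?T| <o lam"
    using card_less_Un[OF lam card_less_finite[OF lam, of "{v None}"] card_less_image[OF S]] by simp
  moreover have "?T \<subseteq> hom I i k" using v0 comp_hom[OF cI u vs] by auto
  ultimately obtain l e where e: "e \<in> hom I k l" "\<forall>a \<in> ?T. \<forall>b \<in> ?T. Comp I e a = Comp I e b"
    using filteredD(3)[OF I i k] by meson
  show ?thesis
  proof (intro exI[of _ l] exI[of _ "Comp I e (v None)"] exI[of _ "\<lambda>s. Comp I e (v (Some s))"] conjI ballI)
    show "Comp I e (v None) \<in> hom I i l" by (rule comp_hom[OF cI v0 e(1)])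
    show "Comp I e (v (Some s)) \<in> hom I (j s) l" if "s \<in> S" for s
      by (rule comp_hom[OF cI vs[OF that] e(1)])
    show "Comp I (Comp I e (v (Some s))) (u s) = Comp I e (v None)" if "s \<in> S" for s
    proof -
      have "Comp I e (Comp I (v (Some s)) (u s)) = Comp I e (v None)" using e(2) that by blast
      then show ?thesis using comp_assoc[OF cI u[OF that] vs[OF that] e(1)] by simp
    qed
  qed
qed

lemma filtered_bound2:
  assumes I: "filtered lam I" and lam: "Cinfinite lam" and i: "i \<in> Obj I" and j: "j \<in> Obj I"
  obtains k u v where "k \<in> Obj I" "u \<in> hom I i k" "v \<in> hom I j k"
proof -
  have "|{i, j}| <o lam" by (rule card_less_finite[OF lam]) simp
  then obtain k where "k \<in> Obj I" "\<forall>x \<in> {i, j}. hom I x k \<noteq> {}"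
    using filteredD(2)[OF I, of "{i, j}"] i j by blast
  then show thesis using that by blast
qed

text \<open>Small filtered categories as index categories; in contrast to filtered diagrams, their
  objects and arrows may come from arbitrary types.\<close>

definition small_filtered :: "'u rel \<Rightarrow> 'l rel \<Rightarrow> ('i, 'j) cat \<Rightarrow> bool" where
  "small_filtered \<kappa> lam I \<longleftrightarrow> small_category \<kappa> I \<and> filtered lam I"

lemma small_filtered_mono: "small_filtered \<kappa> mu I \<Longrightarrow> lam \<le>o mu \<Longrightarrow> small_filtered \<kappa> lam I"
  unfolding small_filtered_def using filtered_mono by blast

lemma small_filteredD:
  assumes "small_filtered \<kappa> lam I"
  shows "filtered lam I" "category I"
  using assms filteredD(1) unfolding small_filtered_def by blast+

section \<open>Index categories over arbitrary types\<close>

text \<open>Existence and preservation of filtered colimits speak of index categories whose objects and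
  arrows are taken from the type underlying \<open>\<kappa>\<close>. Since a small category is isomorphic to such a one,
  both carry over to small filtered categories over any types. The isomorphism is recorded as a
  functor that is bijective on objects and on arrows.\<close>

definition reindexing :: "('p, 'q) cat \<Rightarrow> ('i, 'j) cat \<Rightarrow> ('p, 'q, 'i, 'j) fctr \<Rightarrow> bool" where
  "reindexing J I R \<longleftrightarrow> is_functor J I R \<and>
     bij_betw (obj_map R) (Obj J) (Obj I) \<and> bij_betw (arr_map R) (Arr J) (Arr I)"

lemma small_category_reindexing:
  fixes \<kappa> :: "'u rel" and I :: "('i, 'j) cat"
  assumes \<kappa>: "inaccessible \<kappa>" and I: "small_category \<kappa> I"
  obtains J :: "('u, 'u) cat" and R where "small_category \<kappa> J" "reindexing J I R"
proof -
  have cI: "category I" and sO: "small \<kappa> (Obj I)" and sA: "small \<kappa> (Arr I)"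
    using I by (auto simp: small_category_def)
  obtain eo :: "'i \<Rightarrow> 'u" where eo: "inj_on eo (Obj I)" using small_embeds[OF \<kappa> sO] .
  obtain ea :: "'j \<Rightarrow> 'u" where ea: "inj_on ea (Arr I)" using small_embeds[OF \<kappa> sA] .
  define ro where "ro = the_inv_into (Obj I) eo"
  define ra where "ra = the_inv_into (Arr I) ea"
  have ro: "ro (eo x) = x" if "x \<in> Obj I" for x
    using the_inv_into_f_f[OF eo that] by (simp add: ro_def)
  have ra: "ra (ea f) = f" if "f \<in> Arr I" for f
    using the_inv_into_f_f[OF ea that] by (simp add: ra_def)
  define J :: "('u, 'u) cat" where "J =
    \<lparr>Obj = eo ` Obj I, Arr = ea ` Arr I, Dom = (\<lambda>f. eo (Dom I (ra f))),
     Cod = (\<lambda>f. eo (Cod I (ra f))), Ident = (\<lambda>x. ea (Ident I (ro x))),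
     Comp = (\<lambda>g f. ea (Comp I (ra g) (ra f)))\<rparr>"
  have hom: "hom J x y = ea ` hom I (ro x) (ro y)" if x: "x \<in> Obj J" and y: "y \<in> Obj J" for x y
  proof -
    obtain x' y' where [simp]: "x = eo x'" "y = eo y'" and o: "x' \<in> Obj I" "y' \<in> Obj I"
      using x y unfolding J_def by auto
    have "Dom I f \<in> Obj I" "Cod I f \<in> Obj I" if "f \<in> Arr I" for f
      using hom_objD[OF cI arr_in_hom[OF that]] by auto
    then have "eo (Dom I f) = eo x' \<longleftrightarrow> Dom I f = x'" "eo (Cod I f) = eo y' \<longleftrightarrow> Cod I f = y'"
      if "f \<in> Arr I" for f
      using that o inj_on_eq_iff[OF eo] by auto
    then show ?thesis using ra ro o by (auto simp: hom_def J_def)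
  qed
  have homI: "ea f \<in> hom J (eo x) (eo y)" if "f \<in> hom I x y" for f x y
    using that hom_objD[OF cI that] homD[OF that] ra by (auto simp: hom_def J_def)
  have homE: "\<exists>f' x' y'. f = ea f' \<and> x = eo x' \<and> y = eo y' \<and> f' \<in> hom I x' y'"
    if "f \<in> hom J x y" for f x y
    using that ra arr_in_hom[of _ I] by (auto simp: hom_def J_def)
  have obj: "x \<in> Obj J \<longleftrightarrow> (\<exists>x' \<in> Obj I. x = eo x')" for x by (auto simp: J_def)
  have comp: "Comp J (ea g) (ea f) = ea (Comp I g f)" if "g \<in> Arr I" "f \<in> Arr I" for g f
    using that ra by (simp add: J_def)
  have idt: "Ident J (eo x) = ea (Ident I x)" if "x \<in> Obj I" for x
    using that ro by (simp add: J_def)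
  have eo_eq: "eo x = eo y \<longleftrightarrow> x = y" if "x \<in> Obj I" "y \<in> Obj I" for x y
    using inj_on_eq_iff[OF eo] that by auto
  have cJ: "category J"
    unfolding category_def
  proof (intro conjI ballI allI impI)
    fix f assume "f \<in> Arr J"
    then show "Dom J f \<in> Obj J" "Cod J f \<in> Obj J"
      using ra hom_objD[OF cI arr_in_hom] by (auto simp: J_def)
  next
    fix x assume "x \<in> Obj J"
    then show "Ident J x \<in> hom J x x"
      using homI[OF ident_hom[OF cI]] idt obj by auto
  next
    fix x y z f g assume f: "f \<in> hom J x y" and g: "g \<in> hom J y z"
    obtain f' x' y' where f': "f = ea f'" "x = eo x'" "y = eo y'" "f' \<in> hom I x' y'"
      using homE[OF f] by blast
    obtain g' y'' z' where g': "g = ea g'" "y = eo y''" "z = eo z'" "g' \<in> hom I y'' z'"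
      using homE[OF g] by blast
    have "y'' = y'" using f'(3) g'(2) eo_eq hom_objD[OF cI f'(4)] hom_objD[OF cI g'(4)] by auto
    then show "Comp J g f \<in> hom J x z"
      using comp homI[OF comp_hom[OF cI f'(4)]] f' g' homD(1) by metis
  next
    fix x y f assume f: "f \<in> hom J x y"
    obtain f' x' y' where f': "f = ea f'" "x = eo x'" "y = eo y'" "f' \<in> hom I x' y'"
      using homE[OF f] by blast
    note o = hom_objD[OF cI f'(4)]
    show "Comp J f (Ident J x) = f" "Comp J (Ident J y) f = f"
      using f' comp idt[OF o(1)] idt[OF o(2)] homD(1)[OF f'(4)] homD(1)[OF ident_hom[OF cI o(1)]]
        homD(1)[OF ident_hom[OF cI o(2)]] ident_left[OF cI f'(4)] ident_right[OF cI f'(4)] by simp_all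
  next
    fix w x y z f g h assume f: "f \<in> hom J w x" and g: "g \<in> hom J x y" and h: "h \<in> hom J y z"
    obtain f' w' x' where f': "f = ea f'" "w = eo w'" "x = eo x'" "f' \<in> hom I w' x'"
      using homE[OF f] by blast
    obtain g' x'' y' where g': "g = ea g'" "x = eo x''" "y = eo y'" "g' \<in> hom I x'' y'"
      using homE[OF g] by blast
    obtain h' y'' z' where h': "h = ea h'" "y = eo y''" "z = eo z'" "h' \<in> hom I y'' z'"
      using homE[OF h] by blast
    have "x'' = x'" using f'(3) g'(2) eo_eq hom_objD[OF cI f'(4)] hom_objD[OF cI g'(4)] by auto
    then have g'': "g' \<in> hom I x' y'" using g'(4) by simp
    have "y'' = y'" using h'(2) g'(3) eo_eq hom_objD[OF cI h'(4)] hom_objD[OF cI g'(4)] by auto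
    then have h'': "h' \<in> hom I y' z'" using h'(4) by simp
    show "Comp J h (Comp J g f) = Comp J (Comp J h g) f"
      using comp comp_assoc[OF cI f'(4) g'' h''] f'(1) g'(1) h'(1) homD(1)[OF f'(4)] homD(1)[OF g'']
        homD(1)[OF h''] homD(1)[OF comp_hom[OF cI f'(4) g'']] homD(1)[OF comp_hom[OF cI g'' h'']]
      by simp
  qed
  define R where "R = \<lparr>obj_map = ro, arr_map = ra\<rparr>"
  have R: "is_functor J I R"
    unfolding is_functor_def R_def fctr.simps
  proof (intro conjI ballI allI impI cI cJ)
    fix x assume "x \<in> Obj J"
    then show "ro x \<in> Obj I" "ra (Ident J x) = Ident I (ro x)"
      using obj ro idt ra homD(1)[OF ident_hom[OF cI]] by auto
  next
    fix x y f assume f: "f \<in> hom J x y"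
    obtain f' x' y' where f': "f = ea f'" "x = eo x'" "y = eo y'" "f' \<in> hom I x' y'"
      using homE[OF f] by blast
    then show "ra f \<in> hom I (ro x) (ro y)"
      using ra[OF homD(1)[OF f'(4)]] ro[OF hom_objD(1)[OF cI f'(4)]] ro[OF hom_objD(2)[OF cI f'(4)]]
      by simp
  next
    fix x y z f g assume f: "f \<in> hom J x y" and g: "g \<in> hom J y z"
    obtain f' x' y' where f': "f = ea f'" "x = eo x'" "y = eo y'" "f' \<in> hom I x' y'"
      using homE[OF f] by blast
    obtain g' y'' z' where g': "g = ea g'" "y = eo y''" "z = eo z'" "g' \<in> hom I y'' z'"
      using homE[OF g] by blast
    have "y'' = y'" using f'(3) g'(2) eo_eq hom_objD[OF cI f'(4)] hom_objD[OF cI g'(4)] by auto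
    then have "g' \<in> hom I y' z'" using g'(4) by simp
    then show "ra (Comp J g f) = Comp I (ra g) (ra f)"
      using comp ra f'(1) g'(1) homD(1) f'(4) comp_hom[OF cI] by metis
  qed
  have "bij_betw ro (Obj J) (Obj I)"
    using bij_betw_the_inv_into[of eo "Obj I" "Obj J"] eo unfolding ro_def bij_betw_def J_def by auto
  moreover have "bij_betw ra (Arr J) (Arr I)"
    using bij_betw_the_inv_into[of ea "Arr I" "Arr J"] ea unfolding ra_def bij_betw_def J_def by auto
  ultimately have "reindexing J I R" using R unfolding reindexing_def R_def by simp
  moreover have "small_category \<kappa> J"
    using cJ small_image[OF sO, of eo] small_image[OF sA, of ea] unfolding small_category_def J_def
    by simp
  ultimately show thesis using that by blast
qed

lemma reindexing_obj:
  assumes "reindexing J I R" "i \<in> Obj I"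
  obtains p where "p \<in> Obj J" "obj_map R p = i"
  using assms unfolding reindexing_def bij_betw_def by (metis image_iff)

lemma reindexing_hom:
  assumes R: "reindexing J I R" and o: "p \<in> Obj J" "q \<in> Obj J"
    and u: "u \<in> hom I (obj_map R p) (obj_map R q)"
  obtains v where "v \<in> hom J p q" "arr_map R v = u"
proof -
  have F: "is_functor J I R" and inj: "inj_on (obj_map R) (Obj J)"
    using R by (auto simp: reindexing_def bij_betw_def)
  obtain v where v: "v \<in> Arr J" "arr_map R v = u"
    using R homD(1)[OF u] unfolding reindexing_def bij_betw_def by (metis image_iff)
  note h = arr_in_hom[OF v(1)]
  have "Dom J v = p"
    using homD(2)[OF u] homD(2)[OF functorD(4)[OF F h]] v(2) inj_on_eq_iff[OF inj] o(1)
      hom_objD(1)[OF functorD(1)[OF F] h] by simp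
  moreover have "Cod J v = q"
    using homD(3)[OF u] homD(3)[OF functorD(4)[OF F h]] v(2) inj_on_eq_iff[OF inj] o(2)
      hom_objD(2)[OF functorD(1)[OF F] h] by simp
  ultimately show thesis using that h v(2) by simp
qed

lemma reindexing_filtered:
  assumes R: "reindexing J I R" and I: "filtered lam I"
  shows "filtered lam J"
  unfolding filtered_def
proof (intro conjI allI impI ballI)
  have F: "is_functor J I R" and inj: "inj_on (arr_map R) (Arr J)"
    using R by (auto simp: reindexing_def bij_betw_def)
  show cJ: "category J" by (rule functorD(1)[OF F])
  show "\<exists>k \<in> Obj J. \<forall>i \<in> S. hom J i k \<noteq> {}" if S: "S \<subseteq> Obj J" "|S| <o lam" for S
  proof -
    have "obj_map R ` S \<subseteq> Obj I" using S(1) functorD(3)[OF F] by blast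
    then obtain k where k: "k \<in> Obj I" "\<forall>i \<in> obj_map R ` S. hom I i k \<noteq> {}"
      using filteredD(2)[OF I _ card_less_image[OF S(2)]] by blast
    obtain p where p: "p \<in> Obj J" "obj_map R p = k" using reindexing_obj[OF R k(1)] .
    have "hom J i p \<noteq> {}" if i: "i \<in> S" for i
    proof -
      obtain u where "u \<in> hom I (obj_map R i) (obj_map R p)" using k(2) p(2) i by blast
      then show ?thesis using reindexing_hom[OF R _ p(1)] S(1) i by blast
    qed
    then show ?thesis using p(1) by blast
  qed
  fix i j S assume o: "i \<in> Obj J" "j \<in> Obj J" and S: "S \<subseteq> hom J i j" "|S| <o lam"
  have "arr_map R ` S \<subseteq> hom I (obj_map R i) (obj_map R j)" using S(1) functorD(4)[OF F] by blast
  then obtain k w where w: "k \<in> Obj I" "w \<in> hom I (obj_map R j) k"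
    "\<forall>u \<in> arr_map R ` S. \<forall>v \<in> arr_map R ` S. Comp I w u = Comp I w v"
    using filteredD(3)[OF I functorD(3)[OF F o(1)] functorD(3)[OF F o(2)] _ card_less_image[OF S(2)]]
    by meson
  obtain p where p: "p \<in> Obj J" "obj_map R p = k" using reindexing_obj[OF R w(1)] .
  obtain x where x: "x \<in> hom J j p" "arr_map R x = w"
    using reindexing_hom[OF R o(2) p(1)] w(2) p(2) by blast
  have "Comp J x u = Comp J x v" if u: "u \<in> S" and v: "v \<in> S" for u v
  proof -
    have h: "u \<in> hom J i j" "v \<in> hom J i j" using u v S(1) by auto
    have "Comp I w (arr_map R u) = Comp I w (arr_map R v)" using w(3) u v by blast
    then have "arr_map R (Comp J x u) = arr_map R (Comp J x v)"
      unfolding functorD(6)[OF F h(1) x(1)] functorD(6)[OF F h(2) x(1)] x(2) .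
    then show ?thesis
      using inj homD(1)[OF comp_hom[OF cJ h(1) x(1)]] homD(1)[OF comp_hom[OF cJ h(2) x(1)]]
      unfolding inj_on_def by blast
  qed
  then show "\<exists>k \<in> Obj J. \<exists>w \<in> hom J j k. \<forall>u \<in> S. \<forall>v \<in> S. Comp J w u = Comp J w v"
    using p(1) x(1) by blast
qed

lemma reindexing_cocone_iff:
  assumes R: "reindexing J I R"
    and eq: "\<And>p. p \<in> Obj J \<Longrightarrow> \<delta> p = \<iota> (obj_map R p)"
  shows "cocone J C (comp_functor D R) c \<delta> \<longleftrightarrow> cocone I C D c \<iota>" (is "?l \<longleftrightarrow> ?r")
proof
  have F: "is_functor J I R" using R by (simp add: reindexing_def)
  note cJ = functorD(1)[OF F] and cI = functorD(2)[OF F]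
  show ?l if r: ?r
    unfolding cocone_def comp_functor_simps
  proof (intro conjI ballI allI impI)
    show "c \<in> Obj C" by (rule coconeD(1)[OF r])
    show "\<delta> i \<in> hom C (obj_map D (obj_map R i)) c" if "i \<in> Obj J" for i
      using coconeD(2)[OF r functorD(3)[OF F that]] eq[OF that] by simp
    show "Comp C (\<delta> j) (arr_map D (arr_map R u)) = \<delta> i" if u: "u \<in> hom J i j" for i j u
      using coconeD(3)[OF r functorD(4)[OF F u]] eq hom_objD[OF cJ u] by simp
  qed
  show ?r if l: ?l
    unfolding cocone_def
  proof (intro conjI ballI allI impI)
    show "c \<in> Obj C" by (rule coconeD(1)[OF l])
    fix i assume i: "i \<in> Obj I"
    obtain p where p: "p \<in> Obj J" "obj_map R p = i" using reindexing_obj[OF R i] .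
    then show "\<iota> i \<in> hom C (obj_map D i) c" using coconeD(2)[OF l p(1)] eq[OF p(1)] by simp
  next
    fix i j u assume u: "u \<in> hom I i j"
    note o = hom_objD[OF cI u]
    obtain p where p: "p \<in> Obj J" "obj_map R p = i" using reindexing_obj[OF R o(1)] .
    obtain q where q: "q \<in> Obj J" "obj_map R q = j" using reindexing_obj[OF R o(2)] .
    obtain v where v: "v \<in> hom J p q" "arr_map R v = u"
      using reindexing_hom[OF R p(1) q(1)] u p(2) q(2) by blast
    show "Comp C (\<iota> j) (arr_map D u) = \<iota> i"
      using coconeD(3)[OF l v(1)] eq[OF p(1)] eq[OF q(1)] p(2) q(2) v(2) by simp
  qed
qed

lemma reindexing_colimit_iff:
  assumes R: "reindexing J I R"
  shows "colimit J C (comp_functor D R) c (\<lambda>p. \<iota> (obj_map R p)) \<longleftrightarrow> colimit I C D c \<iota>"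
proof -
  let ?s = "the_inv_into (Obj J) (obj_map R)"
  have inj: "inj_on (obj_map R) (Obj J)" using R by (simp add: reindexing_def bij_betw_def)
  have s: "?s (obj_map R p) = p" if "p \<in> Obj J" for p using the_inv_into_f_f[OF inj that] .
  have F: "is_functor J I R" using R by (simp add: reindexing_def)
  have all: "(\<forall>p \<in> Obj J. P (obj_map R p)) \<longleftrightarrow> (\<forall>i \<in> Obj I. P i)" for P
    using reindexing_obj[OF R] functorD(3)[OF F] by metis
  have cc: "cocone J C (comp_functor D R) d \<delta> \<longleftrightarrow> cocone I C D d (\<lambda>i. \<delta> (?s i))" for d \<delta>
    by (rule reindexing_cocone_iff[OF R]) (simp add: s)
  have cc': "cocone J C (comp_functor D R) d (\<lambda>p. \<delta> (obj_map R p)) \<longleftrightarrow> cocone I C D d \<delta>" for d \<delta>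
    by (rule reindexing_cocone_iff[OF R]) simp
  show ?thesis
  proof
    assume l: "colimit J C (comp_functor D R) c (\<lambda>p. \<iota> (obj_map R p))"
    show "colimit I C D c \<iota>"
      unfolding colimit_def
    proof (intro conjI allI impI)
      show "cocone I C D c \<iota>" using colimit_imp_cocone[OF l] cc' by blast
      fix d \<delta> assume "cocone I C D d \<delta>"
      then have "cocone J C (comp_functor D R) d (\<lambda>p. \<delta> (obj_map R p))" using cc' by blast
      then have "\<exists>!h. h \<in> hom C c d \<and> (\<forall>p \<in> Obj J. Comp C h (\<iota> (obj_map R p)) = \<delta> (obj_map R p))"
        using l unfolding colimit_def by blast
      then show "\<exists>!h. h \<in> hom C c d \<and> (\<forall>i \<in> Obj I. Comp C h (\<iota> i) = \<delta> i)"
        using all[of "\<lambda>i. Comp C _ (\<iota> i) = \<delta> i"] by simp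
    qed
  next
    assume r: "colimit I C D c \<iota>"
    show "colimit J C (comp_functor D R) c (\<lambda>p. \<iota> (obj_map R p))"
      unfolding colimit_def
    proof (intro conjI allI impI)
      show "cocone J C (comp_functor D R) c (\<lambda>p. \<iota> (obj_map R p))"
        using colimit_imp_cocone[OF r] cc' by blast
      fix d \<delta> assume "cocone J C (comp_functor D R) d \<delta>"
      then have "cocone I C D d (\<lambda>i. \<delta> (?s i))" using cc by blast
      then have "\<exists>!h. h \<in> hom C c d \<and> (\<forall>i \<in> Obj I. Comp C h (\<iota> i) = \<delta> (?s i))"
        using r unfolding colimit_def by blast
      moreover have "(\<forall>i \<in> Obj I. Comp C h (\<iota> i) = \<delta> (?s i)) \<longleftrightarrow>
          (\<forall>p \<in> Obj J. Comp C h (\<iota> (obj_map R p)) = \<delta> p)" for h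
        using all[of "\<lambda>i. Comp C h (\<iota> i) = \<delta> (?s i)", symmetric] s by simp
      ultimately show "\<exists>!h. h \<in> hom C c d \<and> (\<forall>p \<in> Obj J. Comp C h (\<iota> (obj_map R p)) = \<delta> p)"
        by simp
    qed
  qed
qed

lemma small_filtered_reindexing:
  fixes \<kappa> :: "'u rel" and I :: "('i, 'j) cat"
  assumes \<kappa>: "inaccessible \<kappa>" and I: "small_filtered \<kappa> lam I" and D: "is_functor I C D"
  obtains J :: "('u, 'u) cat" and R where "reindexing J I R"
    "filtered_diagram \<kappa> lam J C (comp_functor D R)"
proof -
  obtain J :: "('u, 'u) cat" and R where J: "small_category \<kappa> J" "reindexing J I R"
    using small_category_reindexing[OF \<kappa>] I unfolding small_filtered_def by blast
  then have "filtered_diagram \<kappa> lam J C (comp_functor D R)"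
    using comp_functor_is_functor[OF _ D, of J R] reindexing_filtered[OF J(2) small_filteredD(1)[OF I]]
    unfolding filtered_diagram_def reindexing_def by blast
  then show thesis using that J(2) by blast
qed

lemma filtered_colimit_exists:
  assumes \<kappa>: "inaccessible \<kappa>" and C: "has_filtered_colimits \<kappa> lam C"
    and I: "small_filtered \<kappa> lam I" and D: "is_functor I C D"
  obtains c \<iota> where "colimit I C D c \<iota>"
proof -
  obtain J R where J: "reindexing J I R" "filtered_diagram \<kappa> lam J C (comp_functor D R)"
    using small_filtered_reindexing[OF \<kappa> I D] .
  then obtain c \<delta> where c: "colimit J C (comp_functor D R) c \<delta>"
    using C unfolding has_filtered_colimits_def by blast
  let ?s = "the_inv_into (Obj J) (obj_map R)"
  have inj: "inj_on (obj_map R) (Obj J)" and F: "is_functor J I R"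
    using J(1) by (simp_all add: reindexing_def bij_betw_def)
  have "colimit J C (comp_functor D R) c (\<lambda>p. \<delta> (?s (obj_map R p)))"
    by (rule colimit_cong[THEN iffD1, OF _ functorD(1)[OF F] c]) (simp add: the_inv_into_f_f[OF inj])
  then have "colimit I C D c (\<lambda>i. \<delta> (?s i))"
    using reindexing_colimit_iff[OF J(1), of C D c "\<lambda>i. \<delta> (?s i)"] by simp
  then show thesis using that by blast
qed

lemma filtered_colimit_preserved:
  assumes \<kappa>: "inaccessible \<kappa>" and F: "preserves_filtered_colimits \<kappa> lam C E F"
    and I: "small_filtered \<kappa> lam I" and D: "is_functor I C D" and c: "colimit I C D c \<iota>"
  shows "colimit I E (comp_functor F D) (obj_map F c) (\<lambda>i. arr_map F (\<iota> i))"
proof -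
  obtain J R where J: "reindexing J I R" "filtered_diagram \<kappa> lam J C (comp_functor D R)"
    using small_filtered_reindexing[OF \<kappa> I D] .
  have "colimit J C (comp_functor D R) c (\<lambda>p. \<iota> (obj_map R p))"
    using reindexing_colimit_iff[OF J(1)] c by (rule iffD2)
  then have "colimit J E (comp_functor F (comp_functor D R)) (obj_map F c)
      (arr_map F \<circ> (\<lambda>p. \<iota> (obj_map R p)))"
    by (rule F[unfolded preserves_filtered_colimits_def, rule_format, OF J(2)])
  then have "colimit J E (comp_functor (comp_functor F D) R) (obj_map F c)
      (\<lambda>p. arr_map F (\<iota> (obj_map R p)))"
    by (simp add: comp_functor_assoc comp_def)
  then show ?thesis
    using reindexing_colimit_iff[OF J(1), of E "comp_functor F D" _ "\<lambda>i. arr_map F (\<iota> i)"] by simp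
qed

section \<open>Presentable objects, stage by stage\<close>

text \<open>The elementwise form of the statement that \<open>hom(A, -)\<close> turns a cocone over a filtered diagram into
  a colimit of sets: the canonical map from the colimit of the sets \<open>hom(A, D i)\<close> to \<open>hom(A, c)\<close> is
  surjective and injective.\<close>

definition stagewise ::
  "('o, 'a) cat \<Rightarrow> ('i, 'j) cat \<Rightarrow> ('i, 'j, 'o, 'a) fctr \<Rightarrow> 'o \<Rightarrow> ('i \<Rightarrow> 'a) \<Rightarrow> 'o \<Rightarrow> bool" where
  "stagewise C I D c \<iota> A \<longleftrightarrow>
     (\<forall>x \<in> hom C A c. \<exists>i \<in> Obj I. \<exists>y \<in> hom C A (obj_map D i). Comp C (\<iota> i) y = x) \<and>
     (\<forall>i \<in> Obj I. \<forall>y \<in> hom C A (obj_map D i). \<forall>z \<in> hom C A (obj_map D i).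
        Comp C (\<iota> i) y = Comp C (\<iota> i) z \<longrightarrow>
        (\<exists>j \<in> Obj I. \<exists>u \<in> hom I i j. Comp C (arr_map D u) y = Comp C (arr_map D u) z))"

lemma stagewise_factor:
  assumes "stagewise C I D c \<iota> A" "x \<in> hom C A c"
  obtains i y where "i \<in> Obj I" "y \<in> hom C A (obj_map D i)" "Comp C (\<iota> i) y = x"
  using assms unfolding stagewise_def by blast

lemma stagewise_equalize:
  assumes "stagewise C I D c \<iota> A" "i \<in> Obj I" "y \<in> hom C A (obj_map D i)"
    "z \<in> hom C A (obj_map D i)" "Comp C (\<iota> i) y = Comp C (\<iota> i) z"
  obtains j u where "j \<in> Obj I" "u \<in> hom I i j" "Comp C (arr_map D u) y = Comp C (arr_map D u) z"
  using assms unfolding stagewise_def by blast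

lemma hom_Sets: "hom (Sets \<kappa>) X Y = {(X, f, Y) | f. small \<kappa> X \<and> small \<kappa> Y \<and> f \<in> X \<rightarrow>\<^sub>E Y}"
  by (auto simp: hom_def Sets_def)

lemma Comp_Sets: "Comp (Sets \<kappa>) (Y, g, Z) (X, f, Y') = (X, compose X g f, Z)"
  by (simp add: Sets_def)

lemma Obj_Sets: "Obj (Sets \<kappa>) = {X. small \<kappa> X}"
  by (simp add: Sets_def)

lemma obj_hom_functor: "obj_map (hom_functor C A) X = Inl ` hom C A X"
  by (simp add: hom_functor_def)

lemma arr_hom_functor:
  "u \<in> hom C X Y \<Longrightarrow> arr_map (hom_functor C A) u =
     (Inl ` hom C A X, restrict (\<lambda>z. Inl (Comp C u (projl z))) (Inl ` hom C A X), Inl ` hom C A Y)"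
  using homD[of u C X Y] by (simp add: hom_functor_def)

text \<open>The defining colimit property of \<open>hom(A, -)\<close> can be tested by cocones into a two-element set:
  the characteristic function of the set of arrows that factor through a stage shows that all do,
  and the characteristic function of the arrows that agree with \<open>y\<close> at a later stage separates
  \<open>y\<close> from everything that it is not eventually identified with.\<close>

lemma hom_functor_colimit_iff_stagewise:
  fixes \<kappa> :: "'u rel" and C :: "('o, 'a) cat" and I :: "('i, 'j) cat"
  assumes \<kappa>: "inaccessible \<kappa>" and C: "class_category \<kappa> C" and lam: "Cinfinite lam"
    and I: "filtered lam I" and D: "is_functor I C D" and c: "cocone I C D c \<iota>" and A: "A \<in> Obj C"
  shows "colimit I (Sets \<kappa>) (comp_functor (hom_functor C A :: ('o, 'a, ('a + 'u) set, _) fctr) D)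
      (obj_map (hom_functor C A) c) (\<lambda>i. arr_map (hom_functor C A) (\<iota> i)) \<longleftrightarrow> stagewise C I D c \<iota> A"
    (is "colimit I _ ?H ?c ?\<iota> \<longleftrightarrow> _")
proof
  note cC = functorD(2)[OF D] and cI = functorD(1)[OF D]
  have leg: "\<iota> i \<in> hom C (obj_map D i) c" if "i \<in> Obj I" for i by (rule coconeD(2)[OF c that])
  have Du: "arr_map D u \<in> hom C (obj_map D i) (obj_map D j)" if "u \<in> hom I i j" for u i j
    by (rule functorD(4)[OF D that])
  have sm: "small \<kappa> (Inl ` hom C A X :: ('a + 'u) set)" if "X \<in> Obj C" for X
    using C A that unfolding class_category_def by (intro small_image) auto
  have smD: "small \<kappa> (Inl ` hom C A (obj_map D i) :: ('a + 'u) set)" if "i \<in> Obj I" for i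
    by (rule sm[OF functorD(3)[OF D that]])
  have smc: "small \<kappa> (Inl ` hom C A c :: ('a + 'u) set)" by (rule sm[OF coconeD(1)[OF c]])
  have H: "obj_map ?H i = Inl ` hom C A (obj_map D i)" for i by (simp add: obj_hom_functor)
  have arrH: "arr_map ?H u = (Inl ` hom C A (obj_map D i),
      restrict (\<lambda>z. Inl (Comp C (arr_map D u) (projl z))) (Inl ` hom C A (obj_map D i)),
      Inl ` hom C A (obj_map D j))" if "u \<in> hom I i j" for u i j
    using arr_hom_functor[OF Du[OF that]] by simp
  have leg': "?\<iota> i = (Inl ` hom C A (obj_map D i),
      restrict (\<lambda>z. Inl (Comp C (\<iota> i) (projl z))) (Inl ` hom C A (obj_map D i)),
      Inl ` hom C A c)" if "i \<in> Obj I" for i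
    by (rule arr_hom_functor[OF leg[OF that]])
  {
    assume col: "colimit I (Sets \<kappa>) ?H ?c ?\<iota>"
    obtain p q :: 'u where pq: "p \<noteq> q"
    proof -
      have "infinite (Field \<kappa>)" using inaccessibleD(1)[OF \<kappa>] by (simp add: cinfinite_def)
      then obtain p where "p \<in> Field \<kappa>" using infinite_imp_nonempty by blast
      moreover obtain q where "q \<in> Field \<kappa> - {p}"
        using infinite_imp_nonempty[OF infinite_remove[OF \<open>infinite (Field \<kappa>)\<close>, of p]] by blast
      ultimately show thesis using that[of p q] by blast
    qed
    \<comment> \<open>\<open>lift P X\<close> is the function from \<open>hom(A, X)\<close> to the two-element set \<open>B\<close> with truth value \<open>P\<close>.\<close>
    define B :: "('a + 'u) set" where "B = {Inr p, Inr q}"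
    define b :: "bool \<Rightarrow> 'a + 'u" where "b = (\<lambda>t. if t then Inr p else Inr q)"
    have b: "b t \<in> B" "b s = b t \<longleftrightarrow> s = t" for s t using pq by (auto simp: b_def B_def)
    have smB: "small \<kappa> B"
      unfolding small_def by (rule card_less_finite[OF inaccessibleD(1)[OF \<kappa>]]) (simp add: B_def)
    define lift :: "('a \<Rightarrow> bool) \<Rightarrow> 'o \<Rightarrow> ('a + 'u) set \<times> ('a + 'u \<Rightarrow> 'a + 'u) \<times> ('a + 'u) set"
      where "lift P X = (Inl ` hom C A X, restrict (\<lambda>z. b (P (projl z))) (Inl ` hom C A X), B)" for P X
    have lift_hom: "lift P X \<in> hom (Sets \<kappa>) (Inl ` hom C A X) B" if "X \<in> Obj C" for P X
      using sm[OF that] smB b(1) by (auto simp: hom_Sets lift_def)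
    have lift_comp: "Comp (Sets \<kappa>) (lift P Y)
        (Inl ` hom C A X, restrict (\<lambda>z. Inl (Comp C u (projl z))) (Inl ` hom C A X), Inl ` hom C A Y) =
        lift (\<lambda>z. P (Comp C u z)) X" if "u \<in> hom C X Y" for P u X Y
      unfolding lift_def Comp_Sets compose_def using comp_hom[OF cC _ that]
      by (auto intro!: restrict_ext)
    have lift_eq: "lift P X = lift Q X \<longleftrightarrow> (\<forall>z \<in> hom C A X. P z = Q z)" for P Q X
      unfolding lift_def by (auto simp: restrict_def fun_eq_iff b(2))
    have "\<exists>i \<in> Obj I. \<exists>y \<in> hom C A (obj_map D i). Comp C (\<iota> i) y = x" if x: "x \<in> hom C A c" for x
    proof -
      let ?P = "\<lambda>x. \<exists>i \<in> Obj I. \<exists>y \<in> hom C A (obj_map D i). Comp C (\<iota> i) y = x"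
      \<comment> \<open>The constant truth value and the characteristic function of \<open>?P\<close> induce the same cocone.\<close>
      have co: "cocone I (Sets \<kappa>) ?H B (\<lambda>i. lift (\<lambda>_. True) (obj_map D i))"
        unfolding cocone_def
      proof (intro conjI ballI allI impI)
        show "B \<in> Obj (Sets \<kappa>)" using smB by (simp add: Obj_Sets)
        show "lift (\<lambda>_. True) (obj_map D i) \<in> hom (Sets \<kappa>) (obj_map ?H i) B" if "i \<in> Obj I" for i
          unfolding H by (rule lift_hom[OF functorD(3)[OF D that]])
        show "Comp (Sets \<kappa>) (lift (\<lambda>_. True) (obj_map D j)) (arr_map ?H u) =
          lift (\<lambda>_. True) (obj_map D i)" if "u \<in> hom I i j" for i j u
          unfolding arrH[OF that] lift_comp[OF Du[OF that]] ..
      qed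
      have ex1: "\<exists>!h. h \<in> hom (Sets \<kappa>) ?c B \<and>
          (\<forall>i \<in> Obj I. Comp (Sets \<kappa>) h (?\<iota> i) = lift (\<lambda>_. True) (obj_map D i))"
        by (rule col[unfolded colimit_def, THEN conjunct2, rule_format, OF co])
      have sol: "lift Q c \<in> hom (Sets \<kappa>) ?c B \<and>
          (\<forall>i \<in> Obj I. Comp (Sets \<kappa>) (lift Q c) (?\<iota> i) = lift (\<lambda>_. True) (obj_map D i))"
        if Q: "\<And>i y. i \<in> Obj I \<Longrightarrow> y \<in> hom C A (obj_map D i) \<Longrightarrow> Q (Comp C (\<iota> i) y)" for Q
      proof (intro conjI ballI)
        show "lift Q c \<in> hom (Sets \<kappa>) ?c B"
          unfolding obj_hom_functor by (rule lift_hom[OF coconeD(1)[OF c]])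
        fix i assume i: "i \<in> Obj I"
        show "Comp (Sets \<kappa>) (lift Q c) (?\<iota> i) = lift (\<lambda>_. True) (obj_map D i)"
          unfolding leg'[OF i] lift_comp[OF leg[OF i]] lift_eq using Q[OF i] by simp
      qed
      obtain h where h: "\<And>k. k \<in> hom (Sets \<kappa>) ?c B \<and>
          (\<forall>i \<in> Obj I. Comp (Sets \<kappa>) k (?\<iota> i) = lift (\<lambda>_. True) (obj_map D i)) \<Longrightarrow> k = h"
        using ex1 by (elim ex1E) blast
      have "lift ?P c = h" by (rule h[OF sol]) blast
      moreover have "lift (\<lambda>_. True) c = h" by (rule h[OF sol]) simp
      ultimately have "lift ?P c = lift (\<lambda>_. True) c" by simp
      then show ?thesis unfolding lift_eq using x by simp
    qed
    moreover have "\<exists>j \<in> Obj I. \<exists>u \<in> hom I i j. Comp C (arr_map D u) y = Comp C (arr_map D u) z"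
      if i: "i \<in> Obj I" and y: "y \<in> hom C A (obj_map D i)" and z: "z \<in> hom C A (obj_map D i)"
        and eq: "Comp C (\<iota> i) y = Comp C (\<iota> i) z" for i y z
    proof -
      \<comment> \<open>\<open>P j t\<close>: the arrow \<open>t\<close> at stage \<open>j\<close> is identified with \<open>y\<close> at some later stage. This is compatible
        with the transitions, so it descends to the colimit, where \<open>y\<close> and \<open>z\<close> agree.\<close>
      define P where "P j t \<longleftrightarrow> (\<exists>k u v. u \<in> hom I i k \<and> v \<in> hom I j k \<and>
        Comp C (arr_map D u) y = Comp C (arr_map D v) t)" for j t
      have P: "P k (Comp C (arr_map D w) t) \<longleftrightarrow> P j t"
        if w: "w \<in> hom I j k" and t: "t \<in> hom C A (obj_map D j)" for w j k t
      proof
        assume "P k (Comp C (arr_map D w) t)"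
        then obtain l u v where l: "u \<in> hom I i l" "v \<in> hom I k l"
          "Comp C (arr_map D u) y = Comp C (arr_map D v) (Comp C (arr_map D w) t)"
          unfolding P_def by blast
        have "Comp C (arr_map D u) y = Comp C (arr_map D (Comp I v w)) t"
          unfolding functorD(6)[OF D w l(2)] l(3) by (rule comp_assoc[OF cC t Du[OF w] Du[OF l(2)]])
        then show "P j t" unfolding P_def using l(1) comp_hom[OF cI w l(2)] by blast
      next
        assume "P j t"
        then obtain l u v where l: "u \<in> hom I i l" "v \<in> hom I j l"
          "Comp C (arr_map D u) y = Comp C (arr_map D v) t"
          unfolding P_def by blast
        let ?j = "\<lambda>b. if b then l else k" and ?v = "\<lambda>b. if b then v else w"
        have "?v b \<in> hom I j (?j b)" for b using w l(2) by simp
        then obtain m e f where m: "e \<in> hom I j m" "\<And>b. f b \<in> hom I (?j b) m"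
          "\<And>b. Comp I (f b) (?v b) = e"
          using filtered_span[OF I lam hom_objD(1)[OF cI w], of UNIV ?v ?j]
            card_less_finite[OF lam, of "UNIV :: bool set"] by (metis UNIV_I finite)
        have f: "f True \<in> hom I l m" "f False \<in> hom I k m" using m(2)[of True] m(2)[of False] by auto
        have e: "Comp I (f True) v = e" "Comp I (f False) w = e" using m(3)[of True] m(3)[of False] by auto
        have "Comp C (arr_map D (Comp I (f True) u)) y =
            Comp C (arr_map D (f True)) (Comp C (arr_map D v) t)"
          unfolding functorD(6)[OF D l(1) f(1)] l(3)[symmetric]
          by (rule comp_assoc[OF cC y Du[OF l(1)] Du[OF f(1)], symmetric])
        also have "\<dots> = Comp C (arr_map D e) t"
          unfolding e(1)[symmetric] functorD(6)[OF D l(2) f(1)]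
          by (rule comp_assoc[OF cC t Du[OF l(2)] Du[OF f(1)]])
        also have "\<dots> = Comp C (arr_map D (f False)) (Comp C (arr_map D w) t)"
          unfolding e(2)[symmetric] functorD(6)[OF D w f(2)]
          by (rule comp_assoc[OF cC t Du[OF w] Du[OF f(2)], symmetric])
        finally show "P k (Comp C (arr_map D w) t)"
          unfolding P_def using comp_hom[OF cI l(1) f(1)] f(2) by blast
      qed
      have "cocone I (Sets \<kappa>) ?H B (\<lambda>j. lift (P j) (obj_map D j))"
        unfolding cocone_def
      proof (intro conjI ballI allI impI)
        show "B \<in> Obj (Sets \<kappa>)" using smB by (simp add: Obj_Sets)
        show "lift (P j) (obj_map D j) \<in> hom (Sets \<kappa>) (obj_map ?H j) B" if "j \<in> Obj I" for j
          unfolding H by (rule lift_hom[OF functorD(3)[OF D that]])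
        show "Comp (Sets \<kappa>) (lift (P k) (obj_map D k)) (arr_map ?H u) = lift (P j) (obj_map D j)"
          if "u \<in> hom I j k" for j k u
          unfolding arrH[OF that] lift_comp[OF Du[OF that]] lift_eq using P[OF that] by simp
      qed
      then obtain h where h: "h \<in> hom (Sets \<kappa>) ?c B"
        "\<And>j. j \<in> Obj I \<Longrightarrow> Comp (Sets \<kappa>) h (?\<iota> j) = lift (P j) (obj_map D j)"
        using colimit_factor[OF col] by blast
      obtain hf where hf: "h = (?c, hf, B)" using h(1) unfolding hom_Sets by blast
      have "hf (Inl (Comp C (\<iota> i) t)) = b (P i t)" if t: "t \<in> hom C A (obj_map D i)" for t
      proof -
        let ?X = "Inl ` hom C A (obj_map D i) :: ('a + 'u) set"
        have "compose ?X hf (restrict (\<lambda>z. Inl (Comp C (\<iota> i) (projl z))) ?X) =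
            restrict (\<lambda>z. b (P i (projl z))) ?X"
          using h(2)[OF i] unfolding leg'[OF i] hf Comp_Sets lift_def by simp
        from fun_cong[OF this, of "Inl t"] show ?thesis using t by (simp add: compose_def)
      qed
      from this[OF y] this[OF z] have "P i y = P i z" using eq b(2) by simp
      moreover have "P i y" unfolding P_def using ident_hom[OF cI i] by blast
      ultimately obtain k u v where k: "u \<in> hom I i k" "v \<in> hom I i k"
        "Comp C (arr_map D u) y = Comp C (arr_map D v) z" unfolding P_def by blast
      note ok = hom_objD(2)[OF cI k(1)]
      obtain l w where l: "l \<in> Obj I" "w \<in> hom I k l" "Comp I w u = Comp I w v"
        using filteredD(3)[OF I i ok, of "{u, v}"] k card_less_finite[OF lam, of "{u, v}"] by auto
      have "Comp C (arr_map D (Comp I w u)) y = Comp C (arr_map D (Comp I w v)) z"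
        unfolding functorD(6)[OF D k(1) l(2)] functorD(6)[OF D k(2) l(2)]
        using comp_assoc[OF cC y Du[OF k(1)] Du[OF l(2)]] comp_assoc[OF cC z Du[OF k(2)] Du[OF l(2)]]
          k(3) by simp
      then show ?thesis using l comp_hom[OF cI k(1) l(2)] by auto
    qed
    ultimately show "stagewise C I D c \<iota> A" unfolding stagewise_def by blast
  next
    assume st: "stagewise C I D c \<iota> A"
    show "colimit I (Sets \<kappa>) ?H ?c ?\<iota>"
    proof (rule colimitI)
      show "cocone I (Sets \<kappa>) ?H ?c ?\<iota>"
        unfolding cocone_def
      proof (intro conjI ballI allI impI)
        show "?c \<in> Obj (Sets \<kappa>)" using smc by (simp add: obj_hom_functor Obj_Sets)
        show "?\<iota> i \<in> hom (Sets \<kappa>) (obj_map ?H i) ?c" if "i \<in> Obj I" for i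
          unfolding leg'[OF that] H obj_hom_functor hom_Sets
          using smD[OF that] smc comp_hom[OF cC _ leg[OF that]] by auto
        fix i j u assume u: "u \<in> hom I i j"
        note o = hom_objD[OF cI u]
        have "Comp C (\<iota> j) (Comp C (arr_map D u) z) = Comp C (\<iota> i) z"
          if "z \<in> hom C A (obj_map D i)" for z
          using comp_assoc[OF cC that Du[OF u] leg[OF o(2)]] coconeD(3)[OF c u] by simp
        then show "Comp (Sets \<kappa>) (?\<iota> j) (arr_map ?H u) = ?\<iota> i"
          unfolding leg'[OF o(1)] leg'[OF o(2)] arrH[OF u] Comp_Sets compose_def
          using comp_hom[OF cC _ Du[OF u]] by (auto intro!: restrict_ext)
      qed
    next
      fix d \<delta> assume d: "cocone I (Sets \<kappa>) ?H d \<delta>"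
      have smd: "small \<kappa> d" using coconeD(1)[OF d] by (simp add: Obj_Sets)
      have "\<exists>f. \<delta> i = (Inl ` hom C A (obj_map D i), f, d) \<and> f \<in> Inl ` hom C A (obj_map D i) \<rightarrow>\<^sub>E d"
        if "i \<in> Obj I" for i
        using coconeD(2)[OF d that] unfolding hom_Sets H by blast
      then obtain \<phi> where \<phi>: "\<And>i. i \<in> Obj I \<Longrightarrow> \<delta> i = (Inl ` hom C A (obj_map D i), \<phi> i, d)"
        "\<And>i. i \<in> Obj I \<Longrightarrow> \<phi> i \<in> Inl ` hom C A (obj_map D i) \<rightarrow>\<^sub>E d" by metis
      have nat: "\<phi> j (Inl (Comp C (arr_map D u) z)) = \<phi> i (Inl z)"
        if u: "u \<in> hom I i j" and z: "z \<in> hom C A (obj_map D i)" for i j u z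
      proof -
        note o = hom_objD[OF cI u]
        let ?X = "Inl ` hom C A (obj_map D i) :: ('a + 'u) set"
        have "compose ?X (\<phi> j) (restrict (\<lambda>z. Inl (Comp C (arr_map D u) (projl z))) ?X) = \<phi> i"
          using coconeD(3)[OF d u] unfolding \<phi>(1)[OF o(1)] \<phi>(1)[OF o(2)] arrH[OF u] Comp_Sets by simp
        from fun_cong[OF this, of "Inl z"] show ?thesis using z by (simp add: compose_def)
      qed
      have wd: "\<phi> i (Inl y) = \<phi> j (Inl z)"
        if i: "i \<in> Obj I" and j: "j \<in> Obj I" and y: "y \<in> hom C A (obj_map D i)"
          and z: "z \<in> hom C A (obj_map D j)" and eq: "Comp C (\<iota> i) y = Comp C (\<iota> j) z" for i j y z
      proof -
        obtain k u v where k: "k \<in> Obj I" "u \<in> hom I i k" "v \<in> hom I j k"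
          using filtered_bound2[OF I lam i j] .
        have y': "Comp C (arr_map D u) y \<in> hom C A (obj_map D k)" by (rule comp_hom[OF cC y Du[OF k(2)]])
        have z': "Comp C (arr_map D v) z \<in> hom C A (obj_map D k)" by (rule comp_hom[OF cC z Du[OF k(3)]])
        have "Comp C (\<iota> k) (Comp C (arr_map D u) y) = Comp C (\<iota> k) (Comp C (arr_map D v) z)"
          using comp_assoc[OF cC y Du[OF k(2)] leg[OF k(1)]] comp_assoc[OF cC z Du[OF k(3)] leg[OF k(1)]]
            coconeD(3)[OF c k(2)] coconeD(3)[OF c k(3)] eq by simp
        then obtain l w where l: "w \<in> hom I k l" "Comp C (arr_map D w) (Comp C (arr_map D u) y) =
            Comp C (arr_map D w) (Comp C (arr_map D v) z)"
          using stagewise_equalize[OF st k(1) y' z'] by blast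
        show ?thesis using nat[OF k(2) y] nat[OF k(3) z] nat[OF l(1) y'] nat[OF l(1) z'] l(2) by simp
      qed
      \<comment> \<open>The value at \<open>x\<close> is computed at any stage through which \<open>x\<close> factors.\<close>
      define \<chi> where "\<chi> x = (SOME r. \<exists>i y. i \<in> Obj I \<and> y \<in> hom C A (obj_map D i) \<and>
        Comp C (\<iota> i) y = x \<and> r = \<phi> i (Inl y))" for x
      have \<chi>: "\<chi> (Comp C (\<iota> i) y) = \<phi> i (Inl y)"
        if i: "i \<in> Obj I" and y: "y \<in> hom C A (obj_map D i)" for i y
      proof -
        have "\<exists>r j z. j \<in> Obj I \<and> z \<in> hom C A (obj_map D j) \<and>
            Comp C (\<iota> j) z = Comp C (\<iota> i) y \<and> r = \<phi> j (Inl z)" using i y by blast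
        from someI_ex[OF this] obtain j z where "j \<in> Obj I" "z \<in> hom C A (obj_map D j)"
            "Comp C (\<iota> j) z = Comp C (\<iota> i) y" "\<chi> (Comp C (\<iota> i) y) = \<phi> j (Inl z)"
          unfolding \<chi>_def by blast
        then show ?thesis using wd[OF i _ y] by metis
      qed
      have \<chi>d: "\<chi> x \<in> d" if x: "x \<in> hom C A c" for x
      proof -
        obtain i y where i: "i \<in> Obj I" "y \<in> hom C A (obj_map D i)" "Comp C (\<iota> i) y = x"
          using stagewise_factor[OF st x] .
        then show ?thesis using \<chi>[OF i(1,2)] \<phi>(2)[OF i(1)] by auto
      qed
      let ?c' = "Inl ` hom C A c :: ('a + 'u) set"
      let ?h = "(?c', restrict (\<lambda>x. \<chi> (projl x)) ?c', d)"
      have "?h \<in> hom (Sets \<kappa>) ?c d"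
        using smc smd \<chi>d by (auto simp: hom_Sets obj_hom_functor)
      moreover have "Comp (Sets \<kappa>) ?h (?\<iota> i) = \<delta> i" if i: "i \<in> Obj I" for i
      proof -
        let ?X = "Inl ` hom C A (obj_map D i) :: ('a + 'u) set"
        have "compose ?X (restrict (\<lambda>x. \<chi> (projl x)) (Inl ` hom C A c :: ('a + 'u) set))
          (restrict (\<lambda>z. Inl (Comp C (\<iota> i) (projl z))) ?X) z = \<phi> i z" for z
        proof (cases "z \<in> ?X")
          case True
          then obtain y where y: "z = Inl y" "y \<in> hom C A (obj_map D i)" by blast
          have "Inl (Comp C (\<iota> i) y) \<in> (Inl ` hom C A c :: ('a + 'u) set)"
            using comp_hom[OF cC y(2) leg[OF i]] by (rule imageI)
          then show ?thesis using True y \<chi>[OF i y(2)] by (simp add: compose_def)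
        next
          case False
          then show ?thesis using PiE_arb[OF \<phi>(2)[OF i]] by (simp add: compose_def)
        qed
        then have "compose ?X (restrict (\<lambda>x. \<chi> (projl x)) (Inl ` hom C A c :: ('a + 'u) set))
          (restrict (\<lambda>z. Inl (Comp C (\<iota> i) (projl z))) ?X) = \<phi> i" by (rule ext)
        then show ?thesis unfolding leg'[OF i] \<phi>(1)[OF i] Comp_Sets by simp
      qed
      ultimately show "\<exists>h \<in> hom (Sets \<kappa>) ?c d. \<forall>i \<in> Obj I. Comp (Sets \<kappa>) h (?\<iota> i) = \<delta> i" by blast
    next
      fix d h k assume h: "h \<in> hom (Sets \<kappa>) ?c d" and k: "k \<in> hom (Sets \<kappa>) ?c d"
        and eq: "\<And>i. i \<in> Obj I \<Longrightarrow> Comp (Sets \<kappa>) h (?\<iota> i) = Comp (Sets \<kappa>) k (?\<iota> i)"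
      obtain hf where hf: "h = (?c, hf, d)" "hf \<in> ?c \<rightarrow>\<^sub>E d" using h unfolding hom_Sets by blast
      obtain kf where kf: "k = (?c, kf, d)" "kf \<in> ?c \<rightarrow>\<^sub>E d" using k unfolding hom_Sets by blast
      have "hf x = kf x" if x: "x \<in> ?c" for x
      proof -
        obtain x' where x': "x = Inl x'" "x' \<in> hom C A c" using x unfolding obj_hom_functor by blast
        obtain i y where i: "i \<in> Obj I" "y \<in> hom C A (obj_map D i)" "Comp C (\<iota> i) y = x'"
          using stagewise_factor[OF st x'(2)] .
        let ?X = "Inl ` hom C A (obj_map D i) :: ('a + 'u) set"
        have "compose ?X hf (restrict (\<lambda>z. Inl (Comp C (\<iota> i) (projl z))) ?X) =
            compose ?X kf (restrict (\<lambda>z. Inl (Comp C (\<iota> i) (projl z))) ?X)"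
          using eq[OF i(1)] unfolding leg'[OF i(1)] hf(1) kf(1) Comp_Sets by simp
        from fun_cong[OF this, of "Inl y"] show ?thesis using i x'(1) by (simp add: compose_def)
      qed
      then have "hf = kf" using hf(2) kf(2) by (meson PiE_ext)
      then show "h = k" using hf(1) kf(1) by simp
    qed
  }
qed

lemma filtered_diagram_iff:
  "filtered_diagram \<kappa> lam I C D \<longleftrightarrow> small_filtered \<kappa> lam I \<and> is_functor I C D"
  by (auto simp: filtered_diagram_def small_filtered_def)

lemma presentable_stagewise:
  fixes \<kappa> :: "'u rel" and C :: "('o, 'a) cat"
  assumes \<kappa>: "inaccessible \<kappa>" and lam: "Cinfinite lam" and C: "class_category \<kappa> C"
    and A: "presentable \<kappa> lam C A" and I: "small_filtered \<kappa> lam I" and D: "is_functor I C D"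
    and c: "colimit I C D c \<iota>"
  shows "stagewise C I D c \<iota> A"
proof -
  have A': "A \<in> Obj C" and pres: "preserves_filtered_colimits \<kappa> lam C (Sets \<kappa>)
      (hom_functor C A :: ('o, 'a, ('a + 'u) set, _) fctr)"
    using A by (auto simp: presentable_def)
  show ?thesis
    by (rule hom_functor_colimit_iff_stagewise[OF \<kappa> C lam small_filteredD(1)[OF I] D
        colimit_imp_cocone[OF c] A', THEN iffD1, OF filtered_colimit_preserved[OF \<kappa> pres I D c]])
qed

lemma presentableI:
  fixes \<kappa> :: "'u rel" and C :: "('o, 'a) cat"
  assumes \<kappa>: "inaccessible \<kappa>" and lam: "Cinfinite lam" and C: "class_category \<kappa> C"
    and A: "A \<in> Obj C"
    and st: "\<And>(I :: ('u, 'u) cat) D c \<iota>. small_filtered \<kappa> lam I \<Longrightarrow> is_functor I C D \<Longrightarrow>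
      colimit I C D c \<iota> \<Longrightarrow> stagewise C I D c \<iota> A"
  shows "presentable \<kappa> lam C A"
  unfolding presentable_def preserves_filtered_colimits_def
proof (intro conjI allI impI A)
  fix I :: "('u, 'u) cat" and D c \<iota>
  assume ID: "filtered_diagram \<kappa> lam I C D" and c: "colimit I C D c \<iota>"
  have I: "small_filtered \<kappa> lam I" and D: "is_functor I C D" using ID filtered_diagram_iff by blast+
  note iff = hom_functor_colimit_iff_stagewise[OF \<kappa> C lam small_filteredD(1)[OF I] D
      colimit_imp_cocone[OF c] A]
  show "colimit I (Sets \<kappa>) (comp_functor (hom_functor C A :: ('o, 'a, ('a + 'u) set, _) fctr) D)
     (obj_map (hom_functor C A) c) (arr_map (hom_functor C A) \<circ> \<iota>)"
    unfolding comp_def by (rule iff[THEN iffD2, OF st[OF I D c]])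
qed

lemma presentable_obj: "presentable \<kappa> lam C A \<Longrightarrow> A \<in> Obj C"
  by (simp add: presentable_def)

lemma presentable_mono:
  assumes \<kappa>: "inaccessible \<kappa>" and lam: "Cinfinite lam" and mu: "Cinfinite mu" and le: "lam \<le>o mu"
    and C: "class_category \<kappa> C" and A: "presentable \<kappa> lam C A"
  shows "presentable \<kappa> mu C A"
  by (rule presentableI[OF \<kappa> mu C presentable_obj[OF A]
        presentable_stagewise[OF \<kappa> lam C A small_filtered_mono[OF _ le]]])

lemma presentable_retract:
  assumes \<kappa>: "inaccessible \<kappa>" and lam: "Cinfinite lam" and C: "class_category \<kappa> C"
    and A: "presentable \<kappa> lam C A" and s: "s \<in> hom C B A" and r: "r \<in> hom C A B"
    and rs: "Comp C r s = Ident C B"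
  shows "presentable \<kappa> lam C B"
proof -
  have cC: "category C" using C by (simp add: class_category_def)
  show ?thesis
  proof (rule presentableI[OF \<kappa> lam C hom_objD(1)[OF cC s]])
    fix I :: "('a, 'a) cat" and D c \<iota>
    assume I: "small_filtered \<kappa> lam I" and D: "is_functor I C D" and c: "colimit I C D c \<iota>"
    note st = presentable_stagewise[OF \<kappa> lam C A I D c] and cc = colimit_imp_cocone[OF c]
    have split: "Comp C (Comp C f r) s = f" if "f \<in> hom C B z" for f z
      using comp_assoc[OF cC s r that] rs ident_right[OF cC that] by simp
    have "\<exists>i \<in> Obj I. \<exists>y \<in> hom C B (obj_map D i). Comp C (\<iota> i) y = x" if x: "x \<in> hom C B c" for x
    proof -
      obtain i y where i: "i \<in> Obj I" "y \<in> hom C A (obj_map D i)" "Comp C (\<iota> i) y = Comp C x r"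
        using stagewise_factor[OF st comp_hom[OF cC r x]] .
      have "Comp C (\<iota> i) (Comp C y s) = x"
        using comp_assoc[OF cC s i(2) coconeD(2)[OF cc i(1)]] i(3) split[OF x] by simp
      then show ?thesis using i(1) comp_hom[OF cC s i(2)] by blast
    qed
    moreover have "\<exists>j \<in> Obj I. \<exists>u \<in> hom I i j. Comp C (arr_map D u) y = Comp C (arr_map D u) z"
      if i: "i \<in> Obj I" and y: "y \<in> hom C B (obj_map D i)" and z: "z \<in> hom C B (obj_map D i)"
        and eq: "Comp C (\<iota> i) y = Comp C (\<iota> i) z" for i y z
    proof -
      note leg = coconeD(2)[OF cc i]
      have "Comp C (\<iota> i) (Comp C y r) = Comp C (\<iota> i) (Comp C z r)"
        using comp_assoc[OF cC r y leg] comp_assoc[OF cC r z leg] eq by simp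
      then obtain j u where j: "j \<in> Obj I" "u \<in> hom I i j"
        "Comp C (arr_map D u) (Comp C y r) = Comp C (arr_map D u) (Comp C z r)"
        using stagewise_equalize[OF st i comp_hom[OF cC r y] comp_hom[OF cC r z]] by blast
      note Du = functorD(4)[OF D j(2)]
      have "Comp C (Comp C (Comp C (arr_map D u) y) r) s = Comp C (Comp C (Comp C (arr_map D u) z) r) s"
        using j(3) comp_assoc[OF cC r y Du] comp_assoc[OF cC r z Du] by simp
      then show ?thesis
        using split[OF comp_hom[OF cC y Du]] split[OF comp_hom[OF cC z Du]] j(1,2) by auto
    qed
    ultimately show "stagewise C I D c \<iota> B" unfolding stagewise_def by blast
  qed
qed

text \<open>In sets, limits of fewer than \<open>mu\<close> objects and arrows commute with \<open>mu\<close>-filtered colimits: the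
  components of an arrow out of \<open>k\<close> factor through a common stage, and the compatibility conditions, fewer
  than \<open>mu\<close> in number, hold at a common later stage.\<close>

lemma presentable_colimit:
  assumes \<kappa>: "inaccessible \<kappa>" and mu: "Cinfinite mu" and C: "class_category \<kappa> C"
    and X: "is_functor J C X" and J: "|Obj J| <o mu" "|Arr J| <o mu"
    and pres: "\<And>j. j \<in> Obj J \<Longrightarrow> presentable \<kappa> mu C (obj_map X j)" and k: "colimit J C X k \<kappa>'"
  shows "presentable \<kappa> mu C k"
proof -
  note cC = functorD(2)[OF X] and cJ = functorD(1)[OF X] and kc = colimit_imp_cocone[OF k]
  note leg = coconeD(2)[OF kc]
  show ?thesis
  proof (rule presentableI[OF \<kappa> mu C coconeD(1)[OF kc]])
    fix I :: "('a, 'a) cat" and D c \<iota>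
    assume I: "small_filtered \<kappa> mu I" and D: "is_functor I C D" and c: "colimit I C D c \<iota>"
    note st = presentable_stagewise[OF \<kappa> mu C pres I D c] and cc = colimit_imp_cocone[OF c]
    note fI = small_filteredD(1)[OF I] and cI = functorD(1)[OF D] and \<iota> = coconeD(2)[OF cc]
    note Du = functorD(4)[OF D]
    have "\<exists>i \<in> Obj I. \<exists>y \<in> hom C k (obj_map D i). Comp C (\<iota> i) y = x" if x: "x \<in> hom C k c" for x
    proof -
      have "\<exists>i y. i \<in> Obj I \<and> y \<in> hom C (obj_map X j) (obj_map D i) \<and> Comp C (\<iota> i) y = Comp C x (\<kappa>' j)"
        if j: "j \<in> Obj J" for j
        using stagewise_factor[OF st[OF j] comp_hom[OF cC leg[OF j] x]] by metis
      then obtain i0 y0 where y0: "\<And>j. j \<in> Obj J \<Longrightarrow> i0 j \<in> Obj I"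
        "\<And>j. j \<in> Obj J \<Longrightarrow> y0 j \<in> hom C (obj_map X j) (obj_map D (i0 j))"
        "\<And>j. j \<in> Obj J \<Longrightarrow> Comp C (\<iota> (i0 j)) (y0 j) = Comp C x (\<kappa>' j)" by metis
      obtain i v where i: "i \<in> Obj I" and v: "\<And>j. j \<in> Obj J \<Longrightarrow> v j \<in> hom I (i0 j) i"
        using filtered_bound[OF fI, of "Obj J" i0] J(1) y0(1) by blast
      define y where "y j = Comp C (arr_map D (v j)) (y0 j)" for j
      have y: "y j \<in> hom C (obj_map X j) (obj_map D i)" if "j \<in> Obj J" for j
        unfolding y_def by (rule comp_hom[OF cC y0(2)[OF that] Du[OF v[OF that]]])
      have \<iota>y: "Comp C (\<iota> i) (y j) = Comp C x (\<kappa>' j)" if j: "j \<in> Obj J" for j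
        unfolding y_def using comp_assoc[OF cC y0(2)[OF j] Du[OF v[OF j]] \<iota>[OF i]]
          coconeD(3)[OF cc v[OF j]] y0(3)[OF j] by simp
      have "\<exists>l u. u \<in> hom I i l \<and> Comp C (arr_map D u) (y (Dom J a)) =
          Comp C (arr_map D u) (Comp C (y (Cod J a)) (arr_map X a))" if a: "a \<in> Arr J" for a
      proof -
        note a' = arr_in_hom[OF a] and o = hom_objD[OF cJ arr_in_hom[OF a]]
        have "Comp C (\<iota> i) (Comp C (y (Cod J a)) (arr_map X a)) = Comp C x (\<kappa>' (Dom J a))"
          using comp_assoc[OF cC functorD(4)[OF X a'] y[OF o(2)] \<iota>[OF i]] \<iota>y[OF o(2)]
            comp_assoc[OF cC functorD(4)[OF X a'] leg[OF o(2)] x] coconeD(3)[OF kc a'] by simp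
        then have "Comp C (\<iota> i) (y (Dom J a)) = Comp C (\<iota> i) (Comp C (y (Cod J a)) (arr_map X a))"
          using \<iota>y[OF o(1)] by simp
        then show ?thesis
          using stagewise_equalize[OF st[OF o(1)] i y[OF o(1)]
              comp_hom[OF cC functorD(4)[OF X a'] y[OF o(2)]]] by metis
      qed
      then obtain l u where u: "\<And>a. a \<in> Arr J \<Longrightarrow> u a \<in> hom I i (l a)"
        "\<And>a. a \<in> Arr J \<Longrightarrow> Comp C (arr_map D (u a)) (y (Dom J a)) =
          Comp C (arr_map D (u a)) (Comp C (y (Cod J a)) (arr_map X a))" by metis
      have "\<exists>m w e. w \<in> hom I i m \<and> (\<forall>a \<in> Arr J. e a \<in> hom I (l a) m \<and> Comp I (e a) (u a) = w)"
        by (rule filtered_span[OF fI mu i, of "Arr J" u l]) (simp_all add: u(1) J(2))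
      then obtain m w e where w: "w \<in> hom I i m"
        and "\<forall>a \<in> Arr J. e a \<in> hom I (l a) m \<and> Comp I (e a) (u a) = w" by blast
      then have e: "\<And>a. a \<in> Arr J \<Longrightarrow> e a \<in> hom I (l a) m"
        "\<And>a. a \<in> Arr J \<Longrightarrow> Comp I (e a) (u a) = w" by blast+
      note om = hom_objD(2)[OF cI w]
      define z where "z j = Comp C (arr_map D w) (y j)" for j
      have z: "z j \<in> hom C (obj_map X j) (obj_map D m)" if "j \<in> Obj J" for j
        unfolding z_def by (rule comp_hom[OF cC y[OF that] Du[OF w]])
      have "cocone J C X (obj_map D m) z"
        unfolding cocone_def
      proof (intro conjI ballI allI impI)
        show "obj_map D m \<in> Obj C" by (rule functorD(3)[OF D om])
        show "z j \<in> hom C (obj_map X j) (obj_map D m)" if "j \<in> Obj J" for j by (rule z[OF that])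
        fix j j' a assume a: "a \<in> hom J j j'"
        note a' = homD[OF a] and o = hom_objD[OF cJ a] and Xa = functorD(4)[OF X a]
        note ua = u(1)[OF a'(1)] and ea = e(1)[OF a'(1)]
        have "Comp C (arr_map D (u a)) (y j) = Comp C (arr_map D (u a)) (Comp C (y j') (arr_map X a))"
          using u(2)[OF a'(1)] a'(2,3) by simp
        then have "Comp C (arr_map D w) (y j) = Comp C (arr_map D w) (Comp C (y j') (arr_map X a))"
          unfolding e(2)[OF a'(1), symmetric] functorD(6)[OF D ua ea]
          using comp_assoc[OF cC y[OF o(1)] Du[OF ua] Du[OF ea]]
            comp_assoc[OF cC comp_hom[OF cC Xa y[OF o(2)]] Du[OF ua] Du[OF ea]] by simp
        then show "Comp C (z j') (arr_map X a) = z j"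
          unfolding z_def using comp_assoc[OF cC Xa y[OF o(2)] Du[OF w]] by simp
      qed
      then obtain t where t: "t \<in> hom C k (obj_map D m)" "\<And>j. j \<in> Obj J \<Longrightarrow> Comp C t (\<kappa>' j) = z j"
        using colimit_factor[OF k] by metis
      have "Comp C (\<iota> m) t = x"
      proof (rule colimit_ext[OF X k comp_hom[OF cC t(1) \<iota>[OF om]] x])
        fix j assume j: "j \<in> Obj J"
        show "Comp C (Comp C (\<iota> m) t) (\<kappa>' j) = Comp C x (\<kappa>' j)"
          using comp_assoc[OF cC leg[OF j] t(1) \<iota>[OF om]] t(2)[OF j]
            comp_assoc[OF cC y[OF j] Du[OF w] \<iota>[OF om]] coconeD(3)[OF cc w] \<iota>y[OF j]
          unfolding z_def by simp
      qed
      then show ?thesis using om t(1) by blast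
    qed
    moreover have "\<exists>j \<in> Obj I. \<exists>u \<in> hom I i j. Comp C (arr_map D u) y = Comp C (arr_map D u) z"
      if i: "i \<in> Obj I" and y: "y \<in> hom C k (obj_map D i)" and z: "z \<in> hom C k (obj_map D i)"
        and eq: "Comp C (\<iota> i) y = Comp C (\<iota> i) z" for i y z
    proof -
      have "\<exists>l u. u \<in> hom I i l \<and> Comp C (arr_map D u) (Comp C y (\<kappa>' j)) =
          Comp C (arr_map D u) (Comp C z (\<kappa>' j))" if j: "j \<in> Obj J" for j
      proof -
        have "Comp C (\<iota> i) (Comp C y (\<kappa>' j)) = Comp C (\<iota> i) (Comp C z (\<kappa>' j))"
          using comp_assoc[OF cC leg[OF j] y \<iota>[OF i]] comp_assoc[OF cC leg[OF j] z \<iota>[OF i]] eq by simp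
        then show ?thesis
          using stagewise_equalize[OF st[OF j] i comp_hom[OF cC leg[OF j] y]
              comp_hom[OF cC leg[OF j] z]] by metis
      qed
      then obtain l u where u: "\<And>j. j \<in> Obj J \<Longrightarrow> u j \<in> hom I i (l j)"
        "\<And>j. j \<in> Obj J \<Longrightarrow> Comp C (arr_map D (u j)) (Comp C y (\<kappa>' j)) =
          Comp C (arr_map D (u j)) (Comp C z (\<kappa>' j))" by metis
      have "\<exists>m w e. w \<in> hom I i m \<and> (\<forall>j \<in> Obj J. e j \<in> hom I (l j) m \<and> Comp I (e j) (u j) = w)"
        by (rule filtered_span[OF fI mu i, of "Obj J" u l]) (simp_all add: u(1) J(1))
      then obtain m w e where w: "w \<in> hom I i m"
        and "\<forall>j \<in> Obj J. e j \<in> hom I (l j) m \<and> Comp I (e j) (u j) = w" by blast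
      then have e: "\<And>j. j \<in> Obj J \<Longrightarrow> e j \<in> hom I (l j) m"
        "\<And>j. j \<in> Obj J \<Longrightarrow> Comp I (e j) (u j) = w" by blast+
      have "Comp C (arr_map D w) y = Comp C (arr_map D w) z"
      proof (rule colimit_ext[OF X k comp_hom[OF cC y Du[OF w]] comp_hom[OF cC z Du[OF w]]])
        fix j assume j: "j \<in> Obj J"
        note uj = u(1)[OF j] and ej = e(1)[OF j]
        have "Comp C (arr_map D w) (Comp C y (\<kappa>' j)) = Comp C (arr_map D w) (Comp C z (\<kappa>' j))"
          unfolding e(2)[OF j, symmetric] functorD(6)[OF D uj ej]
          using comp_assoc[OF cC comp_hom[OF cC leg[OF j] y] Du[OF uj] Du[OF ej]]
            comp_assoc[OF cC comp_hom[OF cC leg[OF j] z] Du[OF uj] Du[OF ej]] u(2)[OF j] by simp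
        then show "Comp C (Comp C (arr_map D w) y) (\<kappa>' j) = Comp C (Comp C (arr_map D w) z) (\<kappa>' j)"
          using comp_assoc[OF cC leg[OF j] y Du[OF w]] comp_assoc[OF cC leg[OF j] z Du[OF w]] by simp
      qed
      then show ?thesis using hom_objD(2)[OF cI w] w by blast
    qed
    ultimately show "stagewise C I D c \<iota> k" unfolding stagewise_def by blast
  qed
qed

lemma class_accessibleD:
  assumes "class_accessible \<kappa> lam C"
  shows "class_category \<kappa> C" "category C" "has_filtered_colimits \<kappa> lam C"
  using assms by (auto simp: class_accessible_def class_category_def)

lemma class_accessible_presentation:
  fixes \<kappa> :: "'u rel"
  assumes "class_accessible \<kappa> lam C" "X \<in> Obj C"
  obtains I :: "('u, 'u) cat" and D \<iota> where "small_filtered \<kappa> lam I" "is_functor I C D" "colimit I C D X \<iota>"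
    "\<And>i. i \<in> Obj I \<Longrightarrow> presentable \<kappa> lam C (obj_map D i)"
proof -
  obtain \<A> where \<A>: "\<forall>A \<in> \<A>. presentable \<kappa> lam C A"
    "\<forall>X \<in> Obj C. \<exists>I D \<iota>. filtered_diagram \<kappa> lam I C D \<and>
      (\<forall>i \<in> Obj I. obj_map D i \<in> \<A>) \<and> colimit I C D X \<iota>"
    using assms(1) unfolding class_accessible_def by blast
  obtain I D \<iota> where "filtered_diagram \<kappa> lam I C D" "\<forall>i \<in> Obj I. obj_map D i \<in> \<A>"
    "colimit I C D X \<iota>" using \<A>(2) assms(2) by blast
  then show thesis using that[of I D \<iota>] \<A>(1) unfolding filtered_diagram_iff by blast
qed

section \<open>Presentable objects detect filtered colimits\<close>

text \<open>Every object is a colimit of presentable ones. So an inverse of \<open>h\<close> can be defined on the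
  components of a presentation of \<open>d\<close>, where \<open>h\<close> is surjective; injectivity makes the lifted legs a
  cocone and shows, on a presentation of \<open>c\<close>, that the inverse is two-sided.\<close>

lemma presentable_detects_iso:
  fixes \<kappa> :: "'u rel"
  assumes C: "class_accessible \<kappa> lam C" and h: "h \<in> hom C c d"
    and inj: "\<And>A x y. presentable \<kappa> lam C A \<Longrightarrow> x \<in> hom C A c \<Longrightarrow> y \<in> hom C A c \<Longrightarrow>
      Comp C h x = Comp C h y \<Longrightarrow> x = y"
    and surj: "\<And>A x. presentable \<kappa> lam C A \<Longrightarrow> x \<in> hom C A d \<Longrightarrow> \<exists>y \<in> hom C A c. Comp C h y = x"
  obtains k where "mutually_inverse C c d h k"
proof -
  note cC = class_accessibleD(2)[OF C] and o = hom_objD[OF class_accessibleD(2)[OF C] h]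
  obtain I :: "('u, 'u) cat" and D \<delta> where "small_filtered \<kappa> lam I" and D: "is_functor I C D" and d: "colimit I C D d \<delta>"
    and pD: "\<And>i. i \<in> Obj I \<Longrightarrow> presentable \<kappa> lam C (obj_map D i)"
    by (rule class_accessible_presentation[OF C o(2)]) (rule that, assumption+)
  note dc = colimit_imp_cocone[OF d] and cI = functorD(1)[OF D]
  have "\<exists>y. y \<in> hom C (obj_map D i) c \<and> Comp C h y = \<delta> i" if "i \<in> Obj I" for i
    using surj[OF pD[OF that] coconeD(2)[OF dc that]] by blast
  then obtain y where y: "\<And>i. i \<in> Obj I \<Longrightarrow> y i \<in> hom C (obj_map D i) c"
    "\<And>i. i \<in> Obj I \<Longrightarrow> Comp C h (y i) = \<delta> i" by metis
  have "cocone I C D c y"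
    unfolding cocone_def
  proof (intro conjI ballI allI impI o(1))
    show "y i \<in> hom C (obj_map D i) c" if "i \<in> Obj I" for i by (rule y(1)[OF that])
    fix i j u assume u: "u \<in> hom I i j"
    note oi = hom_objD[OF cI u] and Du = functorD(4)[OF D u]
    show "Comp C (y j) (arr_map D u) = y i"
    proof (rule inj[OF pD[OF oi(1)] comp_hom[OF cC Du y(1)[OF oi(2)]] y(1)[OF oi(1)]])
      show "Comp C h (Comp C (y j) (arr_map D u)) = Comp C h (y i)"
        using comp_assoc[OF cC Du y(1)[OF oi(2)] h] y(2)[OF oi(1)] y(2)[OF oi(2)] coconeD(3)[OF dc u]
        by simp
    qed
  qed
  then obtain k where k: "k \<in> hom C d c" "\<And>i. i \<in> Obj I \<Longrightarrow> Comp C k (\<delta> i) = y i"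
    using colimit_factor[OF d] by metis
  have hk: "Comp C h k = Ident C d"
  proof (rule colimit_ext[OF D d comp_hom[OF cC k(1) h] ident_hom[OF cC o(2)]])
    fix i assume i: "i \<in> Obj I"
    show "Comp C (Comp C h k) (\<delta> i) = Comp C (Ident C d) (\<delta> i)"
      using comp_assoc[OF cC coconeD(2)[OF dc i] k(1) h] k(2)[OF i] y(2)[OF i]
        ident_left[OF cC coconeD(2)[OF dc i]] by simp
  qed
  obtain J :: "('u, 'u) cat" and E \<epsilon> where "small_filtered \<kappa> lam J" and E: "is_functor J C E" and e: "colimit J C E c \<epsilon>"
    and pE: "\<And>j. j \<in> Obj J \<Longrightarrow> presentable \<kappa> lam C (obj_map E j)"
    by (rule class_accessible_presentation[OF C o(1)]) (rule that, assumption+)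
  note ec = coconeD(2)[OF colimit_imp_cocone[OF e]]
  have kh: "Comp C k h = Ident C c"
  proof (rule colimit_ext[OF E e comp_hom[OF cC h k(1)] ident_hom[OF cC o(1)]])
    fix j assume j: "j \<in> Obj J"
    note kh = comp_hom[OF cC h k(1)] and he = comp_hom[OF cC ec[OF j] h]
    have "Comp C (Comp C k h) (\<epsilon> j) = \<epsilon> j"
    proof (rule inj[OF pE[OF j] comp_hom[OF cC ec[OF j] kh] ec[OF j]])
      have "Comp C h (Comp C (Comp C k h) (\<epsilon> j)) = Comp C (Comp C h k) (Comp C h (\<epsilon> j))"
        using comp_assoc[OF cC ec[OF j] h k(1)] comp_assoc[OF cC he k(1) h] by simp
      then show "Comp C h (Comp C (Comp C k h) (\<epsilon> j)) = Comp C h (\<epsilon> j)"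
        using hk ident_left[OF cC he] by simp
    qed
    then show "Comp C (Comp C k h) (\<epsilon> j) = Comp C (Ident C c) (\<epsilon> j)"
      using ident_left[OF cC ec[OF j]] by simp
  qed
  show thesis using that[of k] h k(1) hk kh unfolding mutually_inverse_def by blast
qed

text \<open>The comparison arrow from the actual colimit to \<open>d\<close> is bijective on arrows out of presentable
  objects, as both cocones are seen stage by stage, and is therefore invertible.\<close>

lemma stagewise_imp_colimit:
  assumes \<kappa>: "inaccessible \<kappa>" and lam: "Cinfinite lam" and C: "class_accessible \<kappa> lam C"
    and I: "small_filtered \<kappa> lam I" and D: "is_functor I C D" and d: "cocone I C D d \<delta>"
    and st: "\<And>A. presentable \<kappa> lam C A \<Longrightarrow> stagewise C I D d \<delta> A"
  shows "colimit I C D d \<delta>"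
proof -
  note cC = class_accessibleD(2)[OF C] and fI = small_filteredD(1)[OF I] and cI = functorD(1)[OF D]
  obtain c \<iota> where c: "colimit I C D c \<iota>"
    using filtered_colimit_exists[OF \<kappa> class_accessibleD(3)[OF C] I D] .
  note cc = colimit_imp_cocone[OF c] and Du = functorD(4)[OF D]
  note \<iota> = coconeD(2)[OF cc] and \<delta> = coconeD(2)[OF d]
  obtain h where h: "h \<in> hom C c d" "\<And>i. i \<in> Obj I \<Longrightarrow> Comp C h (\<iota> i) = \<delta> i"
    using colimit_factor[OF c d] by metis
  have h\<iota>: "Comp C h (Comp C (\<iota> i) y) = Comp C (\<delta> i) y"
    if "i \<in> Obj I" "y \<in> hom C A (obj_map D i)" for i y A
    using comp_assoc[OF cC that(2) \<iota>[OF that(1)] h(1)] h(2)[OF that(1)] by simp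
  obtain k where k: "mutually_inverse C c d h k"
  proof (rule presentable_detects_iso[OF C h(1)])
    fix A x assume A: "presentable \<kappa> lam C A" and x: "x \<in> hom C A d"
    obtain i y where i: "i \<in> Obj I" "y \<in> hom C A (obj_map D i)" "Comp C (\<delta> i) y = x"
      using stagewise_factor[OF st[OF A] x] .
    then show "\<exists>z \<in> hom C A c. Comp C h z = x"
      using h\<iota>[OF i(1,2)] comp_hom[OF cC i(2) \<iota>[OF i(1)]] by metis
  next
    fix A x x' assume A: "presentable \<kappa> lam C A" and x: "x \<in> hom C A c" and x': "x' \<in> hom C A c"
      and eq: "Comp C h x = Comp C h x'"
    note sc = presentable_stagewise[OF \<kappa> lam class_accessibleD(1)[OF C] A I D c]
    obtain i y where i: "i \<in> Obj I" "y \<in> hom C A (obj_map D i)" "Comp C (\<iota> i) y = x"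
      using stagewise_factor[OF sc x] .
    obtain i' y' where i': "i' \<in> Obj I" "y' \<in> hom C A (obj_map D i')" "Comp C (\<iota> i') y' = x'"
      using stagewise_factor[OF sc x'] .
    obtain j u u' where j: "j \<in> Obj I" "u \<in> hom I i j" "u' \<in> hom I i' j"
      using filtered_bound2[OF fI lam i(1) i'(1)] .
    let ?z = "Comp C (arr_map D u) y" and ?z' = "Comp C (arr_map D u') y'"
    have z: "?z \<in> hom C A (obj_map D j)" "Comp C (\<iota> j) ?z = x"
      using comp_hom[OF cC i(2) Du[OF j(2)]] comp_assoc[OF cC i(2) Du[OF j(2)] \<iota>[OF j(1)]]
        coconeD(3)[OF cc j(2)] i(3) by simp_all
    have z': "?z' \<in> hom C A (obj_map D j)" "Comp C (\<iota> j) ?z' = x'"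
      using comp_hom[OF cC i'(2) Du[OF j(3)]] comp_assoc[OF cC i'(2) Du[OF j(3)] \<iota>[OF j(1)]]
        coconeD(3)[OF cc j(3)] i'(3) by simp_all
    have "Comp C (\<delta> j) ?z = Comp C (\<delta> j) ?z'"
      using h\<iota>[OF j(1) z(1)] h\<iota>[OF j(1) z'(1)] z(2) z'(2) eq by simp
    then obtain m w where w: "m \<in> Obj I" "w \<in> hom I j m"
      "Comp C (arr_map D w) ?z = Comp C (arr_map D w) ?z'"
      using stagewise_equalize[OF st[OF A] j(1) z(1) z'(1)] by metis
    have "Comp C (\<iota> j) ?z = Comp C (\<iota> j) ?z'"
      using coconeD(3)[OF cc w(2)] comp_assoc[OF cC z(1) Du[OF w(2)] \<iota>[OF w(1)]]
        comp_assoc[OF cC z'(1) Du[OF w(2)] \<iota>[OF w(1)]] w(3) by simp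
    then show "x = x'" using z(2) z'(2) by simp
  qed metis
  show ?thesis
    by (rule colimit_cong[THEN iffD1, OF _ cI colimit_iso_apex[OF D c k]]) (rule h(2))
qed

section \<open>Strictly directed systems\<close>

definition strictly_directed :: "'l rel \<Rightarrow> 'w set \<Rightarrow> ('w \<Rightarrow> 'w \<Rightarrow> bool) \<Rightarrow> bool" where
  "strictly_directed lam W lt \<longleftrightarrow>
     (\<forall>u \<in> W. \<forall>v \<in> W. \<forall>w \<in> W. lt u v \<longrightarrow> lt v w \<longrightarrow> lt u w) \<and>
     (\<forall>S \<subseteq> W. |S| <o lam \<longrightarrow> (\<exists>w \<in> W. \<forall>s \<in> S. lt s w))"

lemma strictly_directed_trans:
  "strictly_directed lam W lt \<Longrightarrow> lt u v \<Longrightarrow> lt v w \<Longrightarrow> u \<in> W \<Longrightarrow> v \<in> W \<Longrightarrow> w \<in> W \<Longrightarrow> lt u w"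
  unfolding strictly_directed_def by blast

lemma strictly_directed_bound:
  assumes "strictly_directed lam W lt" "S \<subseteq> W" "|S| <o lam"
  obtains w where "w \<in> W" "\<And>s. s \<in> S \<Longrightarrow> lt s w"
proof -
  have "\<exists>w \<in> W. \<forall>s \<in> S. lt s w"
    using assms(1)[unfolded strictly_directed_def, THEN conjunct2, rule_format, OF assms(2,3)] .
  then show thesis using that by blast
qed

text \<open>The elements are the sets \<open>s\<close> of fewer than \<open>lam\<close> arrows, each with a chosen cocone \<open>\<tau> s\<close> of apex
  \<open>tip s\<close>, and \<open>s\<close> precedes \<open>s'\<close> if \<open>s'\<close> contains \<open>s\<close> together with its whole cocone. The transition arrow
  is then the leg of the cocone of \<open>s'\<close> at \<open>tip s\<close>, and transitions compose because the legs of a later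
  cocone are compatible with those of an earlier one. If \<open>s\<close> happens to precede itself, the transition
  is merely an idempotent of \<open>tip s\<close>; this does no harm, since no identity law is demanded. The last two
  properties say that \<open>tip\<close> is cofinal.\<close>

lemma filtered_strict_refinement:
  fixes I :: "('i, 'j) cat" and lam :: "'l rel"
  assumes lam: "Cinfinite lam" "regularCard lam" and I: "filtered lam I"
  obtains W :: "'j set set" and lt tip e where
    "W \<subseteq> Pow (Arr I)" "strictly_directed lam W lt"
    "\<And>w. w \<in> W \<Longrightarrow> tip w \<in> Obj I"
    "\<And>v w. v \<in> W \<Longrightarrow> w \<in> W \<Longrightarrow> lt v w \<Longrightarrow> e v w \<in> hom I (tip v) (tip w)"
    "\<And>u v w. u \<in> W \<Longrightarrow> v \<in> W \<Longrightarrow> w \<in> W \<Longrightarrow> lt u v \<Longrightarrow> lt v w \<Longrightarrow>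
      Comp I (e v w) (e u v) = e u w"
    "\<And>i. i \<in> Obj I \<Longrightarrow> \<exists>w \<in> W. \<exists>r. r \<in> hom I i (tip w)"
    "\<And>w i u. w \<in> W \<Longrightarrow> u \<in> hom I (tip w) i \<Longrightarrow>
      \<exists>v \<in> W. lt w v \<and> (\<exists>r \<in> hom I i (tip v). Comp I r u = e w v)"
proof -
  note cI = filteredD(1)[OF I]
  define W where "W = {s. s \<subseteq> Arr I \<and> |s| <o lam}"
  define ob where "ob s = Dom I ` s \<union> Cod I ` s" for s
  have ob_card: "|ob s| <o lam" if "s \<in> W" for s
    using that card_less_image[of s lam] unfolding ob_def W_def by (intro card_less_Un[OF lam(1)]) auto
  have ob_obj: "i \<in> Obj I" if "s \<in> W" "i \<in> ob s" for s i
    using that hom_objD[OF cI arr_in_hom] unfolding ob_def W_def by auto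
  have "\<exists>t \<tau>. t \<in> Obj I \<and> (\<forall>i \<in> ob s. \<tau> i \<in> hom I i t) \<and>
      (\<forall>u \<in> s. Comp I (\<tau> (Cod I u)) u = \<tau> (Dom I u))" if s: "s \<in> W" for s
  proof -
    obtain k v where k: "k \<in> Obj I" and v: "\<And>i. i \<in> ob s \<Longrightarrow> v i \<in> hom I i k"
      using filtered_bound[OF I, of "ob s" "\<lambda>i. i"] ob_obj[OF s] ob_card[OF s] by metis
    have "\<exists>l e. e \<in> hom I k l \<and> Comp I e (Comp I (v (Cod I u)) u) = Comp I e (v (Dom I u))"
      if u: "u \<in> s" for u
    proof -
      have h: "u \<in> hom I (Dom I u) (Cod I u)" using s u by (intro arr_in_hom) (auto simp: W_def)
      have o: "Dom I u \<in> ob s" "Cod I u \<in> ob s" using u by (auto simp: ob_def)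
      have "{Comp I (v (Cod I u)) u, v (Dom I u)} \<subseteq> hom I (Dom I u) k"
        using comp_hom[OF cI h v[OF o(2)]] v[OF o(1)] by simp
      moreover have "|{Comp I (v (Cod I u)) u, v (Dom I u)}| <o lam"
        by (rule card_less_finite[OF lam(1)]) simp
      ultimately show ?thesis
        using filteredD(3)[OF I hom_objD(1)[OF cI h] k] by (metis insertI1 insertI2)
    qed
    then obtain l e where e: "\<And>u. u \<in> s \<Longrightarrow> e u \<in> hom I k (l u)"
      "\<And>u. u \<in> s \<Longrightarrow> Comp I (e u) (Comp I (v (Cod I u)) u) = Comp I (e u) (v (Dom I u))" by metis
    have "|s| <o lam" using s by (simp add: W_def)
    then obtain t w r where w: "w \<in> hom I k t"
      and r: "\<forall>u \<in> s. r u \<in> hom I (l u) t \<and> Comp I (r u) (e u) = w"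
      using filtered_span[OF I lam(1) k, of s e l] e(1) by blast
    have "Comp I (Comp I w (v (Cod I u))) u = Comp I w (v (Dom I u))" if u: "u \<in> s" for u
    proof -
      have h: "u \<in> hom I (Dom I u) (Cod I u)" using s u by (intro arr_in_hom) (auto simp: W_def)
      have o: "Dom I u \<in> ob s" "Cod I u \<in> ob s" using u by (auto simp: ob_def)
      have ru: "r u \<in> hom I (l u) t" and wu: "w = Comp I (r u) (e u)" using r u by auto
      have "Comp I (Comp I w (v (Cod I u))) u = Comp I w (Comp I (v (Cod I u)) u)"
        by (rule comp_assoc[OF cI h v[OF o(2)] w, symmetric])
      also have "\<dots> = Comp I (r u) (Comp I (e u) (Comp I (v (Cod I u)) u))"
        unfolding wu by (rule comp_assoc[OF cI comp_hom[OF cI h v[OF o(2)]] e(1)[OF u] ru, symmetric])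
      also have "\<dots> = Comp I (r u) (Comp I (e u) (v (Dom I u)))" using e(2)[OF u] by simp
      also have "\<dots> = Comp I w (v (Dom I u))"
        unfolding wu by (rule comp_assoc[OF cI v[OF o(1)] e(1)[OF u] ru])
      finally show ?thesis .
    qed
    then show ?thesis
      using hom_objD(2)[OF cI w] comp_hom[OF cI v w]
      by (intro exI[of _ t] exI[of _ "\<lambda>i. Comp I w (v i)"]) blast
  qed
  then obtain tip \<tau> where tip: "\<And>s. s \<in> W \<Longrightarrow> tip s \<in> Obj I"
    and \<tau>: "\<And>s i. s \<in> W \<Longrightarrow> i \<in> ob s \<Longrightarrow> \<tau> s i \<in> hom I i (tip s)"
    and \<tau>_comp: "\<And>s u. s \<in> W \<Longrightarrow> u \<in> s \<Longrightarrow> Comp I (\<tau> s (Cod I u)) u = \<tau> s (Dom I u)"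
    by metis
  define lt where "lt s s' \<longleftrightarrow> s \<subseteq> s' \<and> Ident I (tip s) \<in> s' \<and> \<tau> s ` ob s \<subseteq> s'" for s s'
  define e where "e s s' = \<tau> s' (tip s)" for s s'
  have \<tau>_eq: "Comp I (\<tau> s j) u = \<tau> s i" if "s \<in> W" "u \<in> s" "u \<in> hom I i j" for s u i j
    using \<tau>_comp[OF that(1,2)] homD[OF that(3)] by simp
  have tip_ob: "tip s \<in> ob s'" if "s \<in> W" "lt s s'" for s s'
  proof -
    have "Dom I (Ident I (tip s)) = tip s" using ident_hom[OF cI tip[OF that(1)]] by (rule homD(2))
    then show ?thesis using that(2) unfolding ob_def lt_def by (metis UnI1 imageI)
  qed
  have e_hom: "e v w \<in> hom I (tip v) (tip w)" if "v \<in> W" "w \<in> W" "lt v w" for v w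
    unfolding e_def by (rule \<tau>[OF that(2) tip_ob[OF that(1,3)]])
  have e_comp: "Comp I (e v w) (e u v) = e u w"
    if "u \<in> W" "v \<in> W" "w \<in> W" "lt u v" "lt v w" for u v w
  proof -
    have "e u v \<in> w" using tip_ob[OF that(1,4)] that(5) unfolding e_def lt_def by blast
    then show ?thesis
      using \<tau>_eq[OF that(3) _ e_hom[OF that(1,2,4)]] unfolding e_def by blast
  qed
  have lt_trans: "lt u w" if "lt u v" "lt v w" for u v w using that unfolding lt_def by blast
  define nxt where "nxt s = s \<union> {Ident I (tip s)} \<union> \<tau> s ` ob s" for s
  have nxt: "nxt s \<subseteq> Arr I" "|nxt s| <o lam" if s: "s \<in> W" for s
  proof -
    have "\<tau> s i \<in> Arr I" if "i \<in> ob s" for i using homD(1)[OF \<tau>[OF s that]] .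
    then show "nxt s \<subseteq> Arr I"
      using s homD(1)[OF ident_hom[OF cI tip[OF s]]] unfolding nxt_def W_def by auto
    show "|nxt s| <o lam"
      unfolding nxt_def using s card_less_image[OF ob_card[OF s], of "\<tau> s"]
        card_less_finite[OF lam(1), of "{Ident I (tip s)}"]
      by (intro card_less_Un[OF lam(1)]) (simp_all add: W_def)
  qed
  have lt_iff: "lt s s' \<longleftrightarrow> nxt s \<subseteq> s'" for s s' unfolding lt_def nxt_def by blast
  have dir: "strictly_directed lam W lt"
    unfolding strictly_directed_def
  proof (intro conjI ballI allI impI)
    show "lt u w" if "lt u v" "lt v w" for u v w using lt_trans that .
    fix S assume S: "S \<subseteq> W" "|S| <o lam"
    have "(\<Union>s\<in>S. nxt s) \<in> W"
      unfolding W_def using nxt S card_less_UNION[OF lam S(2), of nxt] by blast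
    then show "\<exists>w \<in> W. \<forall>s \<in> S. lt s w" unfolding lt_iff by blast
  qed
  have c1: "\<exists>w \<in> W. \<exists>r. r \<in> hom I i (tip w)" if i: "i \<in> Obj I" for i
  proof -
    have "{Ident I i} \<in> W"
      using homD(1)[OF ident_hom[OF cI i]] card_less_finite[OF lam(1), of "{Ident I i}"]
      by (simp add: W_def)
    moreover have "i \<in> ob {Ident I i}" using homD(2)[OF ident_hom[OF cI i]] by (simp add: ob_def)
    ultimately show ?thesis using \<tau> by blast
  qed
  have c2: "\<exists>v \<in> W. lt w v \<and> (\<exists>r \<in> hom I i (tip v). Comp I r u = e w v)"
    if w: "w \<in> W" and u: "u \<in> hom I (tip w) i" for w i u
  proof -
    let ?v = "nxt w \<union> {u}"
    have v: "?v \<in> W"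
      using nxt[OF w] homD(1)[OF u] card_less_Un[OF lam(1) _ card_less_finite[OF lam(1), of "{u}"]]
      by (simp add: W_def)
    have "i \<in> ob ?v" using homD(3)[OF u] unfolding ob_def by blast
    then have "\<tau> ?v i \<in> hom I i (tip ?v)" by (rule \<tau>[OF v])
    moreover have "Comp I (\<tau> ?v i) u = e w ?v" unfolding e_def by (rule \<tau>_eq[OF v _ u]) simp
    moreover have "lt w ?v" unfolding lt_iff by blast
    ultimately show ?thesis using v by blast
  qed
  have "W \<subseteq> Pow (Arr I)" by (auto simp: W_def)
  from that[OF this dir tip e_hom e_comp c1 c2] show thesis .
qed

text \<open>A diagram with a cocone, indexed by a strict relation: transition arrows exist for related
  elements only, and there are no identities to be preserved.\<close>

definition system ::
  "('o, 'a) cat \<Rightarrow> 'w set \<Rightarrow> ('w \<Rightarrow> 'w \<Rightarrow> bool) \<Rightarrow> ('w \<Rightarrow> 'o) \<Rightarrow> ('w \<Rightarrow> 'w \<Rightarrow> 'a) \<Rightarrow> 'o \<Rightarrow> ('w \<Rightarrow> 'a) \<Rightarrow> bool"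
where
  "system C W lt A a K \<alpha> \<longleftrightarrow> category C \<and> K \<in> Obj C \<and>
     (\<forall>w \<in> W. \<alpha> w \<in> hom C (A w) K) \<and>
     (\<forall>v \<in> W. \<forall>w \<in> W. lt v w \<longrightarrow> a v w \<in> hom C (A v) (A w) \<and> Comp C (\<alpha> w) (a v w) = \<alpha> v) \<and>
     (\<forall>u \<in> W. \<forall>v \<in> W. \<forall>w \<in> W. lt u v \<longrightarrow> lt v w \<longrightarrow> lt u w \<longrightarrow> Comp C (a v w) (a u v) = a u w)"

lemma systemD:
  assumes "system C W lt A a K \<alpha>"
  shows "category C" "K \<in> Obj C" "w \<in> W \<Longrightarrow> \<alpha> w \<in> hom C (A w) K"
    "v \<in> W \<Longrightarrow> w \<in> W \<Longrightarrow> lt v w \<Longrightarrow> a v w \<in> hom C (A v) (A w)"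
    "v \<in> W \<Longrightarrow> w \<in> W \<Longrightarrow> lt v w \<Longrightarrow> Comp C (\<alpha> w) (a v w) = \<alpha> v"
    "u \<in> W \<Longrightarrow> v \<in> W \<Longrightarrow> w \<in> W \<Longrightarrow> lt u v \<Longrightarrow> lt v w \<Longrightarrow> lt u w \<Longrightarrow>
      Comp C (a v w) (a u v) = a u w"
  using assms unfolding system_def by blast+

text \<open>The analogue of \<open>stagewise\<close> for systems.\<close>

definition system_stagewise ::
  "('o, 'a) cat \<Rightarrow> 'w set \<Rightarrow> ('w \<Rightarrow> 'w \<Rightarrow> bool) \<Rightarrow> ('w \<Rightarrow> 'o) \<Rightarrow> ('w \<Rightarrow> 'w \<Rightarrow> 'a) \<Rightarrow> 'o \<Rightarrow> ('w \<Rightarrow> 'a) \<Rightarrow>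
   'o \<Rightarrow> bool"
where
  "system_stagewise C W lt A a K \<alpha> B \<longleftrightarrow>
     (\<forall>x \<in> hom C B K. \<exists>w \<in> W. \<exists>y \<in> hom C B (A w). Comp C (\<alpha> w) y = x) \<and>
     (\<forall>w \<in> W. \<forall>y \<in> hom C B (A w). \<forall>z \<in> hom C B (A w).
        Comp C (\<alpha> w) y = Comp C (\<alpha> w) z \<longrightarrow>
        (\<exists>v \<in> W. lt w v \<and> Comp C (a w v) y = Comp C (a w v) z))"

lemma system_stagewise_factor:
  assumes "system_stagewise C W lt A a K \<alpha> B" "x \<in> hom C B K"
  obtains w y where "w \<in> W" "y \<in> hom C B (A w)" "Comp C (\<alpha> w) y = x"
  using assms unfolding system_stagewise_def by blast

lemma system_stagewise_equalize:
  assumes "system_stagewise C W lt A a K \<alpha> B" "w \<in> W" "y \<in> hom C B (A w)" "z \<in> hom C B (A w)"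
    "Comp C (\<alpha> w) y = Comp C (\<alpha> w) z"
  obtains v where "v \<in> W" "lt w v" "Comp C (a w v) y = Comp C (a w v) z"
  using assms unfolding system_stagewise_def by blast

lemma functor_system:
  assumes F: "is_functor C E F" and S: "system C W lt A a K \<alpha>"
  shows "system E W lt (\<lambda>w. obj_map F (A w)) (\<lambda>v w. arr_map F (a v w)) (obj_map F K)
    (\<lambda>w. arr_map F (\<alpha> w))"
  unfolding system_def
proof (intro conjI ballI impI)
  note s = systemD[OF S] and f = functorD[OF F]
  show "category E" by (rule f(2))
  show "obj_map F K \<in> Obj E" by (rule f(3)[OF s(2)])
  show "arr_map F (\<alpha> w) \<in> hom E (obj_map F (A w)) (obj_map F K)" if "w \<in> W" for w
    by (rule f(4)[OF s(3)[OF that]])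
  fix v w assume vw: "v \<in> W" "w \<in> W" "lt v w"
  show "arr_map F (a v w) \<in> hom E (obj_map F (A v)) (obj_map F (A w))"
    by (rule f(4)[OF s(4)[OF vw]])
  show "Comp E (arr_map F (\<alpha> w)) (arr_map F (a v w)) = arr_map F (\<alpha> v)"
    using f(6)[OF s(4)[OF vw] s(3)[OF vw(2)]] s(5)[OF vw] by simp
next
  note s = systemD[OF S] and f = functorD[OF F]
  fix u v w assume uvw: "u \<in> W" "v \<in> W" "w \<in> W" "lt u v" "lt v w" "lt u w"
  show "Comp E (arr_map F (a v w)) (arr_map F (a u v)) = arr_map F (a u w)"
    using f(6)[OF s(4)[OF uvw(1,2,4)] s(4)[OF uvw(2,3,5)]] s(6)[OF uvw] by simp
qed

text \<open>The filtered presentation of \<open>X\<close> by presentable objects is refined to a system. The functor \<open>F\<close> is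
  treated together with \<open>X\<close>, because the interleaving below needs one system that exhausts \<open>X\<close> and whose
  image exhausts \<open>F X\<close>.\<close>

lemma accessible_system:
  fixes \<kappa> :: "'u rel" and C :: "('o, 'a) cat" and E :: "('p, 'b) cat"
  assumes \<kappa>: "inaccessible \<kappa>" and lam: "Cinfinite lam" "regularCard lam"
    and F: "class_accessible_functor \<kappa> lam C E F" and X: "X \<in> Obj C"
  obtains W :: "'u set set" and lt A a \<alpha> where
    "small \<kappa> W" "strictly_directed lam W lt" "system C W lt A a X \<alpha>"
    "\<And>w. w \<in> W \<Longrightarrow> presentable \<kappa> lam C (A w)"
    "\<And>B. presentable \<kappa> lam C B \<Longrightarrow> system_stagewise C W lt A a X \<alpha> B"
    "\<And>B. presentable \<kappa> lam E B \<Longrightarrow> system_stagewise E W lt (\<lambda>w. obj_map F (A w))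
      (\<lambda>v w. arr_map F (a v w)) (obj_map F X) (\<lambda>w. arr_map F (\<alpha> w)) B"
proof -
  have C: "class_accessible \<kappa> lam C" and E: "class_accessible \<kappa> lam E" and fF: "is_functor C E F"
    and pF: "preserves_filtered_colimits \<kappa> lam C E F"
    using F by (auto simp: class_accessible_functor_def)
  obtain I :: "('u, 'u) cat" and D \<iota> where I: "small_filtered \<kappa> lam I" and D: "is_functor I C D"
    and c: "colimit I C D X \<iota>" and pD: "\<And>i. i \<in> Obj I \<Longrightarrow> presentable \<kappa> lam C (obj_map D i)"
    by (rule class_accessible_presentation[OF C X]) (rule that, assumption+)
  note cc = colimit_imp_cocone[OF c] and cC = class_accessibleD(2)[OF C]
  obtain W :: "'u set set" and lt tip e where W: "W \<subseteq> Pow (Arr I)" "strictly_directed lam W lt"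
    "\<And>w. w \<in> W \<Longrightarrow> tip w \<in> Obj I"
    "\<And>v w. v \<in> W \<Longrightarrow> w \<in> W \<Longrightarrow> lt v w \<Longrightarrow> e v w \<in> hom I (tip v) (tip w)"
    "\<And>u v w. u \<in> W \<Longrightarrow> v \<in> W \<Longrightarrow> w \<in> W \<Longrightarrow> lt u v \<Longrightarrow> lt v w \<Longrightarrow>
      Comp I (e v w) (e u v) = e u w"
    "\<And>i. i \<in> Obj I \<Longrightarrow> \<exists>w \<in> W. \<exists>r. r \<in> hom I i (tip w)"
    "\<And>w i u. w \<in> W \<Longrightarrow> u \<in> hom I (tip w) i \<Longrightarrow>
      \<exists>v \<in> W. lt w v \<and> (\<exists>r \<in> hom I i (tip v). Comp I r u = e w v)"
    by (rule filtered_strict_refinement[OF lam small_filteredD(1)[OF I]]) (rule that, assumption+)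
  have "small \<kappa> (Arr I)" using I by (simp add: small_filtered_def small_category_def)
  then have sW: "small \<kappa> W" using small_subset[OF W(1) small_Pow[OF \<kappa>]] by blast
  have sys: "system C W lt (\<lambda>w. obj_map D (tip w)) (\<lambda>v w. arr_map D (e v w)) X (\<lambda>w. \<iota> (tip w))"
    unfolding system_def
    using cC coconeD[OF cc] W(3) W(4) W(5) functorD(4)[OF D] functorD(6)[OF D, OF W(4) W(4)] by auto
  have stage: "system_stagewise H W lt (\<lambda>w. obj_map D' (tip w)) (\<lambda>v w. arr_map D' (e v w)) d
      (\<lambda>w. \<delta> (tip w)) B"
    if D': "is_functor I H D'" and d: "cocone I H D' d \<delta>" and st: "stagewise H I D' d \<delta> B"
    for H :: "('x, 'y) cat" and D' d \<delta> B
    unfolding system_stagewise_def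
  proof (intro conjI ballI impI)
    note cH = functorD(2)[OF D'] and D'u = functorD(4)[OF D']
    fix x assume x: "x \<in> hom H B d"
    obtain i y where i: "i \<in> Obj I" "y \<in> hom H B (obj_map D' i)" "Comp H (\<delta> i) y = x"
      using stagewise_factor[OF st x] .
    obtain w r where w: "w \<in> W" "r \<in> hom I i (tip w)" using W(6)[OF i(1)] by blast
    have "Comp H (\<delta> (tip w)) (Comp H (arr_map D' r) y) = x"
      using comp_assoc[OF cH i(2) D'u[OF w(2)] coconeD(2)[OF d W(3)[OF w(1)]]] coconeD(3)[OF d w(2)] i(3)
      by simp
    then show "\<exists>w \<in> W. \<exists>y \<in> hom H B (obj_map D' (tip w)). Comp H (\<delta> (tip w)) y = x"
      using w(1) comp_hom[OF cH i(2) D'u[OF w(2)]] by blast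
  next
    note cH = functorD(2)[OF D'] and D'u = functorD(4)[OF D']
    fix w y z assume w: "w \<in> W" and y: "y \<in> hom H B (obj_map D' (tip w))"
      and z: "z \<in> hom H B (obj_map D' (tip w))" and eq: "Comp H (\<delta> (tip w)) y = Comp H (\<delta> (tip w)) z"
    obtain j u where j: "u \<in> hom I (tip w) j" "Comp H (arr_map D' u) y = Comp H (arr_map D' u) z"
      using stagewise_equalize[OF st W(3)[OF w] y z eq] by blast
    obtain v r where v: "v \<in> W" "lt w v" "r \<in> hom I j (tip v)" "Comp I r u = e w v"
      using W(7)[OF w j(1)] by blast
    have "Comp H (arr_map D' (e w v)) y = Comp H (arr_map D' (e w v)) z"
      unfolding v(4)[symmetric] functorD(6)[OF D' j(1) v(3)]
      using comp_assoc[OF cH y D'u[OF j(1)] D'u[OF v(3)]] comp_assoc[OF cH z D'u[OF j(1)] D'u[OF v(3)]]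
        j(2) by simp
    then show "\<exists>v \<in> W. lt w v \<and> Comp H (arr_map D' (e w v)) y = Comp H (arr_map D' (e w v)) z"
      using v(1,2) by blast
  qed
  have st1: "system_stagewise C W lt (\<lambda>w. obj_map D (tip w)) (\<lambda>v w. arr_map D (e v w)) X
      (\<lambda>w. \<iota> (tip w)) B" if "presentable \<kappa> lam C B" for B
    by (rule stage[OF D cc presentable_stagewise[OF \<kappa> lam(1) class_accessibleD(1)[OF C] that I D c]])
  have FD: "is_functor I E (comp_functor F D)" by (rule comp_functor_is_functor[OF D fF])
  have Fc: "colimit I E (comp_functor F D) (obj_map F X) (\<lambda>i. arr_map F (\<iota> i))"
    by (rule filtered_colimit_preserved[OF \<kappa> pF I D c])
  have st2: "system_stagewise E W lt (\<lambda>w. obj_map F (obj_map D (tip w)))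
      (\<lambda>v w. arr_map F (arr_map D (e v w))) (obj_map F X) (\<lambda>w. arr_map F (\<iota> (tip w))) B"
    if "presentable \<kappa> lam E B" for B
    using stage[OF FD colimit_imp_cocone[OF Fc]
        presentable_stagewise[OF \<kappa> lam(1) class_accessibleD(1)[OF E] that I FD Fc]] by simp
  show thesis
    by (rule that[OF sW W(2) sys]) (use pD W(3) st1 st2 in blast)+
qed

section \<open>Chains in a strictly directed system\<close>

definition thin :: "'x set \<Rightarrow> ('x \<Rightarrow> 'x \<Rightarrow> bool) \<Rightarrow> ('x, 'x \<times> 'x) cat" where
  "thin S R = \<lparr>Obj = S, Arr = {(x, y). x \<in> S \<and> y \<in> S \<and> R x y}, Dom = fst, Cod = snd,
     Ident = (\<lambda>x. (x, x)), Comp = (\<lambda>g f. (fst f, snd g))\<rparr>"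

lemma hom_thin: "u \<in> hom (thin S R) x y \<longleftrightarrow> u = (x, y) \<and> x \<in> S \<and> y \<in> S \<and> R x y"
  by (cases u) (auto simp: hom_def thin_def)

lemma thin_simps [simp]:
  "Obj (thin S R) = S" "Ident (thin S R) x = (x, x)" "Comp (thin S R) g f = (fst f, snd g)"
  by (simp_all add: thin_def)

lemma category_thin:
  assumes "\<And>x. x \<in> S \<Longrightarrow> R x x"
    and "\<And>x y z. x \<in> S \<Longrightarrow> y \<in> S \<Longrightarrow> z \<in> S \<Longrightarrow> R x y \<Longrightarrow> R y z \<Longrightarrow> R x z"
  shows "category (thin S R)"
  unfolding category_def hom_thin using assms by (auto simp: thin_def)

lemma filtered_thin:
  assumes refl: "\<And>x. x \<in> S \<Longrightarrow> R x x"
    and trans: "\<And>x y z. x \<in> S \<Longrightarrow> y \<in> S \<Longrightarrow> z \<in> S \<Longrightarrow> R x y \<Longrightarrow> R y z \<Longrightarrow> R x z"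
    and bound: "\<And>T. T \<subseteq> S \<Longrightarrow> |T| <o lam \<Longrightarrow> \<exists>s \<in> S. \<forall>t \<in> T. R t s"
  shows "filtered lam (thin S R)"
  unfolding filtered_def
proof (intro conjI allI impI ballI)
  show "category (thin S R)" by (rule category_thin[OF refl trans])
  fix T assume T: "T \<subseteq> Obj (thin S R)" "|T| <o lam"
  then obtain s where "s \<in> S" "\<forall>t \<in> T. R t s" using bound[of T] by auto
  moreover have "(i, s) \<in> hom (thin S R) i s" if "i \<in> T" for i
    using calculation T(1) that by (auto simp: hom_thin)
  ultimately show "\<exists>k \<in> Obj (thin S R). \<forall>i \<in> T. hom (thin S R) i k \<noteq> {}"
    by (intro bexI[of _ s]) auto
next
  fix i j T assume j: "j \<in> Obj (thin S R)" and T: "T \<subseteq> hom (thin S R) i j"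
  have "u = (i, j)" if "u \<in> T" for u using subsetD[OF T that] by (simp add: hom_thin)
  then show "\<exists>k \<in> Obj (thin S R). \<exists>w \<in> hom (thin S R) j k. \<forall>u \<in> T. \<forall>v \<in> T.
      Comp (thin S R) w u = Comp (thin S R) w v"
    using j refl[of j] hom_thin[of "(j, j)" S R j j] by (intro bexI[of _ j] bexI[of _ "(j, j)"]) auto
qed

lemma small_category_thin:
  assumes \<kappa>: "inaccessible \<kappa>" and S: "small \<kappa> S" and I: "category (thin S R)"
  shows "small_category \<kappa> (thin S R)"
proof -
  have "Arr (thin S R) \<subseteq> S \<times> S" by (auto simp: thin_def)
  then have "small \<kappa> (Arr (thin S R))" by (rule small_subset[OF _ small_Sigma[OF \<kappa> S S]])
  then show ?thesis using S I by (simp add: small_category_def)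
qed

lemma Field_order:
  assumes lam: "Cinfinite lam"
  shows "p \<in> Field lam \<Longrightarrow> (p, p) \<in> lam"
    and "(p, q) \<in> lam \<Longrightarrow> (q, r) \<in> lam \<Longrightarrow> (p, r) \<in> lam"
    and "(p, q) \<in> lam \<Longrightarrow> (q, p) \<in> lam \<Longrightarrow> p = q"
    and "p \<in> Field lam \<Longrightarrow> q \<in> Field lam \<Longrightarrow> (p, q) \<in> lam \<or> (q, p) \<in> lam"
    and "wf (lam - Id)"
proof -
  have "Well_order lam" using lam by (simp add: card_order_on_def)
  then have "Refl lam" "trans lam" "antisym lam" "Total lam" "wf (lam - Id)"
    by (auto simp: well_order_on_def linear_order_on_def partial_order_on_def preorder_on_def)
  then show "p \<in> Field lam \<Longrightarrow> (p, p) \<in> lam"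
    "(p, q) \<in> lam \<Longrightarrow> (q, r) \<in> lam \<Longrightarrow> (p, r) \<in> lam"
    "(p, q) \<in> lam \<Longrightarrow> (q, p) \<in> lam \<Longrightarrow> p = q"
    "p \<in> Field lam \<Longrightarrow> q \<in> Field lam \<Longrightarrow> (p, q) \<in> lam \<or> (q, p) \<in> lam"
    "wf (lam - Id)"
    by (cases "p = q"; auto simp: refl_on_def total_on_def dest: transD antisymD)+
qed

lemma regular_strict_bound:
  assumes lam: "Cinfinite lam" "regularCard lam" and P: "P \<subseteq> Field lam" "|P| <o lam"
  shows "\<exists>q \<in> Field lam. \<forall>p \<in> P. (p, q) \<in> lam \<and> p \<noteq> q"
proof -
  have "\<not> |P| =o lam" using P(2) not_ordLess_ordIso by blast
  then have "\<not> cofinal P lam" using lam(2) P(1) unfolding regularCard_def by blast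
  then obtain b where b: "b \<in> Field lam" "\<And>p. p \<in> P \<Longrightarrow> b = p \<or> (b, p) \<notin> lam"
    unfolding cofinal_def by blast
  have pb: "(p, b) \<in> lam" if "p \<in> P" for p
    using b(2)[OF that] Field_order(1,4)[OF lam(1)] b(1) P(1) that by blast
  obtain q where q: "q \<in> Field lam" "b \<noteq> q" "(b, q) \<in> lam"
    using infinite_Card_order_limit[of lam b] lam(1) b(1) by (auto simp: cinfinite_def)
  have "(p, q) \<in> lam \<and> p \<noteq> q" if "p \<in> P" for p
    using Field_order(2,3)[OF lam(1)] pb[OF that] q(2,3) by blast
  then show ?thesis using q(1) by blast
qed

lemma strict_bound2:
  assumes lam: "Cinfinite lam" "regularCard lam" and p: "p \<in> Field lam" and q: "q \<in> Field lam"
  obtains r where "r \<in> Field lam" "(p, r) \<in> lam" "p \<noteq> r" "(q, r) \<in> lam" "q \<noteq> r"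
  using regular_strict_bound[OF lam, of "{p, q}"] card_less_finite[OF lam(1), of "{p, q}"] p q that
  by auto

lemma strict_successor:
  assumes lam: "Cinfinite lam" "regularCard lam" and p: "p \<in> Field lam"
  obtains q where "q \<in> Field lam" "(p, q) \<in> lam" "p \<noteq> q"
  by (rule strict_bound2[OF lam p p]) (rule that)

text \<open>The ordinal \<open>lam\<close> as a category. By regularity it is \<open>lam\<close>-filtered, so that presentable objects see
  the colimits of chains stage by stage.\<close>

definition chain_index :: "'l rel \<Rightarrow> ('l, 'l \<times> 'l) cat" where
  "chain_index lam = thin (Field lam) (\<lambda>p q. (p, q) \<in> lam)"

lemma Obj_chain_index [simp]: "Obj (chain_index lam) = Field lam"
  by (simp add: chain_index_def)

lemma hom_chain_index: "u \<in> hom (chain_index lam) p q \<longleftrightarrow> u = (p, q) \<and> (p, q) \<in> lam"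
  unfolding chain_index_def hom_thin by (auto intro: FieldI1 FieldI2)

lemma small_filtered_chain_index:
  assumes \<kappa>: "inaccessible \<kappa>" and lam: "Cinfinite lam" "regularCard lam" "lam <o \<kappa>"
  shows "small_filtered \<kappa> lam (chain_index lam)"
proof -
  note o = Field_order[OF lam(1)]
  have "filtered lam (chain_index lam)"
    unfolding chain_index_def
  proof (rule filtered_thin)
    fix T assume "T \<subseteq> Field lam" "|T| <o lam"
    then show "\<exists>s \<in> Field lam. \<forall>t \<in> T. (t, s) \<in> lam"
      using regular_strict_bound[OF lam(1,2)] by blast
  qed (use o in blast)+
  moreover have "small \<kappa> (Field lam)"
    unfolding small_def using card_of_Field_ordIso[of lam] lam(1,3) ordIso_ordLess_trans by blast
  ultimately show ?thesis
    unfolding small_filtered_def chain_index_def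
    using small_category_thin[OF \<kappa>, of "Field lam"] filteredD(1) by blast
qed

lemma card_chain_index:
  assumes lam: "Cinfinite lam"
  shows "|Obj (chain_index lam)| <o cardSuc lam" "|Arr (chain_index lam)| <o cardSuc lam"
proof -
  have co: "Card_order lam" and inf: "\<not> finite (Field lam)" using lam by (auto simp: cinfinite_def)
  have F: "|Field lam| \<le>o lam" using card_of_Field_ordIso[OF co] ordIso_imp_ordLeq by blast
  then show "|Obj (chain_index lam)| <o cardSuc lam"
    using cardSuc_ordLeq_ordLess[OF co card_of_Card_order[of "Field lam"]] by simp
  have "Arr (chain_index lam) \<subseteq> Field lam \<times> Field lam"
    by (auto simp: chain_index_def thin_def)
  then have "|Arr (chain_index lam)| \<le>o |Field lam \<times> Field lam|" by (rule card_of_mono1)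
  also have "|Field lam \<times> Field lam| \<le>o lam"
    by (rule card_of_Times_ordLeq_infinite_Field[OF inf F F co])
  finally show "|Arr (chain_index lam)| <o cardSuc lam"
    using cardSuc_ordLeq_ordLess[OF co card_of_Card_order[of "Arr (chain_index lam)"]] by blast
qed

text \<open>Chains are extensional functions in order that they form a small set. One chain is below
  another if each of its members is below some member of the other; this is reflexive because chains
  increase strictly, and it provides an arrow between the colimits.\<close>

definition chains :: "'l rel \<Rightarrow> 'w set \<Rightarrow> ('w \<Rightarrow> 'w \<Rightarrow> bool) \<Rightarrow> ('l \<Rightarrow> 'w) set" where
  "chains lam W lt =
     {w \<in> Field lam \<rightarrow>\<^sub>E W. \<forall>p q. (p, q) \<in> lam \<longrightarrow> p \<noteq> q \<longrightarrow> lt (w p) (w q)}"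

definition chain_le :: "'l rel \<Rightarrow> ('w \<Rightarrow> 'w \<Rightarrow> bool) \<Rightarrow> ('l \<Rightarrow> 'w) \<Rightarrow> ('l \<Rightarrow> 'w) \<Rightarrow> bool" where
  "chain_le lam lt v w \<longleftrightarrow> (\<forall>p \<in> Field lam. \<exists>q \<in> Field lam. lt (v p) (w q))"

lemma chainsD:
  assumes "w \<in> chains lam W lt"
  shows "p \<in> Field lam \<Longrightarrow> w p \<in> W" "(p, q) \<in> lam \<Longrightarrow> p \<noteq> q \<Longrightarrow> lt (w p) (w q)"
  using assms by (auto simp: chains_def)

text \<open>The reason why \<open>lam\<close> and its successor fit together: \<open>lam\<close> elements of a \<open>lam\<close>-directed
  system are dominated by one chain of length \<open>lam\<close>, since at each step fewer than \<open>lam\<close>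
  elements have to be bounded.\<close>

lemma chain_above:
  assumes lam: "Cinfinite lam" and dir: "strictly_directed lam W lt"
    and Z: "Z \<subseteq> W" "|Z| \<le>o lam"
  shows "\<exists>w \<in> chains lam W lt. \<forall>z \<in> Z. \<exists>p \<in> Field lam. lt z (w p)"
proof -
  have co: "Card_order lam" using lam by simp
  obtain w0 where w0: "w0 \<in> W"
    by (rule strictly_directed_bound[OF dir, of "{}"]) (auto intro: card_less_finite[OF lam])
  have "|insert w0 Z| \<le>o lam"
    using Un_Cinfinite_bound[OF _ Z(2) lam, of "{w0}"] card_less_finite[OF lam, of "{w0}"]
      ordLess_imp_ordLeq by (metis finite.emptyI finite.insertI insert_is_Un)
  then have "|insert w0 Z| \<le>o |Field lam|"
    using card_of_Field_ordIso[OF co] ordIso_symmetric ordLeq_ordIso_trans by blast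
  then obtain y where y: "y ` Field lam = insert w0 Z"
    using card_of_ordLeq2[of "insert w0 Z" "Field lam"] by blast
  have yW: "y p \<in> W" if "p \<in> Field lam" for p
    using imageI[OF that, of y] unfolding y using w0 Z(1) by blast
  define P where "P f p r \<longleftrightarrow> (p \<in> Field lam \<longrightarrow> r \<in> W \<and> lt (y p) r \<and> (\<forall>q \<in> underS lam p. lt (f q) r))"
    for f p r
  have "\<exists>f. \<forall>p. P f p (f p)"
  proof (rule dependent_wf_choice[of "lam - Id"])
    show "wf (lam - Id)" by (rule Field_order(5)[OF lam])
    show "P f p r = P g p r" if "\<And>q. (q, p) \<in> lam - Id \<Longrightarrow> f q = g q" for f g p r
      using that unfolding P_def underS_def by auto
    show "\<exists>r. P f p r" if f: "\<And>q. (q, p) \<in> lam - Id \<Longrightarrow> P f q (f q)" for p f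
    proof (cases "p \<in> Field lam")
      case True
      have "f ` underS lam p \<subseteq> W"
      proof
        fix x assume "x \<in> f ` underS lam p"
        then obtain q where q: "x = f q" "(q, p) \<in> lam" "q \<noteq> p" by (auto simp: underS_def)
        then show "x \<in> W" using f[of q] FieldI1[of q p lam] by (auto simp: P_def)
      qed
      moreover have "|{y p} \<union> f ` underS lam p| <o lam"
        by (rule card_less_Un[OF lam card_less_finite[OF lam] card_less_image[OF card_of_underS[OF co True]]])
          simp
      ultimately obtain r where "r \<in> W" "\<And>s. s \<in> {y p} \<union> f ` underS lam p \<Longrightarrow> lt s r"
        using strictly_directed_bound[OF dir, of "{y p} \<union> f ` underS lam p"] yW[OF True] by auto
      then show ?thesis unfolding P_def by blast
    qed (simp add: P_def)
  qed
  then obtain f where f: "\<And>p. P f p (f p)" by blast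
  let ?w = "restrict f (Field lam)"
  have "?w \<in> chains lam W lt"
    unfolding chains_def
  proof (intro CollectI conjI allI impI)
    show "?w \<in> Field lam \<rightarrow>\<^sub>E W" using f unfolding P_def by auto
    fix p q assume pq: "(p, q) \<in> lam" "p \<noteq> q"
    then have "p \<in> underS lam q" "p \<in> Field lam" "q \<in> Field lam"
      by (auto simp: underS_def intro: FieldI1 FieldI2)
    then show "lt (?w p) (?w q)" using f[of q] unfolding P_def by simp
  qed
  moreover have "\<exists>p \<in> Field lam. lt z (?w p)" if "z \<in> Z" for z
  proof -
    have "z \<in> y ` Field lam" unfolding y using that by simp
    then obtain p where "p \<in> Field lam" "y p = z" by auto
    then show ?thesis using f[of p] unfolding P_def by auto
  qed
  ultimately show ?thesis by (intro bexI[of _ ?w] ballI)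
qed

lemma chain_le_refl:
  assumes lam: "Cinfinite lam" "regularCard lam" and w: "w \<in> chains lam W lt"
  shows "chain_le lam lt w w"
  unfolding chain_le_def
proof
  fix p assume "p \<in> Field lam"
  then obtain q where "q \<in> Field lam" "(p, q) \<in> lam" "p \<noteq> q"
    using strict_successor[OF lam] by metis
  then show "\<exists>q \<in> Field lam. lt (w p) (w q)" using chainsD(2)[OF w] by blast
qed

lemma chain_le_trans:
  assumes dir: "strictly_directed lam W lt"
    and T: "u \<in> chains lam W lt" "v \<in> chains lam W lt" "w \<in> chains lam W lt"
    and le: "chain_le lam lt u v" "chain_le lam lt v w"
  shows "chain_le lam lt u w"
  unfolding chain_le_def
proof
  fix p assume p: "p \<in> Field lam"
  obtain q where q: "q \<in> Field lam" "lt (u p) (v q)" using le(1) p unfolding chain_le_def by blast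
  obtain r where r: "r \<in> Field lam" "lt (v q) (w r)" using le(2) q(1) unfolding chain_le_def by blast
  have "lt (u p) (w r)"
    by (rule strictly_directed_trans[OF dir q(2) r(2) chainsD(1)[OF T(1) p] chainsD(1)[OF T(2) q(1)]
          chainsD(1)[OF T(3) r(1)]])
  then show "\<exists>q \<in> Field lam. lt (u p) (w q)" using r(1) by blast
qed

lemma small_filtered_chains:
  fixes lam :: "'l rel"
  assumes \<kappa>: "inaccessible \<kappa>" and lam: "Cinfinite lam" "regularCard lam" "lam <o \<kappa>"
    and dir: "strictly_directed lam W lt" and W: "small \<kappa> W"
  shows "small_filtered \<kappa> (cardSuc lam) (thin (chains lam W lt) (chain_le lam lt))"
proof -
  have co: "Card_order lam" using lam(1) by simp
  have F: "|Field lam| \<le>o lam" using card_of_Field_ordIso[OF co] ordIso_imp_ordLeq by blast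
  have "filtered (cardSuc lam) (thin (chains lam W lt) (chain_le lam lt))"
  proof (rule filtered_thin)
    fix T assume T: "T \<subseteq> chains lam W lt" "|T| <o cardSuc lam"
    then have T': "|T| \<le>o lam" using cardSuc_ordLeq_ordLess[OF co card_of_Card_order[of T]] by blast
    let ?Z = "\<Union>w\<in>T. w ` Field lam"
    have "|?Z| \<le>o lam"
    proof (rule UNION_Cinfinite_bound[OF T' _ lam(1)])
      show "\<forall>w \<in> T. |w ` Field lam| \<le>o lam" by (intro ballI ordLeq_transitive[OF card_of_image F])
    qed
    moreover have "?Z \<subseteq> W"
    proof
      fix z assume "z \<in> ?Z"
      then obtain w p where "w \<in> T" "p \<in> Field lam" "z = w p" by auto
      then show "z \<in> W" using chainsD(1)[OF subsetD[OF T(1)]] by simp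
    qed
    ultimately have "\<exists>w \<in> chains lam W lt. \<forall>z \<in> ?Z. \<exists>p \<in> Field lam. lt z (w p)"
      by (intro chain_above[OF lam(1) dir])
    then obtain w where w: "w \<in> chains lam W lt" "\<forall>z \<in> ?Z. \<exists>p \<in> Field lam. lt z (w p)" by (elim bexE)
    have "chain_le lam lt t w" if "t \<in> T" for t
      unfolding chain_le_def using w(2) that by simp
    then show "\<exists>s \<in> chains lam W lt. \<forall>t \<in> T. chain_le lam lt t s"
      by (intro bexI[OF _ w(1)] ballI)
  qed (use chain_le_refl[OF lam(1,2)] chain_le_trans[OF dir] in blast)+
  moreover have "small \<kappa> (chains lam W lt)"
  proof (rule small_subset)
    show "chains lam W lt \<subseteq> Field lam \<rightarrow>\<^sub>E W" by (auto simp: chains_def)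
    show "small \<kappa> (Field lam \<rightarrow>\<^sub>E W)"
      using small_PiE[OF \<kappa> _ W] F lam(3) ordLeq_ordLess_trans unfolding small_def by blast
  qed
  ultimately show ?thesis
    unfolding small_filtered_def using small_category_thin[OF \<kappa>] filteredD(1) by blast
qed

section \<open>Colimits of chains\<close>

definition chain_diagram ::
  "('o, 'a) cat \<Rightarrow> ('w \<Rightarrow> 'o) \<Rightarrow> ('w \<Rightarrow> 'w \<Rightarrow> 'a) \<Rightarrow> ('l \<Rightarrow> 'w) \<Rightarrow> ('l, 'l \<times> 'l, 'o, 'a) fctr" where
  "chain_diagram C A a w = \<lparr>obj_map = (\<lambda>p. A (w p)),
     arr_map = (\<lambda>(p, q). if p = q then Ident C (A (w p)) else a (w p) (w q))\<rparr>"

lemma chain_diagram_simps [simp]: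
  "obj_map (chain_diagram C A a w) p = A (w p)"
  "arr_map (chain_diagram C A a w) (p, q) = (if p = q then Ident C (A (w p)) else a (w p) (w q))"
  by (simp_all add: chain_diagram_def)

definition chain_functor :: "(('l \<Rightarrow> 'w) \<Rightarrow> 'o) \<Rightarrow> (('l \<Rightarrow> 'w) \<Rightarrow> ('l \<Rightarrow> 'w) \<Rightarrow> 'a) \<Rightarrow>
    ('l \<Rightarrow> 'w, ('l \<Rightarrow> 'w) \<times> ('l \<Rightarrow> 'w), 'o, 'a) fctr" where
  "chain_functor N m = \<lparr>obj_map = N, arr_map = (\<lambda>(v, w). m v w)\<rparr>"

context
  fixes lam :: "'l rel" and C :: "('o, 'a) cat" and W :: "'w set" and lt A a K \<alpha>
  assumes lam: "Cinfinite lam" "regularCard lam"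
    and dir: "strictly_directed lam W lt" and sys: "system C W lt A a K \<alpha>"
begin

lemma chain_diagram_functor:
  assumes w: "w \<in> chains lam W lt"
  shows "is_functor (chain_index lam) C (chain_diagram C A a w)"
proof -
  note s = systemD[OF sys] and o = Field_order[OF lam(1)] and wD = chainsD[OF w]
  have F: "p \<in> Field lam" "q \<in> Field lam" if "(p, q) \<in> lam" for p q
    using that by (auto intro: FieldI1 FieldI2)
  have obj: "A (w p) \<in> Obj C" if "p \<in> Field lam" for p
    by (rule hom_objD(1)[OF s(1) s(3)[OF wD(1)[OF that]]])
  have tr: "a (w p) (w q) \<in> hom C (A (w p)) (A (w q))" if "(p, q) \<in> lam" "p \<noteq> q" for p q
    by (rule s(4)[OF wD(1)[OF F(1)[OF that(1)]] wD(1)[OF F(2)[OF that(1)]] wD(2)[OF that]])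
  show ?thesis
    unfolding is_functor_def
  proof (intro conjI ballI allI impI s(1))
    show "category (chain_index lam)"
      unfolding chain_index_def by (rule category_thin) (use o in blast)+
  next
    fix p assume "p \<in> Obj (chain_index lam)"
    then show "obj_map (chain_diagram C A a w) p \<in> Obj C"
      "arr_map (chain_diagram C A a w) (Ident (chain_index lam) p) =
        Ident C (obj_map (chain_diagram C A a w) p)"
      using obj by (simp_all add: chain_index_def)
  next
    fix p q f assume "f \<in> hom (chain_index lam) p q"
    then have f: "f = (p, q)" "(p, q) \<in> lam" by (simp_all add: hom_chain_index)
    show "arr_map (chain_diagram C A a w) f \<in>
        hom C (obj_map (chain_diagram C A a w) p) (obj_map (chain_diagram C A a w) q)"
      using tr[of p q] f(2) ident_hom[OF s(1) obj[OF F(1)[OF f(2)]]] unfolding f(1)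
      by (cases "p = q") simp_all
  next
    fix p q r f g assume "f \<in> hom (chain_index lam) p q" "g \<in> hom (chain_index lam) q r"
    then have f: "f = (p, q)" "(p, q) \<in> lam" and g: "g = (q, r)" "(q, r) \<in> lam"
      by (simp_all add: hom_chain_index)
    note o' = o(2)[OF f(2) g(2)]
    have c: "Comp (chain_index lam) g f = (p, r)" by (simp add: f g chain_index_def)
    consider "p = q" | "q = r" | "p \<noteq> q" "q \<noteq> r" "p \<noteq> r" using o(3) f(2) g(2) by blast
    then show "arr_map (chain_diagram C A a w) (Comp (chain_index lam) g f) =
        Comp C (arr_map (chain_diagram C A a w) g) (arr_map (chain_diagram C A a w) f)"
    proof cases
      case 1
      then show ?thesis
        using c f(1) g ident_right[OF s(1) tr[OF g(2)]]
          ident_right[OF s(1) ident_hom[OF s(1) obj[OF F(1)[OF f(2)]]]] by auto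
    next
      case 2
      then show ?thesis
        using c f g(1) ident_left[OF s(1) tr[OF f(2)]]
          ident_right[OF s(1) ident_hom[OF s(1) obj[OF F(1)[OF f(2)]]]] by auto
    next
      case 3
      then show ?thesis
        using c f g s(6)[OF wD(1)[OF F(1)[OF f(2)]] wD(1)[OF F(2)[OF f(2)]] wD(1)[OF F(2)[OF g(2)]]
            wD(2)[OF f(2)] wD(2)[OF g(2)] wD(2)[OF o']] by auto
    qed
  qed
qed

lemma chain_cocone_trans:
  assumes w: "w \<in> chains lam W lt" and c: "cocone (chain_index lam) C (chain_diagram C A a w) c \<iota>"
    and pq: "(p, q) \<in> lam" "p \<noteq> q"
  shows "Comp C (\<iota> q) (a (w p) (w q)) = \<iota> p"
  using coconeD(3)[OF c, of "(p, q)" p q] pq by (simp add: hom_chain_index)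

lemma chain_cocone_leg:
  assumes c: "cocone (chain_index lam) C (chain_diagram C A a w) c \<iota>" and p: "p \<in> Field lam"
  shows "\<iota> p \<in> hom C (A (w p)) c"
  using coconeD(2)[OF c, of p] p by simp

lemma chain_coconeI:
  assumes w: "w \<in> chains lam W lt" and c: "c \<in> Obj C"
    and leg: "\<And>p. p \<in> Field lam \<Longrightarrow> \<iota> p \<in> hom C (A (w p)) c"
    and tr: "\<And>p q. (p, q) \<in> lam \<Longrightarrow> p \<noteq> q \<Longrightarrow> Comp C (\<iota> q) (a (w p) (w q)) = \<iota> p"
  shows "cocone (chain_index lam) C (chain_diagram C A a w) c \<iota>"
  unfolding cocone_def
proof (intro conjI ballI allI impI c)
  fix p q f assume "f \<in> hom (chain_index lam) p q"
  then have f: "f = (p, q)" "(p, q) \<in> lam" by (simp_all add: hom_chain_index)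
  show "Comp C (\<iota> q) (arr_map (chain_diagram C A a w) f) = \<iota> p"
    using tr[OF f(2)] ident_right[OF systemD(1)[OF sys] leg[OF FieldI1[OF f(2)]]] unfolding f(1)
    by auto
qed (simp add: leg)

text \<open>Both composites equal the one through a member of the chain above the two given members.\<close>

lemma chain_cocone_stage_irrelevant:
  assumes w: "w \<in> chains lam W lt" and c: "cocone (chain_index lam) C (chain_diagram C A a w) c \<iota>"
    and v: "v \<in> W" and p: "p \<in> Field lam" "lt v (w p)" and q: "q \<in> Field lam" "lt v (w q)"
  shows "Comp C (\<iota> p) (a v (w p)) = Comp C (\<iota> q) (a v (w q))"
proof -
  note s = systemD[OF sys] and wD = chainsD[OF w]
  obtain r where r: "r \<in> Field lam" "(p, r) \<in> lam" "p \<noteq> r" "(q, r) \<in> lam" "q \<noteq> r"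
    using strict_bound2[OF lam p(1) q(1)] .
  have "Comp C (\<iota> x) (a v (w x)) = Comp C (\<iota> r) (a v (w r))"
    if x: "x \<in> Field lam" "lt v (w x)" "(x, r) \<in> lam \<and> x \<noteq> r" for x
  proof -
    have xr: "lt (w x) (w r)" using wD(2) x(3) by blast
    have vr: "lt v (w r)" by (rule strictly_directed_trans[OF dir x(2) xr v wD(1)[OF x(1)] wD(1)[OF r(1)]])
    have "\<iota> x = Comp C (\<iota> r) (a (w x) (w r))" using chain_cocone_trans[OF w c] x(3) by metis
    then have "Comp C (\<iota> x) (a v (w x)) = Comp C (\<iota> r) (Comp C (a (w x) (w r)) (a v (w x)))"
      using comp_assoc[OF s(1) s(4)[OF v wD(1)[OF x(1)] x(2)] s(4)[OF wD(1)[OF x(1)] wD(1)[OF r(1)] xr]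
          chain_cocone_leg[OF c r(1)]] by simp
    then show ?thesis using s(6)[OF v wD(1)[OF x(1)] wD(1)[OF r(1)] x(2) xr vr] by simp
  qed
  from this[OF p] this[OF q] show ?thesis using r by simp
qed

text \<open>A choice of colimits \<open>N w\<close> of the chains, with the induced arrows \<open>\<nu> w\<close> to the apex of the system and
  the induced arrows \<open>m v w\<close> between the colimits of comparable chains.\<close>

definition chain_colimits :: "(('l \<Rightarrow> 'w) \<Rightarrow> 'o) \<Rightarrow> (('l \<Rightarrow> 'w) \<Rightarrow> 'l \<Rightarrow> 'a) \<Rightarrow>
    (('l \<Rightarrow> 'w) \<Rightarrow> 'a) \<Rightarrow> (('l \<Rightarrow> 'w) \<Rightarrow> ('l \<Rightarrow> 'w) \<Rightarrow> 'a) \<Rightarrow> bool" where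
  "chain_colimits N leg \<nu> m \<longleftrightarrow>
     (\<forall>w \<in> chains lam W lt. colimit (chain_index lam) C (chain_diagram C A a w) (N w) (leg w)) \<and>
     (\<forall>w \<in> chains lam W lt. \<nu> w \<in> hom C (N w) K \<and>
        (\<forall>p \<in> Field lam. Comp C (\<nu> w) (leg w p) = \<alpha> (w p))) \<and>
     (\<forall>v \<in> chains lam W lt. \<forall>w \<in> chains lam W lt. chain_le lam lt v w \<longrightarrow> m v w \<in> hom C (N v) (N w) \<and>
        (\<forall>p \<in> Field lam. \<forall>q \<in> Field lam. lt (v p) (w q) \<longrightarrow>
           Comp C (m v w) (leg v p) = Comp C (leg w q) (a (v p) (w q))))"

lemma chain_colimitsD:
  assumes "chain_colimits N leg \<nu> m"
  shows "w \<in> chains lam W lt \<Longrightarrow>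
      colimit (chain_index lam) C (chain_diagram C A a w) (N w) (leg w)"
    and "w \<in> chains lam W lt \<Longrightarrow> \<nu> w \<in> hom C (N w) K"
    and "w \<in> chains lam W lt \<Longrightarrow> p \<in> Field lam \<Longrightarrow> Comp C (\<nu> w) (leg w p) = \<alpha> (w p)"
    and "v \<in> chains lam W lt \<Longrightarrow> w \<in> chains lam W lt \<Longrightarrow> chain_le lam lt v w \<Longrightarrow>
      m v w \<in> hom C (N v) (N w)"
    and "v \<in> chains lam W lt \<Longrightarrow> w \<in> chains lam W lt \<Longrightarrow> chain_le lam lt v w \<Longrightarrow>
      p \<in> Field lam \<Longrightarrow> q \<in> Field lam \<Longrightarrow> lt (v p) (w q) \<Longrightarrow>
      Comp C (m v w) (leg v p) = Comp C (leg w q) (a (v p) (w q))"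
    and "w \<in> chains lam W lt \<Longrightarrow> p \<in> Field lam \<Longrightarrow> leg w p \<in> hom C (A (w p)) (N w)"
proof -
  note d = assms[unfolded chain_colimits_def]
  show 1: "colimit (chain_index lam) C (chain_diagram C A a w) (N w) (leg w)"
    if "w \<in> chains lam W lt" for w using d[THEN conjunct1] that by blast
  show "leg w p \<in> hom C (A (w p)) (N w)" if "w \<in> chains lam W lt" "p \<in> Field lam"
    by (rule chain_cocone_leg[OF colimit_imp_cocone[OF 1[OF that(1)]] that(2)])
qed (use assms[unfolded chain_colimits_def, THEN conjunct2] in blast)+

lemma chain_colimits_exist:
  fixes \<kappa> :: "'u rel"
  assumes \<kappa>: "inaccessible \<kappa>" "lam <o \<kappa>" and C: "has_filtered_colimits \<kappa> lam C"
  obtains N leg \<nu> m where "chain_colimits N leg \<nu> m"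
proof -
  note s = systemD[OF sys]
  let ?T = "chains lam W lt"
  have "\<exists>n l. colimit (chain_index lam) C (chain_diagram C A a w) n l" if w: "w \<in> ?T" for w
    using filtered_colimit_exists[OF \<kappa>(1) C small_filtered_chain_index[OF \<kappa>(1) lam \<kappa>(2)]
        chain_diagram_functor[OF w]] by blast
  then obtain N leg where
    N: "\<And>w. w \<in> ?T \<Longrightarrow> colimit (chain_index lam) C (chain_diagram C A a w) (N w) (leg w)" by metis
  note Nc = colimit_imp_cocone[OF N]
  have legh: "leg w p \<in> hom C (A (w p)) (N w)" if "w \<in> ?T" "p \<in> Field lam" for w p
    by (rule chain_cocone_leg[OF Nc[OF that(1)] that(2)])
  have "\<exists>n. n \<in> hom C (N w) K \<and> (\<forall>p \<in> Field lam. Comp C n (leg w p) = \<alpha> (w p))" if w: "w \<in> ?T" for w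
  proof -
    have "cocone (chain_index lam) C (chain_diagram C A a w) K (\<lambda>p. \<alpha> (w p))"
    proof (rule chain_coconeI[OF w s(2)])
      show "\<alpha> (w p) \<in> hom C (A (w p)) K" if "p \<in> Field lam" for p
        by (rule s(3)[OF chainsD(1)[OF w that]])
      show "Comp C (\<alpha> (w q)) (a (w p) (w q)) = \<alpha> (w p)" if "(p, q) \<in> lam" "p \<noteq> q" for p q
        by (rule s(5)[OF chainsD(1)[OF w FieldI1[OF that(1)]] chainsD(1)[OF w FieldI2[OF that(1)]]
              chainsD(2)[OF w that]])
    qed
    then obtain n where "n \<in> hom C (N w) K"
        "\<And>p. p \<in> Obj (chain_index lam) \<Longrightarrow> Comp C n (leg w p) = \<alpha> (w p)"
      using colimit_factor[OF N[OF w]] by blast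
    then show ?thesis by auto
  qed
  then obtain \<nu> where \<nu>: "\<And>w. w \<in> ?T \<Longrightarrow>
    \<nu> w \<in> hom C (N w) K \<and> (\<forall>p \<in> Field lam. Comp C (\<nu> w) (leg w p) = \<alpha> (w p))" by metis
  have "\<exists>x. x \<in> hom C (N v) (N w) \<and> (\<forall>p \<in> Field lam. \<forall>q \<in> Field lam. lt (v p) (w q) \<longrightarrow>
      Comp C x (leg v p) = Comp C (leg w q) (a (v p) (w q)))"
    if v: "v \<in> ?T" and w: "w \<in> ?T" and le: "chain_le lam lt v w" for v w
  proof -
    obtain b where b: "\<And>p. p \<in> Field lam \<Longrightarrow> b p \<in> Field lam \<and> lt (v p) (w (b p))"
      using le unfolding chain_le_def by metis
    let ?l = "\<lambda>p. Comp C (leg w (b p)) (a (v p) (w (b p)))"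
    have irr: "?l p = Comp C (leg w q) (a (v p) (w q))"
      if "p \<in> Field lam" "q \<in> Field lam" "lt (v p) (w q)" for p q
      using chain_cocone_stage_irrelevant[OF w Nc[OF w] chainsD(1)[OF v that(1)]] b[OF that(1)] that(2,3)
      by blast
    have tr: "a (v p) (w q) \<in> hom C (A (v p)) (A (w q))"
      if "p \<in> Field lam" "q \<in> Field lam" "lt (v p) (w q)" for p q
      by (rule s(4)[OF chainsD(1)[OF v that(1)] chainsD(1)[OF w that(2)] that(3)])
    have "cocone (chain_index lam) C (chain_diagram C A a v) (N w) ?l"
    proof (rule chain_coconeI[OF v coconeD(1)[OF Nc[OF w]]])
      show "?l p \<in> hom C (A (v p)) (N w)" if "p \<in> Field lam" for p
        using comp_hom[OF s(1) tr[OF that] legh[OF w]] b[OF that] by blast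
      fix p q assume pq: "(p, q) \<in> lam" "p \<noteq> q"
      have p: "p \<in> Field lam" and q: "q \<in> Field lam" using pq(1) by (auto intro: FieldI1 FieldI2)
      have bq: "b q \<in> Field lam" "lt (v q) (w (b q))" using b[OF q] by auto
      have lvq: "lt (v p) (v q)" by (rule chainsD(2)[OF v pq])
      have l: "lt (v p) (w (b q))"
        by (rule strictly_directed_trans[OF dir lvq bq(2) chainsD(1)[OF v p] chainsD(1)[OF v q]
              chainsD(1)[OF w bq(1)]])
      have "Comp C (?l q) (a (v p) (v q)) = Comp C (leg w (b q)) (Comp C (a (v q) (w (b q))) (a (v p) (v q)))"
        by (rule comp_assoc[OF s(1) s(4)[OF chainsD(1)[OF v p] chainsD(1)[OF v q] lvq]
              tr[OF q bq] legh[OF w bq(1)], symmetric])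
      also have "\<dots> = ?l p"
        using s(6)[OF chainsD(1)[OF v p] chainsD(1)[OF v q] chainsD(1)[OF w bq(1)] lvq bq(2) l]
          irr[OF p bq(1) l] by simp
      finally show "Comp C (?l q) (a (v p) (v q)) = ?l p" .
    qed
    then obtain x where "x \<in> hom C (N v) (N w)"
        "\<And>p. p \<in> Obj (chain_index lam) \<Longrightarrow> Comp C x (leg v p) = ?l p"
      using colimit_factor[OF N[OF v]] by blast
    then show ?thesis using irr by (intro exI[of _ x]) simp
  qed
  then obtain m where m: "\<And>v w. v \<in> ?T \<Longrightarrow> w \<in> ?T \<Longrightarrow> chain_le lam lt v w \<Longrightarrow>
    m v w \<in> hom C (N v) (N w) \<and> (\<forall>p \<in> Field lam. \<forall>q \<in> Field lam. lt (v p) (w q) \<longrightarrow>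
      Comp C (m v w) (leg v p) = Comp C (leg w q) (a (v p) (w q)))" by metis
  have "chain_colimits N leg \<nu> m"
    unfolding chain_colimits_def using N \<nu> m by blast
  then show thesis by (rule that)
qed

lemma chain_functor_is_functor:
  assumes N: "chain_colimits N leg \<nu> m"
  shows "is_functor (thin (chains lam W lt) (chain_le lam lt)) C (chain_functor N m)"
proof -
  note s = systemD[OF sys] and n = chain_colimitsD[OF N]
  let ?T = "chains lam W lt"
  note o = coconeD(1)[OF colimit_imp_cocone[OF n(1)]]
  have mid: "m w w = Ident C (N w)" if w: "w \<in> ?T" for w
  proof (rule colimit_ext[OF chain_diagram_functor[OF w] n(1)[OF w] n(4)[OF w w] ident_hom[OF s(1) o[OF w]]])
    show le: "chain_le lam lt w w" by (rule chain_le_refl[OF lam w])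
    fix p assume "p \<in> Obj (chain_index lam)"
    then have p: "p \<in> Field lam" by simp
    obtain q where q: "q \<in> Field lam" "(p, q) \<in> lam" "p \<noteq> q"
      using strict_successor[OF lam p] .
    have "Comp C (m w w) (leg w p) = leg w p"
      using n(5)[OF w w le p q(1) chainsD(2)[OF w q(2,3)]]
        chain_cocone_trans[OF w colimit_imp_cocone[OF n(1)[OF w]] q(2,3)] by simp
    then show "Comp C (m w w) (leg w p) = Comp C (Ident C (N w)) (leg w p)"
      using ident_left[OF s(1) n(6)[OF w p]] by simp
  qed
  have mcomp: "m u w = Comp C (m v w) (m u v)"
    if u: "u \<in> ?T" and v: "v \<in> ?T" and w: "w \<in> ?T" and uv: "chain_le lam lt u v"
      and vw: "chain_le lam lt v w" for u v w
  proof -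
    note uw = chain_le_trans[OF dir u v w uv vw]
    show ?thesis
    proof (rule colimit_ext[OF chain_diagram_functor[OF u] n(1)[OF u] n(4)[OF u w uw]
          comp_hom[OF s(1) n(4)[OF u v uv] n(4)[OF v w vw]]])
      fix p assume "p \<in> Obj (chain_index lam)"
      then have p: "p \<in> Field lam" by simp
      obtain q where q: "q \<in> Field lam" "lt (u p) (v q)" using uv p unfolding chain_le_def by blast
      obtain r where r: "r \<in> Field lam" "lt (v q) (w r)" using vw q(1) unfolding chain_le_def by blast
      note up = chainsD(1)[OF u p] and vq = chainsD(1)[OF v q(1)] and wr = chainsD(1)[OF w r(1)]
      have l: "lt (u p) (w r)" by (rule strictly_directed_trans[OF dir q(2) r(2) up vq wr])
      have "Comp C (Comp C (m v w) (m u v)) (leg u p) = Comp C (m v w) (Comp C (leg v q) (a (u p) (v q)))"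
        using comp_assoc[OF s(1) n(6)[OF u p] n(4)[OF u v uv] n(4)[OF v w vw]]
          n(5)[OF u v uv p q(1) q(2)] by simp
      also have "\<dots> = Comp C (Comp C (leg w r) (a (v q) (w r))) (a (u p) (v q))"
        using comp_assoc[OF s(1) s(4)[OF up vq q(2)] n(6)[OF v q(1)] n(4)[OF v w vw]]
          n(5)[OF v w vw q(1) r(1) r(2)] by simp
      also have "\<dots> = Comp C (leg w r) (a (u p) (w r))"
        using comp_assoc[OF s(1) s(4)[OF up vq q(2)] s(4)[OF vq wr r(2)] n(6)[OF w r(1)]]
          s(6)[OF up vq wr q(2) r(2) l] by simp
      also have "\<dots> = Comp C (m u w) (leg u p)" by (rule n(5)[OF u w uw p r(1) l, symmetric])
      finally show "Comp C (m u w) (leg u p) = Comp C (Comp C (m v w) (m u v)) (leg u p)" by (rule sym)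
    qed
  qed
  have "category (thin ?T (chain_le lam lt))"
    by (rule category_thin) (use chain_le_refl[OF lam] chain_le_trans[OF dir] in blast)+
  then show ?thesis
    unfolding is_functor_def hom_thin chain_functor_def using s(1) o mid mcomp n(4) by auto
qed

lemma chain_functor_cocone:
  assumes N: "chain_colimits N leg \<nu> m"
  shows "cocone (thin (chains lam W lt) (chain_le lam lt)) C (chain_functor N m) K \<nu>"
proof -
  note s = systemD[OF sys] and n = chain_colimitsD[OF N]
  let ?T = "chains lam W lt"
  have "Comp C (\<nu> w) (m v w) = \<nu> v" if v: "v \<in> ?T" and w: "w \<in> ?T" and vw: "chain_le lam lt v w" for v w
  proof (rule colimit_ext[OF chain_diagram_functor[OF v] n(1)[OF v] comp_hom[OF s(1) n(4)[OF v w vw] n(2)[OF w]]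
        n(2)[OF v]])
    fix p assume "p \<in> Obj (chain_index lam)"
    then have p: "p \<in> Field lam" by simp
    obtain q where q: "q \<in> Field lam" "lt (v p) (w q)" using vw p unfolding chain_le_def by blast
    note vp = chainsD(1)[OF v p] and wq = chainsD(1)[OF w q(1)]
    show "Comp C (Comp C (\<nu> w) (m v w)) (leg v p) = Comp C (\<nu> v) (leg v p)"
      using comp_assoc[OF s(1) n(6)[OF v p] n(4)[OF v w vw] n(2)[OF w]] n(5)[OF v w vw p q]
        comp_assoc[OF s(1) s(4)[OF vp wq q(2)] n(6)[OF w q(1)] n(2)[OF w]] n(3)[OF w q(1)] n(3)[OF v p]
        s(5)[OF vp wq q(2)] by simp
  qed
  then show ?thesis
    unfolding cocone_def hom_thin chain_functor_def using s(2) n(2) by auto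
qed

text \<open>The chains exhaust whatever the system exhausts. An arrow into the colimit of a chain factors
  through a member of the chain, so that an identification in \<open>K\<close> happens at some element of the
  system, and any chain above both the given chain and this element realizes it.\<close>

lemma chain_functor_stagewise:
  fixes \<kappa> :: "'u rel"
  assumes \<kappa>: "inaccessible \<kappa>" "lam <o \<kappa>" and C: "class_category \<kappa> C"
    and N: "chain_colimits N leg \<nu> m" and B: "presentable \<kappa> lam C B"
    and st: "system_stagewise C W lt A a K \<alpha> B"
  shows "stagewise C (thin (chains lam W lt) (chain_le lam lt)) (chain_functor N m) K \<nu> B"
  unfolding stagewise_def chain_functor_def thin_simps fctr.simps
proof (intro conjI ballI impI)
  note s = systemD[OF sys] and n = chain_colimitsD[OF N]
  let ?T = "chains lam W lt"
  have one: "|{z}| \<le>o lam" for z :: 'w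
    by (rule ordLess_imp_ordLeq[OF card_less_finite[OF lam(1)]]) simp
  {
    fix x assume x: "x \<in> hom C B K"
    obtain v y where v: "v \<in> W" "y \<in> hom C B (A v)" "Comp C (\<alpha> v) y = x"
      using system_stagewise_factor[OF st x] .
    obtain w p where w: "w \<in> ?T" and p: "p \<in> Field lam" "lt v (w p)"
      using chain_above[OF lam(1) dir _ one, of v] v(1) by blast
    note wp = chainsD(1)[OF w p(1)] and h = s(4)[OF v(1) chainsD(1)[OF w p(1)] p(2)]
    have "Comp C (\<nu> w) (Comp C (leg w p) (Comp C (a v (w p)) y)) = x"
      using comp_assoc[OF s(1) comp_hom[OF s(1) v(2) h] n(6)[OF w p(1)] n(2)[OF w]]
        n(3)[OF w p(1)] comp_assoc[OF s(1) v(2) h s(3)[OF wp]] s(5)[OF v(1) wp p(2)] v(3) by simp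
    then show "\<exists>w \<in> ?T. \<exists>y \<in> hom C B (N w). Comp C (\<nu> w) y = x"
      using w comp_hom[OF s(1) comp_hom[OF s(1) v(2) h] n(6)[OF w p(1)]] by blast
  next
    fix w y z assume w: "w \<in> ?T" and y: "y \<in> hom C B (N w)" and z: "z \<in> hom C B (N w)"
      and eq: "Comp C (\<nu> w) y = Comp C (\<nu> w) z"
    note c = n(1)[OF w] and wW = chainsD(1)[OF w]
    note D = chain_diagram_functor[OF w]
    note stw = presentable_stagewise[OF \<kappa>(1) lam(1) C B small_filtered_chain_index[OF \<kappa>(1) lam \<kappa>(2)] D c]
    obtain p y' where "p \<in> Obj (chain_index lam)" "y' \<in> hom C B (obj_map (chain_diagram C A a w) p)"
        "Comp C (leg w p) y' = y" using stagewise_factor[OF stw y] .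
    then have p: "p \<in> Field lam" "y' \<in> hom C B (A (w p))" "Comp C (leg w p) y' = y" by simp_all
    obtain q z' where "q \<in> Obj (chain_index lam)" "z' \<in> hom C B (obj_map (chain_diagram C A a w) q)"
        "Comp C (leg w q) z' = z" using stagewise_factor[OF stw z] .
    then have q: "q \<in> Field lam" "z' \<in> hom C B (A (w q))" "Comp C (leg w q) z' = z" by simp_all
    obtain r where r: "r \<in> Field lam" "(p, r) \<in> lam" "p \<noteq> r" "(q, r) \<in> lam" "q \<noteq> r"
      using strict_bound2[OF lam p(1) q(1)] .
    have shift: "\<exists>x'. x' \<in> hom C B (A (w r)) \<and> Comp C (leg w r) x' = Comp C (leg w i) x"
      if "i \<in> Field lam" "(i, r) \<in> lam \<and> i \<noteq> r" "x \<in> hom C B (A (w i))" for i x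
    proof -
      have l: "lt (w i) (w r)" using chainsD(2)[OF w] that(2) by blast
      note h = s(4)[OF wW[OF that(1)] wW[OF r(1)] l]
      have "Comp C (leg w r) (Comp C (a (w i) (w r)) x) = Comp C (leg w i) x"
        using comp_assoc[OF s(1) that(3) h n(6)[OF w r(1)]]
          chain_cocone_trans[OF w colimit_imp_cocone[OF c]] that(2) by metis
      then show ?thesis using comp_hom[OF s(1) that(3) h] by blast
    qed
    obtain y1 where y1: "y1 \<in> hom C B (A (w r))" "Comp C (leg w r) y1 = y"
      using shift[OF p(1) conjI[OF r(2,3)] p(2)] p(3) by auto
    obtain z1 where z1: "z1 \<in> hom C B (A (w r))" "Comp C (leg w r) z1 = z"
      using shift[OF q(1) conjI[OF r(4,5)] q(2)] q(3) by auto
    have "Comp C (\<alpha> (w r)) y1 = Comp C (\<alpha> (w r)) z1"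
      using eq comp_assoc[OF s(1) y1(1) n(6)[OF w r(1)] n(2)[OF w]] y1(2)
        comp_assoc[OF s(1) z1(1) n(6)[OF w r(1)] n(2)[OF w]] z1(2) n(3)[OF w r(1)] by simp
    then obtain v where v: "v \<in> W" "lt (w r) v" "Comp C (a (w r) v) y1 = Comp C (a (w r) v) z1"
      using system_stagewise_equalize[OF st wW[OF r(1)] y1(1) z1(1)] by metis
    have "|insert v (w ` Field lam)| \<le>o lam"
    proof -
      have "|Field lam| \<le>o lam"
        using card_of_Field_ordIso[of lam] lam(1) ordIso_imp_ordLeq by blast
      then have "|w ` Field lam| \<le>o lam" using card_of_image ordLeq_transitive by blast
      then have "|{v} \<union> w ` Field lam| \<le>o lam" by (rule Un_Cinfinite_bound[OF one _ lam(1)])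
      then show ?thesis by simp
    qed
    then obtain w' where w': "w' \<in> ?T" "\<And>z. z \<in> insert v (w ` Field lam) \<Longrightarrow> \<exists>p \<in> Field lam. lt z (w' p)"
      using chain_above[OF lam(1) dir, of "insert v (w ` Field lam)"] v(1) wW by blast
    have le: "chain_le lam lt w w'" using w'(2) unfolding chain_le_def by blast
    obtain b where b: "b \<in> Field lam" "lt v (w' b)" using w'(2)[of v] by blast
    note w'b = chainsD(1)[OF w'(1) b(1)] and wr = wW[OF r(1)]
    have l: "lt (w r) (w' b)" by (rule strictly_directed_trans[OF dir v(2) b(2) wr v(1) w'b])
    have "Comp C (m w w') x = Comp C (leg w' b) (Comp C (a v (w' b)) (Comp C (a (w r) v) x1))"
      if x1: "x1 \<in> hom C B (A (w r))" "Comp C (leg w r) x1 = x" for x x1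
    proof -
      note h1 = s(4)[OF wr v(1) v(2)] and h2 = s(4)[OF v(1) w'b b(2)] and h3 = s(4)[OF wr w'b l]
      have "Comp C (m w w') x = Comp C (Comp C (leg w' b) (a (w r) (w' b))) x1"
        using comp_assoc[OF s(1) x1(1) n(6)[OF w r(1)] n(4)[OF w w'(1) le]] x1(2)
          n(5)[OF w w'(1) le r(1) b(1) l] by simp
      also have "\<dots> = Comp C (leg w' b) (Comp C (a (w r) (w' b)) x1)"
        by (rule comp_assoc[OF s(1) x1(1) h3 n(6)[OF w'(1) b(1)], symmetric])
      also have "Comp C (a (w r) (w' b)) x1 = Comp C (a v (w' b)) (Comp C (a (w r) v) x1)"
        using s(6)[OF wr v(1) w'b v(2) b(2) l] comp_assoc[OF s(1) x1(1) h1 h2] by simp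
      finally show ?thesis .
    qed
    from this[OF y1] this[OF z1] have "Comp C (m w w') y = Comp C (m w w') z" using v(3) by simp
    then show "\<exists>j \<in> ?T. \<exists>u \<in> hom (thin ?T (chain_le lam lt)) w j.
        Comp C ((\<lambda>(v, w). m v w) u) y = Comp C ((\<lambda>(v, w). m v w) u) z"
      using w w'(1) le hom_thin[of "(w, w')"] by (intro bexI[of _ w'] bexI[of _ "(w, w')"]) auto
  }
qed

end

section \<open>Interleaving two systems over isomorphic objects\<close>

lemma strictly_directed_bound2:
  assumes lam: "Cinfinite lam" and dir: "strictly_directed lam W lt" and v: "v \<in> W" and w: "w \<in> W"
  obtains x where "x \<in> W" "lt v x" "lt w x"
  by (rule strictly_directed_bound[OF dir, of "{v, w}"]) (auto simp: v w intro: card_less_finite[OF lam] that)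

lemma strictly_directed_bound_family:
  assumes lam: "Cinfinite lam" and dir: "strictly_directed lam W lt"
    and S: "|S| <o lam" and f: "\<And>s. s \<in> S \<Longrightarrow> f s \<in> W" and w: "w \<in> W"
  obtains x where "x \<in> W" "lt w x" "\<And>s. s \<in> S \<Longrightarrow> lt (f s) x"
proof -
  have "|{w} \<union> f ` S| <o lam"
    by (rule card_less_Un[OF lam card_less_finite[OF lam] card_less_image[OF S]]) simp
  moreover have "{w} \<union> f ` S \<subseteq> W" using f w by auto
  ultimately obtain x where "x \<in> W" "\<And>z. z \<in> {w} \<union> f ` S \<Longrightarrow> lt z x"
    using strictly_directed_bound[OF dir] by metis
  then show thesis using that by auto
qed

text \<open>The interleaved system below is compared with the two given ones by its projections \<open>\<pi>\<close>, which are
  monotone and cofinal.\<close>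

lemma system_pullback:
  assumes sys: "system C V lt A a K \<alpha>" and \<pi>: "\<And>w. w \<in> W \<Longrightarrow> \<pi> w \<in> V"
    and mono: "\<And>v w. v \<in> W \<Longrightarrow> w \<in> W \<Longrightarrow> lt' v w \<Longrightarrow> lt (\<pi> v) (\<pi> w)"
  shows "system C W lt' (\<lambda>w. A (\<pi> w)) (\<lambda>v w. a (\<pi> v) (\<pi> w)) K (\<lambda>w. \<alpha> (\<pi> w))"
  unfolding system_def
  using systemD(1,2)[OF sys] systemD(3)[OF sys \<pi>] systemD(4)[OF sys \<pi> \<pi> mono]
    systemD(5)[OF sys \<pi> \<pi> mono] systemD(6)[OF sys \<pi> \<pi> \<pi> mono mono mono] by simp

lemma system_stagewise_pullback:
  assumes sys: "system C V lt A a K \<alpha>" and st: "system_stagewise C V lt A a K \<alpha> B"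
    and \<pi>: "\<And>w. w \<in> W \<Longrightarrow> \<pi> w \<in> V"
    and mono: "\<And>v w. v \<in> W \<Longrightarrow> w \<in> W \<Longrightarrow> lt' v w \<Longrightarrow> lt (\<pi> v) (\<pi> w)"
    and cof: "\<And>v. v \<in> V \<Longrightarrow> \<exists>w \<in> W. lt v (\<pi> w)"
      "\<And>w v. w \<in> W \<Longrightarrow> v \<in> V \<Longrightarrow> \<exists>w' \<in> W. lt' w w' \<and> lt v (\<pi> w')"
  shows "system_stagewise C W lt' (\<lambda>w. A (\<pi> w)) (\<lambda>v w. a (\<pi> v) (\<pi> w)) K (\<lambda>w. \<alpha> (\<pi> w)) B"
  unfolding system_stagewise_def
proof (intro conjI ballI impI)
  note s = systemD[OF sys]
  fix x assume x: "x \<in> hom C B K"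
  obtain v y where v: "v \<in> V" "y \<in> hom C B (A v)" "Comp C (\<alpha> v) y = x"
    using system_stagewise_factor[OF st x] .
  obtain w where w: "w \<in> W" "lt v (\<pi> w)" using cof(1)[OF v(1)] by blast
  note h = s(4)[OF v(1) \<pi>[OF w(1)] w(2)]
  have "Comp C (\<alpha> (\<pi> w)) (Comp C (a v (\<pi> w)) y) = x"
    using comp_assoc[OF s(1) v(2) h s(3)[OF \<pi>[OF w(1)]]] s(5)[OF v(1) \<pi>[OF w(1)] w(2)] v(3) by simp
  then show "\<exists>w \<in> W. \<exists>y \<in> hom C B (A (\<pi> w)). Comp C (\<alpha> (\<pi> w)) y = x"
    using w(1) comp_hom[OF s(1) v(2) h] by blast
next
  note s = systemD[OF sys]
  fix w y z assume w: "w \<in> W" and y: "y \<in> hom C B (A (\<pi> w))" and z: "z \<in> hom C B (A (\<pi> w))"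
    and eq: "Comp C (\<alpha> (\<pi> w)) y = Comp C (\<alpha> (\<pi> w)) z"
  obtain v where v: "v \<in> V" "lt (\<pi> w) v" "Comp C (a (\<pi> w) v) y = Comp C (a (\<pi> w) v) z"
    using system_stagewise_equalize[OF st \<pi>[OF w] y z eq] .
  obtain w' where w': "w' \<in> W" "lt' w w'" "lt v (\<pi> w')" using cof(2)[OF w v(1)] by blast
  note h1 = s(4)[OF \<pi>[OF w] v(1,2)] and h2 = s(4)[OF v(1) \<pi>[OF w'(1)] w'(3)]
  have "a (\<pi> w) (\<pi> w') = Comp C (a v (\<pi> w')) (a (\<pi> w) v)"
    using s(6)[OF \<pi>[OF w] v(1) \<pi>[OF w'(1)] v(2) w'(3) mono[OF w w'(1,2)]] by simp
  then have "Comp C (a (\<pi> w) (\<pi> w')) y = Comp C (a (\<pi> w) (\<pi> w')) z"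
    using comp_assoc[OF s(1) y h1 h2] comp_assoc[OF s(1) z h1 h2] v(3) by simp
  then show "\<exists>v \<in> W. lt' w v \<and> Comp C (a (\<pi> w) (\<pi> v)) y = Comp C (a (\<pi> w) (\<pi> v)) z"
    using w'(1,2) by blast
qed

definition interleavings ::
  "('o, 'a) cat \<Rightarrow> 'v set \<Rightarrow> ('v \<Rightarrow> 'o) \<Rightarrow> ('v \<Rightarrow> 'a) \<Rightarrow> 'w set \<Rightarrow> ('w \<Rightarrow> 'o) \<Rightarrow> ('w \<Rightarrow> 'a) \<Rightarrow> 'a \<Rightarrow>
   ('v \<times> 'w \<times> 'a) set"
where
  "interleavings M V A \<alpha> W B \<beta> h =
     {(v, w, \<phi>). v \<in> V \<and> w \<in> W \<and> \<phi> \<in> hom M (A v) (B w) \<and> Comp M (\<beta> w) \<phi> = Comp M h (\<alpha> v)}"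

text \<open>Between two comparable stages there is an arrow back, which splits the transitions of both
  systems. It is not part of the data: its existence is what makes the chains of interleavings have
  isomorphic colimits.\<close>

definition interleaved_lt ::
  "('o, 'a) cat \<Rightarrow> ('v \<Rightarrow> 'v \<Rightarrow> bool) \<Rightarrow> ('v \<Rightarrow> 'o) \<Rightarrow> ('v \<Rightarrow> 'v \<Rightarrow> 'a) \<Rightarrow>
   ('w \<Rightarrow> 'w \<Rightarrow> bool) \<Rightarrow> ('w \<Rightarrow> 'o) \<Rightarrow> ('w \<Rightarrow> 'w \<Rightarrow> 'a) \<Rightarrow> 'v \<times> 'w \<times> 'a \<Rightarrow> 'v \<times> 'w \<times> 'a \<Rightarrow> bool"
where
  "interleaved_lt M ltV A a ltW B b = (\<lambda>(v, w, \<phi>) (v', w', \<phi>'). ltV v v' \<and> ltW w w' \<and>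
     (\<exists>\<psi> \<in> hom M (B w) (A v'). Comp M \<psi> \<phi> = a v v' \<and> Comp M \<phi>' \<psi> = b w w'))"

text \<open>If both systems consist of objects that see both colimits stage by stage, then a comparison
  \<open>A v \<rightarrow> B w\<close> over \<open>h\<close> can be answered by a comparison back, and that one again forward, and for
  fewer than \<open>lam\<close> given comparisons the answers can be taken at one common stage.\<close>

lemma interleavings_bound:
  fixes M :: "('o, 'a) cat" and V :: "'v set" and W :: "'w set"
  assumes lam: "Cinfinite lam"
    and dV: "strictly_directed lam V ltV" and dW: "strictly_directed lam W ltW"
    and sA: "system M V ltV A a K \<alpha>" and sB: "system M W ltW B b L \<beta>"
    and h: "mutually_inverse M K L h k"
    and stA: "\<And>v. v \<in> V \<Longrightarrow> system_stagewise M V ltV A a K \<alpha> (A v)"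
      "\<And>v. v \<in> V \<Longrightarrow> system_stagewise M W ltW B b L \<beta> (A v)"
    and stB: "\<And>w. w \<in> W \<Longrightarrow> system_stagewise M V ltV A a K \<alpha> (B w)"
      "\<And>w. w \<in> W \<Longrightarrow> system_stagewise M W ltW B b L \<beta> (B w)"
    and S: "S \<subseteq> interleavings M V A \<alpha> W B \<beta> h" "|S| <o lam" and v1: "v1 \<in> V" and w1: "w1 \<in> W"
  shows "\<exists>v w \<phi>. (v, w, \<phi>) \<in> interleavings M V A \<alpha> W B \<beta> h \<and> ltV v1 v \<and> ltW w1 w \<and>
    (\<forall>s \<in> S. interleaved_lt M ltV A a ltW B b s (v, w, \<phi>))"
proof -
  note cM = systemD(1)[OF sA]
  note \<alpha> = systemD(3)[OF sA] and a = systemD(4)[OF sA] and \<alpha>a = systemD(5)[OF sA]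
  note \<beta> = systemD(3)[OF sB] and b = systemD(4)[OF sB] and \<beta>b = systemD(5)[OF sB]
  note hh = mutually_inverseD(1)[OF h] and kh = mutually_inverseD(2)[OF h]
  define i where "i s = fst s" for s :: "'v \<times> 'w \<times> 'a"
  define j where "j s = fst (snd s)" for s :: "'v \<times> 'w \<times> 'a"
  define \<phi> where "\<phi> s = snd (snd s)" for s :: "'v \<times> 'w \<times> 'a"
  have s_eq: "s = (i s, j s, \<phi> s)" for s by (simp add: i_def j_def \<phi>_def)
  have iV: "i s \<in> V" and jW: "j s \<in> W" and \<phi>h: "\<phi> s \<in> hom M (A (i s)) (B (j s))"
    and \<phi>o: "Comp M (\<beta> (j s)) (\<phi> s) = Comp M h (\<alpha> (i s))" if "s \<in> S" for s
  proof -
    have "(i s, j s, \<phi> s) \<in> interleavings M V A \<alpha> W B \<beta> h" using S(1) that s_eq[of s] by auto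
    then show "i s \<in> V" "j s \<in> W" "\<phi> s \<in> hom M (A (i s)) (B (j s))"
      "Comp M (\<beta> (j s)) (\<phi> s) = Comp M h (\<alpha> (i s))" by (simp_all add: interleavings_def)
  qed
  have aa: "Comp M (a v w) (a u v) = a u w"
    if "u \<in> V" "v \<in> V" "w \<in> V" "ltV u v" "ltV v w" for u v w
    by (rule systemD(6)[OF sA that strictly_directed_trans[OF dV that(4,5,1,2,3)]])
  have bb: "Comp M (b v w) (b u v) = b u w"
    if "u \<in> W" "v \<in> W" "w \<in> W" "ltW u v" "ltW v w" for u v w
    by (rule systemD(6)[OF sB that strictly_directed_trans[OF dW that(4,5,1,2,3)]])
  have trV: "ltV u w" if "ltV u v" "ltV v w" "u \<in> V" "v \<in> V" "w \<in> V" for u v w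
    by (rule strictly_directed_trans[OF dV that])
  have trW: "ltW u w" if "ltW u v" "ltW v w" "u \<in> W" "v \<in> W" "w \<in> W" for u v w
    by (rule strictly_directed_trans[OF dW that])
  \<comment> \<open>Answer each given comparison separately, then move all answers to one stage \<open>v\<close>.\<close>
  have "\<exists>n \<psi>. n \<in> V \<and> ltV (i s) n \<and> \<psi> \<in> hom M (B (j s)) (A n) \<and>
      Comp M (\<alpha> n) \<psi> = Comp M k (\<beta> (j s)) \<and> Comp M \<psi> (\<phi> s) = a (i s) n" if s: "s \<in> S" for s
  proof -
    note i_V = iV[OF s] and js = jW[OF s] and \<phi>s = \<phi>h[OF s]
    obtain l y where l: "l \<in> V" "y \<in> hom M (B (j s)) (A l)" "Comp M (\<alpha> l) y = Comp M k (\<beta> (j s))"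
      using system_stagewise_factor[OF stB(1)[OF js] comp_hom[OF cM \<beta>[OF js] kh]] .
    obtain m where m: "m \<in> V" "ltV l m" "ltV (i s) m" using strictly_directed_bound2[OF lam dV l(1) i_V] .
    let ?y = "Comp M (a l m) y"
    note alm = a[OF l(1) m(1,2)] and aim = a[OF i_V m(1,3)]
    have y: "?y \<in> hom M (B (j s)) (A m)" by (rule comp_hom[OF cM l(2) alm])
    have \<alpha>y: "Comp M (\<alpha> m) ?y = Comp M k (\<beta> (j s))"
      using comp_assoc[OF cM l(2) alm \<alpha>[OF m(1)]] \<alpha>a[OF l(1) m(1,2)] l(3) by simp
    have "Comp M (\<alpha> m) (Comp M ?y (\<phi> s)) = Comp M (Comp M k (\<beta> (j s))) (\<phi> s)"
      using comp_assoc[OF cM \<phi>s y \<alpha>[OF m(1)]] \<alpha>y by simp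
    also have "\<dots> = Comp M k (Comp M h (\<alpha> (i s)))"
      using comp_assoc[OF cM \<phi>s \<beta>[OF js] kh] \<phi>o[OF s] by simp
    also have "\<dots> = \<alpha> (i s)" by (rule inverse_cancel_left[OF cM h \<alpha>[OF i_V]])
    also have "\<dots> = Comp M (\<alpha> m) (a (i s) m)" by (rule \<alpha>a[OF i_V m(1,3), symmetric])
    finally obtain n where n: "n \<in> V" "ltV m n"
      "Comp M (a m n) (Comp M ?y (\<phi> s)) = Comp M (a m n) (a (i s) m)"
      using system_stagewise_equalize[OF stA(1)[OF i_V] m(1) comp_hom[OF cM \<phi>s y] aim] by blast
    note amn = a[OF m(1) n(1,2)]
    show ?thesis
    proof (intro exI conjI)
      show "n \<in> V" by (rule n(1))
      show "ltV (i s) n" by (rule trV[OF m(3) n(2) i_V m(1) n(1)])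
      show "Comp M (a m n) ?y \<in> hom M (B (j s)) (A n)" by (rule comp_hom[OF cM y amn])
      show "Comp M (\<alpha> n) (Comp M (a m n) ?y) = Comp M k (\<beta> (j s))"
        using comp_assoc[OF cM y amn \<alpha>[OF n(1)]] \<alpha>a[OF m(1) n(1,2)] \<alpha>y by simp
      show "Comp M (Comp M (a m n) ?y) (\<phi> s) = a (i s) n"
        using comp_assoc[OF cM \<phi>s y amn] n(3) aa[OF i_V m(1) n(1) m(3) n(2)] by simp
    qed
  qed
  then obtain n \<psi>1 where n: "\<And>s. s \<in> S \<Longrightarrow> n s \<in> V" "\<And>s. s \<in> S \<Longrightarrow> ltV (i s) (n s)"
    and \<psi>1: "\<And>s. s \<in> S \<Longrightarrow> \<psi>1 s \<in> hom M (B (j s)) (A (n s))"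
      "\<And>s. s \<in> S \<Longrightarrow> Comp M (\<alpha> (n s)) (\<psi>1 s) = Comp M k (\<beta> (j s))"
      "\<And>s. s \<in> S \<Longrightarrow> Comp M (\<psi>1 s) (\<phi> s) = a (i s) (n s)" by metis
  obtain v where v: "v \<in> V" "ltV v1 v" "\<And>s. s \<in> S \<Longrightarrow> ltV (n s) v"
    using strictly_directed_bound_family[OF lam dV S(2), of n] n(1) v1 by blast
  define \<psi> where "\<psi> s = Comp M (a (n s) v) (\<psi>1 s)" for s
  note anv = a[OF n(1) v(1) v(3)]
  have \<psi>: "\<psi> s \<in> hom M (B (j s)) (A v)" if "s \<in> S" for s
    unfolding \<psi>_def by (rule comp_hom[OF cM \<psi>1(1)[OF that] anv[OF that that]])
  have \<psi>_over: "Comp M (\<alpha> v) (\<psi> s) = Comp M k (\<beta> (j s))" if s: "s \<in> S" for s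
    unfolding \<psi>_def
    using comp_assoc[OF cM \<psi>1(1)[OF s] anv[OF s s] \<alpha>[OF v(1)]] \<alpha>a[OF n(1)[OF s] v(1) v(3)[OF s]]
      \<psi>1(2)[OF s] by simp
  have \<psi>\<phi>: "Comp M (\<psi> s) (\<phi> s) = a (i s) v" if s: "s \<in> S" for s
    unfolding \<psi>_def
    using comp_assoc[OF cM \<phi>h[OF s] \<psi>1(1)[OF s] anv[OF s s]] \<psi>1(3)[OF s]
      aa[OF iV[OF s] n(1)[OF s] v(1) n(2)[OF s] v(3)[OF s]] by simp
  have iv: "ltV (i s) v" if s: "s \<in> S" for s
    by (rule trV[OF n(2)[OF s] v(3)[OF s] iV[OF s] n(1)[OF s] v(1)])
  \<comment> \<open>Compare stage \<open>v\<close> with the second system, and go on until all the composites are transitions.\<close>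
  obtain l \<phi>0 where l: "l \<in> W" "\<phi>0 \<in> hom M (A v) (B l)" "Comp M (\<beta> l) \<phi>0 = Comp M h (\<alpha> v)"
    using system_stagewise_factor[OF stA(2)[OF v(1)] comp_hom[OF cM \<alpha>[OF v(1)] hh]] .
  have "\<exists>r. r \<in> W \<and> ltW l r \<and> ltW (j s) r \<and> Comp M (b l r) (Comp M \<phi>0 (\<psi> s)) = b (j s) r"
    if s: "s \<in> S" for s
  proof -
    note js = jW[OF s] and \<psi>s = \<psi>[OF s]
    obtain m where m: "m \<in> W" "ltW l m" "ltW (j s) m" using strictly_directed_bound2[OF lam dW l(1) js] .
    note blm = b[OF l(1) m(1,2)] and bjm = b[OF js m(1,3)]
    note y = comp_hom[OF cM \<psi>s l(2)]
    have "Comp M (\<beta> m) (Comp M (b l m) (Comp M \<phi>0 (\<psi> s))) = Comp M (\<beta> l) (Comp M \<phi>0 (\<psi> s))"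
      using comp_assoc[OF cM y blm \<beta>[OF m(1)]] \<beta>b[OF l(1) m(1,2)] by simp
    also have "\<dots> = Comp M (Comp M h (\<alpha> v)) (\<psi> s)"
      using comp_assoc[OF cM \<psi>s l(2) \<beta>[OF l(1)]] l(3) by simp
    also have "\<dots> = Comp M h (Comp M k (\<beta> (j s)))"
      using comp_assoc[OF cM \<psi>s \<alpha>[OF v(1)] hh] \<psi>_over[OF s] by simp
    also have "\<dots> = \<beta> (j s)" by (rule inverse_cancel_left[OF cM mutually_inverse_sym[OF h] \<beta>[OF js]])
    also have "\<dots> = Comp M (\<beta> m) (b (j s) m)" by (rule \<beta>b[OF js m(1,3), symmetric])
    finally obtain r where r: "r \<in> W" "ltW m r"
      "Comp M (b m r) (Comp M (b l m) (Comp M \<phi>0 (\<psi> s))) = Comp M (b m r) (b (j s) m)"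
      using system_stagewise_equalize[OF stB(2)[OF js] m(1) comp_hom[OF cM y blm] bjm] by blast
    have "Comp M (b l r) (Comp M \<phi>0 (\<psi> s)) = b (j s) r"
      using comp_assoc[OF cM y blm b[OF m(1) r(1,2)]] r(3) bb[OF l(1) m(1) r(1) m(2) r(2)]
        bb[OF js m(1) r(1) m(3) r(2)] by simp
    then show ?thesis
      using r(1) trW[OF m(2) r(2) l(1) m(1) r(1)] trW[OF m(3) r(2) js m(1) r(1)] by blast
  qed
  then obtain r where r: "\<And>s. s \<in> S \<Longrightarrow> r s \<in> W" "\<And>s. s \<in> S \<Longrightarrow> ltW l (r s)"
    "\<And>s. s \<in> S \<Longrightarrow> ltW (j s) (r s)"
    "\<And>s. s \<in> S \<Longrightarrow> Comp M (b l (r s)) (Comp M \<phi>0 (\<psi> s)) = b (j s) (r s)" by metis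
  obtain w2 where w2: "w2 \<in> W" "ltW l w2" "ltW w1 w2" using strictly_directed_bound2[OF lam dW l(1) w1] .
  obtain w where w: "w \<in> W" "ltW w2 w" "\<And>s. s \<in> S \<Longrightarrow> ltW (r s) w"
    using strictly_directed_bound_family[OF lam dW S(2), of r] r(1) w2(1) by blast
  have lw: "ltW l w" by (rule trW[OF w2(2) w(2) l(1) w2(1) w(1)])
  note blw = b[OF l(1) w(1) lw]
  let ?\<phi> = "Comp M (b l w) \<phi>0"
  have "Comp M (\<beta> w) ?\<phi> = Comp M h (\<alpha> v)"
    using comp_assoc[OF cM l(2) blw \<beta>[OF w(1)]] \<beta>b[OF l(1) w(1) lw] l(3) by simp
  then have "(v, w, ?\<phi>) \<in> interleavings M V A \<alpha> W B \<beta> h"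
    using v(1) w(1) comp_hom[OF cM l(2) blw] by (simp add: interleavings_def)
  moreover have "interleaved_lt M ltV A a ltW B b s (v, w, ?\<phi>)" if s: "s \<in> S" for s
  proof -
    have jw: "ltW (j s) w" by (rule trW[OF r(3)[OF s] w(3)[OF s] jW[OF s] r(1)[OF s] w(1)])
    note y = comp_hom[OF cM \<psi>[OF s] l(2)]
    have "Comp M ?\<phi> (\<psi> s) = Comp M (b l w) (Comp M \<phi>0 (\<psi> s))"
      by (rule comp_assoc[OF cM \<psi>[OF s] l(2) blw, symmetric])
    also have "\<dots> = Comp M (b (r s) w) (Comp M (b l (r s)) (Comp M \<phi>0 (\<psi> s)))"
      using comp_assoc[OF cM y b[OF l(1) r(1)[OF s] r(2)[OF s]] b[OF r(1)[OF s] w(1) w(3)[OF s]]]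
        bb[OF l(1) r(1)[OF s] w(1) r(2)[OF s] w(3)[OF s]] by simp
    also have "\<dots> = b (j s) w"
      using r(4)[OF s] bb[OF jW[OF s] r(1)[OF s] w(1) r(3)[OF s] w(3)[OF s]] by simp
    finally have "Comp M ?\<phi> (\<psi> s) = b (j s) w" .
    then have "interleaved_lt M ltV A a ltW B b (i s, j s, \<phi> s) (v, w, ?\<phi>)"
      unfolding interleaved_lt_def using iv[OF s] jw \<psi>[OF s] \<psi>\<phi>[OF s] by auto
    then show ?thesis using s_eq[of s] by simp
  qed
  moreover have "ltW w1 w" by (rule trW[OF w2(3) w(2) w1 w2(1) w(1)])
  ultimately show ?thesis using v(2) by blast
qed

lemma interleaved_lt_trans:
  assumes dV: "strictly_directed lam V ltV" and dW: "strictly_directed lam W ltW"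
    and sA: "system M V ltV A a K \<alpha>" and sB: "system M W ltW B b L \<beta>"
    and x: "x \<in> interleavings M V A \<alpha> W B \<beta> h" and y: "y \<in> interleavings M V A \<alpha> W B \<beta> h"
    and z: "z \<in> interleavings M V A \<alpha> W B \<beta> h"
    and xy: "interleaved_lt M ltV A a ltW B b x y" and yz: "interleaved_lt M ltV A a ltW B b y z"
  shows "interleaved_lt M ltV A a ltW B b x z"
proof -
  note cM = systemD(1)[OF sA] and a = systemD(4)[OF sA] and b = systemD(4)[OF sB]
  obtain v1 w1 \<phi>1 where [simp]: "x = (v1, w1, \<phi>1)" by (cases x)
  obtain v2 w2 \<phi>2 where [simp]: "y = (v2, w2, \<phi>2)" by (cases y)
  obtain v3 w3 \<phi>3 where [simp]: "z = (v3, w3, \<phi>3)" by (cases z)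
  have V: "v1 \<in> V" "v2 \<in> V" "v3 \<in> V" and W: "w1 \<in> W" "w2 \<in> W" "w3 \<in> W"
    and \<phi>: "\<phi>1 \<in> hom M (A v1) (B w1)" "\<phi>2 \<in> hom M (A v2) (B w2)" "\<phi>3 \<in> hom M (A v3) (B w3)"
    using x y z by (simp_all add: interleavings_def)
  have l: "ltV v1 v2" "ltV v2 v3" "ltW w1 w2" "ltW w2 w3"
    using xy yz by (simp_all add: interleaved_lt_def)
  obtain \<psi>1 where \<psi>1: "\<psi>1 \<in> hom M (B w1) (A v2)" "Comp M \<psi>1 \<phi>1 = a v1 v2" "Comp M \<phi>2 \<psi>1 = b w1 w2"
    using xy by (auto simp: interleaved_lt_def)
  obtain \<psi>2 where \<psi>2: "\<psi>2 \<in> hom M (B w2) (A v3)" "Comp M \<psi>2 \<phi>2 = a v2 v3" "Comp M \<phi>3 \<psi>2 = b w2 w3"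
    using yz by (auto simp: interleaved_lt_def)
  have lV: "ltV v1 v3" by (rule strictly_directed_trans[OF dV l(1,2) V])
  have lW: "ltW w1 w3" by (rule strictly_directed_trans[OF dW l(3,4) W])
  have a23: "a v2 v3 \<in> hom M (A v2) (A v3)" by (rule a[OF V(2,3) l(2)])
  let ?\<psi> = "Comp M (a v2 v3) \<psi>1"
  have "Comp M ?\<psi> \<phi>1 = a v1 v3"
    using comp_assoc[OF cM \<phi>(1) \<psi>1(1) a23] \<psi>1(2) systemD(6)[OF sA V l(1,2) lV] by simp
  moreover have "Comp M \<phi>3 ?\<psi> = b w1 w3"
  proof -
    have "Comp M \<phi>3 ?\<psi> = Comp M (Comp M \<phi>3 (Comp M \<psi>2 \<phi>2)) \<psi>1"
      using comp_assoc[OF cM \<psi>1(1) a23 \<phi>(3)] \<psi>2(2) by simp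
    also have "Comp M \<phi>3 (Comp M \<psi>2 \<phi>2) = Comp M (b w2 w3) \<phi>2"
      using comp_assoc[OF cM \<phi>(2) \<psi>2(1) \<phi>(3)] \<psi>2(3) by simp
    also have "Comp M (Comp M (b w2 w3) \<phi>2) \<psi>1 = Comp M (b w2 w3) (b w1 w2)"
      using comp_assoc[OF cM \<psi>1(1) \<phi>(2) b[OF W(2,3) l(4)]] \<psi>1(3) by simp
    also have "\<dots> = b w1 w3" by (rule systemD(6)[OF sB W l(3,4) lW])
    finally show ?thesis .
  qed
  ultimately show ?thesis
    using lV lW comp_hom[OF cM \<psi>1(1) a23] by (auto simp: interleaved_lt_def)
qed

lemma small_interleavings:
  assumes \<kappa>: "inaccessible \<kappa>" and M: "class_category \<kappa> M" and V: "small \<kappa> V" and W: "small \<kappa> W"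
    and sA: "system M V ltV A a K \<alpha>" and sB: "system M W ltW B b L \<beta>"
  shows "small \<kappa> (interleavings M V A \<alpha> W B \<beta> h)"
proof (rule small_subset)
  show "interleavings M V A \<alpha> W B \<beta> h \<subseteq> (SIGMA v:V. SIGMA w:W. hom M (A v) (B w))"
    by (auto simp: interleavings_def)
  note cM = systemD(1)[OF sA]
  have "small \<kappa> (hom M (A v) (B w))" if "v \<in> V" "w \<in> W" for v w
    using M hom_objD(1)[OF cM systemD(3)[OF sA that(1)]] hom_objD(1)[OF cM systemD(3)[OF sB that(2)]]
    unfolding class_category_def by blast
  then show "small \<kappa> (SIGMA v:V. SIGMA w:W. hom M (A v) (B w))"
    by (intro small_Sigma[OF \<kappa>] V W)
qed

section \<open>The pseudopullback in terms of comparison isomorphisms\<close>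

definition obj_K :: "('k, 'l, 'm, 'mm) pspb_obj \<Rightarrow> 'k" where "obj_K X = fst X"
definition obj_L :: "('k, 'l, 'm, 'mm) pspb_obj \<Rightarrow> 'l" where "obj_L X = fst (snd X)"
definition obj_M :: "('k, 'l, 'm, 'mm) pspb_obj \<Rightarrow> 'm" where "obj_M X = fst (snd (snd X))"
definition iso_F :: "('k, 'l, 'm, 'mm) pspb_obj \<Rightarrow> 'mm" where "iso_F X = fst (snd (snd (snd X)))"
definition iso_G :: "('k, 'l, 'm, 'mm) pspb_obj \<Rightarrow> 'mm" where "iso_G X = snd (snd (snd (snd X)))"
definition arr_K :: "('k, 'kk, 'l, 'll, 'm, 'mm) pspb_arr \<Rightarrow> 'kk" where "arr_K t = fst (fst (snd t))"
definition arr_L :: "('k, 'kk, 'l, 'll, 'm, 'mm) pspb_arr \<Rightarrow> 'll" where "arr_L t = fst (snd (fst (snd t)))"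
definition arr_M :: "('k, 'kk, 'l, 'll, 'm, 'mm) pspb_arr \<Rightarrow> 'mm" where "arr_M t = snd (snd (fst (snd t)))"

lemmas pspb_parts_defs = obj_K_def obj_L_def obj_M_def iso_F_def iso_G_def arr_K_def arr_L_def arr_M_def

lemma pspb_parts [simp]:
  "obj_K (K, L, M, f, g) = K" "obj_L (K, L, M, f, g) = L" "obj_M (K, L, M, f, g) = M"
  "iso_F (K, L, M, f, g) = f" "iso_G (K, L, M, f, g) = g"
  "arr_K (X, (a, b, c), Y) = a" "arr_L (X, (a, b, c), Y) = b" "arr_M (X, (a, b, c), Y) = c"
  by (simp_all add: pspb_parts_defs)

lemma bar_simps [simp]:
  "obj_map G_bar X = obj_K X" "arr_map G_bar t = arr_K t"
  "obj_map F_bar X = obj_L X" "arr_map F_bar t = arr_L t"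
  by (simp_all add: G_bar_def F_bar_def pspb_parts_defs split_beta)

context
  fixes \<K> :: "('k, 'kk) cat" and \<L> :: "('l, 'll) cat" and \<M> :: "('m, 'mm) cat"
    and F :: "('k, 'kk, 'm, 'mm) fctr" and G :: "('l, 'll, 'm, 'mm) fctr"
  assumes F: "is_functor \<K> \<M> F" and G: "is_functor \<L> \<M> G"
begin

private abbreviation (input) P :: "(('k, 'l, 'm, 'mm) pspb_obj, ('k, 'kk, 'l, 'll, 'm, 'mm) pspb_arr) cat" where
  "P \<equiv> PsPb \<K> \<L> \<M> F G"

lemma pspb_obj_iff:
  "X \<in> Obj P \<longleftrightarrow> obj_K X \<in> Obj \<K> \<and> obj_L X \<in> Obj \<L> \<and> obj_M X \<in> Obj \<M> \<and>
     is_iso \<M> (obj_map F (obj_K X)) (obj_M X) (iso_F X) \<and>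
     is_iso \<M> (obj_map G (obj_L X)) (obj_M X) (iso_G X)"
  by (cases X) (simp add: PsPb_def pspb_objects_def)

lemma pspb_hom_iff:
  "t \<in> hom P X Y \<longleftrightarrow> X \<in> Obj P \<and> Y \<in> Obj P \<and> fst t = X \<and> snd (snd t) = Y \<and>
     arr_K t \<in> hom \<K> (obj_K X) (obj_K Y) \<and> arr_L t \<in> hom \<L> (obj_L X) (obj_L Y) \<and>
     arr_M t \<in> hom \<M> (obj_M X) (obj_M Y) \<and>
     Comp \<M> (arr_M t) (iso_F X) = Comp \<M> (iso_F Y) (arr_map F (arr_K t)) \<and>
     Comp \<M> (arr_M t) (iso_G X) = Comp \<M> (iso_G Y) (arr_map G (arr_L t))"
proof -
  obtain X' a b c Y' where t: "t = (X', (a, b, c), Y')" by (cases t) auto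
  have o: "Obj P = pspb_objects \<K> \<L> \<M> F G" by (simp add: PsPb_def)
  show ?thesis
    unfolding t o by (cases X; cases Y; cases X'; cases Y') (auto simp: hom_def PsPb_def)
qed

lemma pspb_arr_eqI:
  "fst s = fst t \<Longrightarrow> arr_K s = arr_K t \<Longrightarrow> arr_L s = arr_L t \<Longrightarrow> arr_M s = arr_M t \<Longrightarrow>
    snd (snd s) = snd (snd t) \<Longrightarrow> s = t"
  by (simp add: prod_eq_iff pspb_parts_defs)

lemma pspb_comp [simp]:
  "fst (Comp P s t) = fst t" "snd (snd (Comp P s t)) = snd (snd s)"
  "arr_K (Comp P s t) = Comp \<K> (arr_K s) (arr_K t)"
  "arr_L (Comp P s t) = Comp \<L> (arr_L s) (arr_L t)"
  "arr_M (Comp P s t) = Comp \<M> (arr_M s) (arr_M t)"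
  by (simp_all add: PsPb_def split_beta pspb_parts_defs)

lemma pspb_ident [simp]:
  "fst (Ident P X) = X" "snd (snd (Ident P X)) = X"
  "arr_K (Ident P X) = Ident \<K> (obj_K X)"
  "arr_L (Ident P X) = Ident \<L> (obj_L X)"
  "arr_M (Ident P X) = Ident \<M> (obj_M X)"
  by (simp_all add: PsPb_def split_beta pspb_parts_defs)

lemma pspb_category: "category P"
  unfolding category_def
proof (intro conjI ballI allI impI)
  note cK = functorD(1)[OF F] and cL = functorD(1)[OF G] and cM = functorD(2)[OF F]
  note F' = functorD(4,5,6)[OF F] and G' = functorD(4,5,6)[OF G]
  {
    fix t assume "t \<in> Arr P"
    then have "t \<in> hom P (Dom P t) (Cod P t)" by (rule arr_in_hom)
    then show "Dom P t \<in> Obj P" "Cod P t \<in> Obj P" unfolding pspb_hom_iff by blast+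
  next
    fix X assume X: "X \<in> Obj P"
    have f: "iso_F X \<in> hom \<M> (obj_map F (obj_K X)) (obj_M X)"
      and g: "iso_G X \<in> hom \<M> (obj_map G (obj_L X)) (obj_M X)"
      and o: "obj_K X \<in> Obj \<K>" "obj_L X \<in> Obj \<L>" "obj_M X \<in> Obj \<M>"
      using X unfolding pspb_obj_iff is_iso_def by blast+
    show "Ident P X \<in> hom P X X"
      unfolding pspb_hom_iff
      using X ident_hom[OF cK o(1)] ident_hom[OF cL o(2)] ident_hom[OF cM o(3)] F'(2)[OF o(1)]
        G'(2)[OF o(2)] ident_left[OF cM f] ident_left[OF cM g] ident_right[OF cM f]
        ident_right[OF cM g] by simp
  next
    fix X Y Z t s assume t: "t \<in> hom P X Y" and s: "s \<in> hom P Y Z"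
    note t' = t[unfolded pspb_hom_iff] and s' = s[unfolded pspb_hom_iff]
    have iso: "iso_F U \<in> hom \<M> (obj_map F (obj_K U)) (obj_M U)"
      "iso_G U \<in> hom \<M> (obj_map G (obj_L U)) (obj_M U)" if "U \<in> Obj P" for U
      using that unfolding pspb_obj_iff is_iso_def by blast+
    have tK: "arr_K t \<in> hom \<K> (obj_K X) (obj_K Y)" and sK: "arr_K s \<in> hom \<K> (obj_K Y) (obj_K Z)"
      and tL: "arr_L t \<in> hom \<L> (obj_L X) (obj_L Y)" and sL: "arr_L s \<in> hom \<L> (obj_L Y) (obj_L Z)"
      and tM: "arr_M t \<in> hom \<M> (obj_M X) (obj_M Y)" and sM: "arr_M s \<in> hom \<M> (obj_M Y) (obj_M Z)"
      and X: "X \<in> Obj P" and Y: "Y \<in> Obj P" and Z: "Z \<in> Obj P"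
      using t' s' by blast+
    have "Comp \<M> (Comp \<M> (arr_M s) (arr_M t)) (iso_F X) =
        Comp \<M> (iso_F Z) (arr_map F (Comp \<K> (arr_K s) (arr_K t)))"
      using comp_assoc[OF cM iso(1)[OF X] tM sM] t' s'
        comp_assoc[OF cM F'(1)[OF tK] iso(1)[OF Y] sM]
        comp_assoc[OF cM F'(1)[OF tK] F'(1)[OF sK] iso(1)[OF Z]] F'(3)[OF tK sK] by simp
    moreover have "Comp \<M> (Comp \<M> (arr_M s) (arr_M t)) (iso_G X) =
        Comp \<M> (iso_G Z) (arr_map G (Comp \<L> (arr_L s) (arr_L t)))"
      using comp_assoc[OF cM iso(2)[OF X] tM sM] t' s'
        comp_assoc[OF cM G'(1)[OF tL] iso(2)[OF Y] sM]
        comp_assoc[OF cM G'(1)[OF tL] G'(1)[OF sL] iso(2)[OF Z]] G'(3)[OF tL sL] by simp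
    ultimately show "Comp P s t \<in> hom P X Z"
      unfolding pspb_hom_iff pspb_comp
      using t' s' comp_hom[OF cK tK sK] comp_hom[OF cL tL sL] comp_hom[OF cM tM sM] by simp
  next
    fix X Y t assume t: "t \<in> hom P X Y"
    have tK: "arr_K t \<in> hom \<K> (obj_K X) (obj_K Y)" and tL: "arr_L t \<in> hom \<L> (obj_L X) (obj_L Y)"
      and tM: "arr_M t \<in> hom \<M> (obj_M X) (obj_M Y)" and t': "fst t = X" "snd (snd t) = Y"
      using t by (simp_all add: pspb_hom_iff)
    show "Comp P t (Ident P X) = t"
      by (rule pspb_arr_eqI) (simp_all add: t' ident_right[OF cK tK] ident_right[OF cL tL] ident_right[OF cM tM])
    show "Comp P (Ident P Y) t = t"
      by (rule pspb_arr_eqI) (simp_all add: t' ident_left[OF cK tK] ident_left[OF cL tL] ident_left[OF cM tM])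
  next
    fix W X Y Z r s t assume r: "r \<in> hom P W X" and s: "s \<in> hom P X Y" and t: "t \<in> hom P Y Z"
    have rK: "arr_K r \<in> hom \<K> (obj_K W) (obj_K X)" and sK: "arr_K s \<in> hom \<K> (obj_K X) (obj_K Y)"
      and tK: "arr_K t \<in> hom \<K> (obj_K Y) (obj_K Z)"
      and rL: "arr_L r \<in> hom \<L> (obj_L W) (obj_L X)" and sL: "arr_L s \<in> hom \<L> (obj_L X) (obj_L Y)"
      and tL: "arr_L t \<in> hom \<L> (obj_L Y) (obj_L Z)"
      and rM: "arr_M r \<in> hom \<M> (obj_M W) (obj_M X)" and sM: "arr_M s \<in> hom \<M> (obj_M X) (obj_M Y)"
      and tM: "arr_M t \<in> hom \<M> (obj_M Y) (obj_M Z)"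
      using r s t by (simp_all add: pspb_hom_iff)
    note comp_assoc[OF cK rK sK tK]
    moreover note comp_assoc[OF cL rL sL tL]
    moreover note comp_assoc[OF cM rM sM tM]
    ultimately show "Comp P t (Comp P s r) = Comp P (Comp P t s) r"
      by (intro pspb_arr_eqI) simp_all
  }
qed

lemma pspb_homD:
  assumes "t \<in> hom P X Y"
  shows "X \<in> Obj P" "Y \<in> Obj P" "arr_K t \<in> hom \<K> (obj_K X) (obj_K Y)"
    "arr_L t \<in> hom \<L> (obj_L X) (obj_L Y)"
  using assms unfolding pspb_hom_iff by blast+

lemma pspb_objD:
  assumes "X \<in> Obj P"
  shows "obj_K X \<in> Obj \<K>" "obj_L X \<in> Obj \<L>"
  using assms unfolding pspb_obj_iff by blast+

lemma G_bar_functor: "is_functor P \<K> G_bar"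
  unfolding is_functor_def using pspb_category functorD(1)[OF F] pspb_homD(3) pspb_objD by simp

lemma F_bar_functor: "is_functor P \<L> F_bar"
  unfolding is_functor_def using pspb_category functorD(1)[OF G] pspb_homD(4) pspb_objD by simp

text \<open>An object \<open>(K, L, M, f, g)\<close> is determined up to isomorphism by the comparison
  \<open>g\<inverse> f : F K \<rightarrow> G L\<close>, and its morphisms are the pairs of arrows compatible with the comparisons:
  the third component is forced. All further work is done with comparisons.\<close>

definition inv_F :: "('k, 'l, 'm, 'mm) pspb_obj \<Rightarrow> 'mm" where
  "inv_F X = (SOME f. mutually_inverse \<M> (obj_map F (obj_K X)) (obj_M X) (iso_F X) f)"

definition inv_G :: "('k, 'l, 'm, 'mm) pspb_obj \<Rightarrow> 'mm" where
  "inv_G X = (SOME g. mutually_inverse \<M> (obj_map G (obj_L X)) (obj_M X) (iso_G X) g)"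

definition comparison :: "('k, 'l, 'm, 'mm) pspb_obj \<Rightarrow> 'mm" where
  "comparison X = Comp \<M> (inv_G X) (iso_F X)"

definition comparison_inv :: "('k, 'l, 'm, 'mm) pspb_obj \<Rightarrow> 'mm" where
  "comparison_inv X = Comp \<M> (inv_F X) (iso_G X)"

lemma inv_F:
  assumes "X \<in> Obj P"
  shows "mutually_inverse \<M> (obj_map F (obj_K X)) (obj_M X) (iso_F X) (inv_F X)"
  using assms unfolding pspb_obj_iff is_iso_iff inv_F_def by (metis someI_ex)

lemma inv_G:
  assumes "X \<in> Obj P"
  shows "mutually_inverse \<M> (obj_map G (obj_L X)) (obj_M X) (iso_G X) (inv_G X)"
  using assms unfolding pspb_obj_iff is_iso_iff inv_G_def by (metis someI_ex)

lemma comparison_iso: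
  assumes X: "X \<in> Obj P"
  shows "mutually_inverse \<M> (obj_map F (obj_K X)) (obj_map G (obj_L X)) (comparison X) (comparison_inv X)"
  unfolding comparison_def comparison_inv_def
  by (rule mutually_inverse_comp[OF functorD(2)[OF F] inv_F[OF X] mutually_inverse_sym[OF inv_G[OF X]]])

lemmas comparison_hom = mutually_inverseD(1)[OF comparison_iso]

lemma pspb_hom_compatible:
  assumes t: "t \<in> hom P X Y"
  shows "Comp \<M> (arr_map G (arr_L t)) (comparison X) = Comp \<M> (comparison Y) (arr_map F (arr_K t))"
proof -
  note cM = functorD(2)[OF F] and X = pspb_homD(1)[OF t] and Y = pspb_homD(2)[OF t]
  note Ft = functorD(4)[OF F pspb_homD(3)[OF t]] and Gt = functorD(4)[OF G pspb_homD(4)[OF t]]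
  note fX = mutually_inverseD[OF inv_F[OF X]] and gX = mutually_inverseD[OF inv_G[OF X]]
  note fY = mutually_inverseD[OF inv_F[OF Y]] and gY = mutually_inverseD[OF inv_G[OF Y]]
  have M: "arr_M t \<in> hom \<M> (obj_M X) (obj_M Y)"
    and eF: "Comp \<M> (arr_M t) (iso_F X) = Comp \<M> (iso_F Y) (arr_map F (arr_K t))"
    and eG: "Comp \<M> (arr_M t) (iso_G X) = Comp \<M> (iso_G Y) (arr_map G (arr_L t))"
    using t unfolding pspb_hom_iff by blast+
  have "Comp \<M> (arr_map G (arr_L t)) (inv_G X) =
      Comp \<M> (inv_G Y) (Comp \<M> (iso_G Y) (Comp \<M> (arr_map G (arr_L t)) (inv_G X)))"
    by (rule inverse_cancel_left[OF cM inv_G[OF Y] comp_hom[OF cM gX(2) Gt], symmetric])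
  also have "Comp \<M> (iso_G Y) (Comp \<M> (arr_map G (arr_L t)) (inv_G X)) =
      Comp \<M> (Comp \<M> (arr_M t) (iso_G X)) (inv_G X)"
    using comp_assoc[OF cM gX(2) Gt gY(1)] eG by simp
  also have "\<dots> = arr_M t" by (rule inverse_cancel_right[OF cM mutually_inverse_sym[OF inv_G[OF X]] M])
  finally have "Comp \<M> (arr_map G (arr_L t)) (inv_G X) = Comp \<M> (inv_G Y) (arr_M t)" .
  then show ?thesis
    unfolding comparison_def
    using comp_assoc[OF cM fX(1) gX(2) Gt] comp_assoc[OF cM fX(1) M gY(2)] eF
      comp_assoc[OF cM Ft fY(1) gY(2)] by simp
qed

lemma pspb_hom_exists:
  assumes X: "X \<in> Obj P" and Y: "Y \<in> Obj P" and a: "a \<in> hom \<K> (obj_K X) (obj_K Y)"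
    and b: "b \<in> hom \<L> (obj_L X) (obj_L Y)"
    and ab: "Comp \<M> (arr_map G b) (comparison X) = Comp \<M> (comparison Y) (arr_map F a)"
  obtains t where "t \<in> hom P X Y" "arr_K t = a" "arr_L t = b"
proof -
  note cM = functorD(2)[OF F] and Fa = functorD(4)[OF F a] and Gb = functorD(4)[OF G b]
  note fX = mutually_inverseD[OF inv_F[OF X]] and gX = mutually_inverseD[OF inv_G[OF X]]
  note fY = mutually_inverseD[OF inv_F[OF Y]] and gY = mutually_inverseD[OF inv_G[OF Y]]
  let ?c = "Comp \<M> (iso_G Y) (Comp \<M> (arr_map G b) (inv_G X))"
  note Gbg = comp_hom[OF cM gX(2) Gb]
  have c: "?c \<in> hom \<M> (obj_M X) (obj_M Y)" by (rule comp_hom[OF cM Gbg gY(1)])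
  have "Comp \<M> ?c (iso_F X) = Comp \<M> (iso_G Y) (Comp \<M> (arr_map G b) (comparison X))"
    unfolding comparison_def
    using comp_assoc[OF cM fX(1) Gbg gY(1)] comp_assoc[OF cM fX(1) gX(2) Gb] by simp
  also have "\<dots> = Comp \<M> (iso_G Y) (Comp \<M> (inv_G Y) (Comp \<M> (iso_F Y) (arr_map F a)))"
    unfolding ab unfolding comparison_def using comp_assoc[OF cM Fa fY(1) gY(2)] by simp
  also have "\<dots> = Comp \<M> (iso_F Y) (arr_map F a)"
    by (rule inverse_cancel_left[OF cM mutually_inverse_sym[OF inv_G[OF Y]] comp_hom[OF cM Fa fY(1)]])
  finally have cF: "Comp \<M> ?c (iso_F X) = Comp \<M> (iso_F Y) (arr_map F a)" .
  have "Comp \<M> ?c (iso_G X) = Comp \<M> (iso_G Y) (Comp \<M> (Comp \<M> (arr_map G b) (inv_G X)) (iso_G X))"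
    by (rule comp_assoc[OF cM gX(1) Gbg gY(1), symmetric])
  also have "\<dots> = Comp \<M> (iso_G Y) (arr_map G b)"
    using inverse_cancel_right[OF cM inv_G[OF X] Gb] by simp
  finally have cG: "Comp \<M> ?c (iso_G X) = Comp \<M> (iso_G Y) (arr_map G b)" .
  have "(X, (a, b, ?c), Y) \<in> hom P X Y"
    unfolding pspb_hom_iff using X Y a b c cF cG by simp
  from that[OF this] show thesis by simp
qed

lemma pspb_hom_unique:
  assumes s: "s \<in> hom P X Y" and t: "t \<in> hom P X Y" and K: "arr_K s = arr_K t" and L: "arr_L s = arr_L t"
  shows "s = t"
proof (rule pspb_arr_eqI)
  note cM = functorD(2)[OF F] and X = pspb_homD(1)[OF t]
  have M: "arr_M s \<in> hom \<M> (obj_M X) (obj_M Y)" "arr_M t \<in> hom \<M> (obj_M X) (obj_M Y)"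
    and e: "Comp \<M> (arr_M s) (iso_F X) = Comp \<M> (arr_M t) (iso_F X)"
    using s t K unfolding pspb_hom_iff by simp_all
  show "arr_M s = arr_M t"
    using inverse_cancel_right[OF cM mutually_inverse_sym[OF inv_F[OF X]] M(1)]
      inverse_cancel_right[OF cM mutually_inverse_sym[OF inv_F[OF X]] M(2)] e by metis
qed (use s t K L in \<open>simp_all add: pspb_hom_iff\<close>)

lemma pspb_obj_of_iso:
  assumes K: "K \<in> Obj \<K>" and L: "L \<in> Obj \<L>"
    and \<theta>: "mutually_inverse \<M> (obj_map F K) (obj_map G L) \<theta> \<theta>'"
  defines "X \<equiv> (K, L, obj_map G L, \<theta>, Ident \<M> (obj_map G L))"
  shows "X \<in> Obj P" "obj_K X = K" "obj_L X = L" "comparison X = \<theta>"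
proof -
  note cM = functorD(2)[OF F]
  note GL = functorD(3)[OF G L]
  note i = mutually_inverse_ident[OF cM GL]
  show X: "X \<in> Obj P"
    unfolding pspb_obj_iff X_def pspb_parts is_iso_iff using K L GL \<theta> i by blast
  show "obj_K X = K" "obj_L X = L" by (simp_all add: X_def)
  have "mutually_inverse \<M> (obj_map G L) (obj_map G L) (Ident \<M> (obj_map G L)) (inv_G X)"
    using inv_G[OF X] by (simp add: X_def)
  then have "inv_G X = Ident \<M> (obj_map G L)"
    using ident_left[OF cM] mutually_inverseD by metis
  then show "comparison X = \<theta>"
    unfolding comparison_def using ident_left[OF cM mutually_inverseD(1)[OF \<theta>]] by (simp add: X_def)
qed

lemma pspb_comparison_natural:
  assumes D: "is_functor I P D" and u: "u \<in> hom I i j"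
  shows "Comp \<M> (arr_map G (arr_L (arr_map D u))) (comparison (obj_map D i)) =
    Comp \<M> (comparison (obj_map D j)) (arr_map F (arr_K (arr_map D u)))"
  by (rule pspb_hom_compatible[OF functorD(4)[OF D u]])

section \<open>Filtered colimits in the pseudopullback\<close>

lemma pspb_colimitI:
  assumes D: "is_functor I P D" and c: "cocone I P D X \<iota>"
    and cK: "colimit I \<K> (comp_functor G_bar D) (obj_K X) (\<lambda>i. arr_K (\<iota> i))"
    and cL: "colimit I \<L> (comp_functor F_bar D) (obj_L X) (\<lambda>i. arr_L (\<iota> i))"
    and cF: "colimit I \<M> (comp_functor F (comp_functor G_bar D)) (obj_map F (obj_K X))
      (\<lambda>i. arr_map F (arr_K (\<iota> i)))"
  shows "colimit I P D X \<iota>"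
proof (rule colimitI[OF c])
  note catM = functorD(2)[OF F]
  note DK = comp_functor_is_functor[OF D G_bar_functor] and DL = comp_functor_is_functor[OF D F_bar_functor]
  note DF = comp_functor_is_functor[OF DK F]
  note X = coconeD(1)[OF c] and \<iota> = coconeD(2)[OF c]
  fix Y \<delta> assume d: "cocone I P D Y \<delta>"
  note Y = coconeD(1)[OF d] and \<delta> = coconeD(2)[OF d]
  have dK: "cocone I \<K> (comp_functor G_bar D) (obj_K Y) (\<lambda>i. arr_K (\<delta> i))"
    using functor_cocone[OF D G_bar_functor d] by simp
  have dL: "cocone I \<L> (comp_functor F_bar D) (obj_L Y) (\<lambda>i. arr_L (\<delta> i))"
    using functor_cocone[OF D F_bar_functor d] by simp
  obtain a where a: "a \<in> hom \<K> (obj_K X) (obj_K Y)"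
    "\<And>i. i \<in> Obj I \<Longrightarrow> Comp \<K> a (arr_K (\<iota> i)) = arr_K (\<delta> i)"
    using colimit_factor[OF cK dK] by blast
  obtain b where b: "b \<in> hom \<L> (obj_L X) (obj_L Y)"
    "\<And>i. i \<in> Obj I \<Longrightarrow> Comp \<L> b (arr_L (\<iota> i)) = arr_L (\<delta> i)"
    using colimit_factor[OF cL dL] by blast
  note Fa = functorD(4)[OF F a(1)] and Gb = functorD(4)[OF G b(1)]
  have ab: "Comp \<M> (arr_map G b) (comparison X) = Comp \<M> (comparison Y) (arr_map F a)"
  proof (rule colimit_ext[OF DF cF comp_hom[OF catM comparison_hom[OF X] Gb]
        comp_hom[OF catM Fa comparison_hom[OF Y]]])
    fix i assume i: "i \<in> Obj I"
    note \<iota>i = pspb_homD[OF \<iota>[OF i]]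
    note FK = functorD(4)[OF F \<iota>i(3)] and GL = functorD(4)[OF G \<iota>i(4)]
    have "Comp \<M> (Comp \<M> (arr_map G b) (comparison X)) (arr_map F (arr_K (\<iota> i))) =
        Comp \<M> (arr_map G b) (Comp \<M> (arr_map G (arr_L (\<iota> i))) (comparison (obj_map D i)))"
      using comp_assoc[OF catM FK comparison_hom[OF X] Gb] pspb_hom_compatible[OF \<iota>[OF i]] by simp
    also have "\<dots> = Comp \<M> (arr_map G (arr_L (\<delta> i))) (comparison (obj_map D i))"
      using comp_assoc[OF catM comparison_hom[OF \<iota>i(1)] GL Gb] functorD(6)[OF G \<iota>i(4) b(1)] b(2)[OF i]
      by simp
    also have "\<dots> = Comp \<M> (comparison Y) (arr_map F (arr_K (\<delta> i)))"
      by (rule pspb_hom_compatible[OF \<delta>[OF i]])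
    also have "\<dots> = Comp \<M> (Comp \<M> (comparison Y) (arr_map F a)) (arr_map F (arr_K (\<iota> i)))"
      using comp_assoc[OF catM FK Fa comparison_hom[OF Y]] functorD(6)[OF F \<iota>i(3) a(1)] a(2)[OF i] by simp
    finally show "Comp \<M> (Comp \<M> (arr_map G b) (comparison X)) (arr_map F (arr_K (\<iota> i))) =
        Comp \<M> (Comp \<M> (comparison Y) (arr_map F a)) (arr_map F (arr_K (\<iota> i)))" .
  qed
  obtain t where t: "t \<in> hom P X Y" "arr_K t = a" "arr_L t = b"
    using pspb_hom_exists[OF X Y a(1) b(1) ab] .
  have "Comp P t (\<iota> i) = \<delta> i" if i: "i \<in> Obj I" for i
    by (rule pspb_hom_unique[OF comp_hom[OF pspb_category \<iota>[OF i] t(1)] \<delta>[OF i]])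
      (simp_all add: t a(2)[OF i] b(2)[OF i])
  then show "\<exists>h \<in> hom P X Y. \<forall>i \<in> Obj I. Comp P h (\<iota> i) = \<delta> i" by (intro bexI[OF _ t(1)] ballI)
next
  note DK = comp_functor_is_functor[OF D G_bar_functor] and DL = comp_functor_is_functor[OF D F_bar_functor]
  fix Y s t assume s: "s \<in> hom P X Y" and t: "t \<in> hom P X Y"
    and eq: "\<And>i. i \<in> Obj I \<Longrightarrow> Comp P s (\<iota> i) = Comp P t (\<iota> i)"
  show "s = t"
  proof (rule pspb_hom_unique[OF s t])
    show "arr_K s = arr_K t"
    proof (rule colimit_ext[OF DK cK pspb_homD(3)[OF s] pspb_homD(3)[OF t]])
      fix i assume "i \<in> Obj I"
      from arg_cong[OF eq[OF this], of arr_K]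
      show "Comp \<K> (arr_K s) (arr_K (\<iota> i)) = Comp \<K> (arr_K t) (arr_K (\<iota> i))" by simp
    qed
    show "arr_L s = arr_L t"
    proof (rule colimit_ext[OF DL cL pspb_homD(4)[OF s] pspb_homD(4)[OF t]])
      fix i assume "i \<in> Obj I"
      from arg_cong[OF eq[OF this], of arr_L]
      show "Comp \<L> (arr_L s) (arr_L (\<iota> i)) = Comp \<L> (arr_L t) (arr_L (\<iota> i))" by simp
    qed
  qed
qed

lemma pspb_cocone_exists:
  assumes D: "is_functor I P D" and X: "X \<in> Obj P"
    and K: "cocone I \<K> (comp_functor G_bar D) (obj_K X) \<kappa>"
    and L: "cocone I \<L> (comp_functor F_bar D) (obj_L X) \<delta>"
    and compat: "\<And>i. i \<in> Obj I \<Longrightarrow> Comp \<M> (comparison X) (arr_map F (\<kappa> i)) =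
      Comp \<M> (arr_map G (\<delta> i)) (comparison (obj_map D i))"
  shows "\<exists>\<iota>. cocone I P D X \<iota> \<and> (\<forall>i \<in> Obj I. arr_K (\<iota> i) = \<kappa> i \<and> arr_L (\<iota> i) = \<delta> i)"
proof -
  note cI = functorD(1)[OF D]
  have "\<exists>t. t \<in> hom P (obj_map D i) X \<and> arr_K t = \<kappa> i \<and> arr_L t = \<delta> i" if i: "i \<in> Obj I" for i
  proof -
    have "\<kappa> i \<in> hom \<K> (obj_K (obj_map D i)) (obj_K X)" "\<delta> i \<in> hom \<L> (obj_L (obj_map D i)) (obj_L X)"
      using coconeD(2)[OF K i] coconeD(2)[OF L i] by simp_all
    from pspb_hom_exists[OF functorD(3)[OF D i] X this compat[OF i, symmetric]] show ?thesis by metis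
  qed
  then obtain \<iota> where \<iota>: "\<And>i. i \<in> Obj I \<Longrightarrow> \<iota> i \<in> hom P (obj_map D i) X"
    "\<And>i. i \<in> Obj I \<Longrightarrow> arr_K (\<iota> i) = \<kappa> i" "\<And>i. i \<in> Obj I \<Longrightarrow> arr_L (\<iota> i) = \<delta> i" by metis
  have "cocone I P D X \<iota>"
    unfolding cocone_def
  proof (intro conjI ballI allI impI X)
    show "\<iota> i \<in> hom P (obj_map D i) X" if "i \<in> Obj I" for i by (rule \<iota>(1)[OF that])
    fix i j u assume u: "u \<in> hom I i j"
    note o = hom_objD[OF cI u]
    show "Comp P (\<iota> j) (arr_map D u) = \<iota> i"
      by (rule pspb_hom_unique[OF comp_hom[OF pspb_category functorD(4)[OF D u] \<iota>(1)[OF o(2)]] \<iota>(1)[OF o(1)]])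
        (use coconeD(3)[OF K u] coconeD(3)[OF L u] \<iota>(2,3)[OF o(1)] \<iota>(2,3)[OF o(2)] in simp_all)
  qed
  then show ?thesis using \<iota>(2,3) by blast
qed

lemma pspb_colimit_exists:
  assumes D: "is_functor I P D"
    and cK: "colimit I \<K> (comp_functor G_bar D) K \<kappa>"
    and cL: "colimit I \<L> (comp_functor F_bar D) L \<delta>"
    and cF: "colimit I \<M> (comp_functor F (comp_functor G_bar D)) (obj_map F K) (\<lambda>i. arr_map F (\<kappa> i))"
    and cG: "colimit I \<M> (comp_functor G (comp_functor F_bar D)) (obj_map G L) (\<lambda>i. arr_map G (\<delta> i))"
  obtains X \<iota> where "colimit I P D X \<iota>" "obj_K X = K" "obj_L X = L"
    "\<And>i. i \<in> Obj I \<Longrightarrow> arr_K (\<iota> i) = \<kappa> i" "\<And>i. i \<in> Obj I \<Longrightarrow> arr_L (\<iota> i) = \<delta> i"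
proof -
  note cI = functorD(1)[OF D]
  note DK = comp_functor_is_functor[OF D G_bar_functor] and DL = comp_functor_is_functor[OF D F_bar_functor]
  note DF = comp_functor_is_functor[OF DK F] and DG = comp_functor_is_functor[OF DL G]
  note kK = colimit_imp_cocone[OF cK] and kL = colimit_imp_cocone[OF cL]
  have \<kappa>: "\<kappa> i \<in> hom \<K> (obj_K (obj_map D i)) K" and \<delta>: "\<delta> i \<in> hom \<L> (obj_L (obj_map D i)) L"
    if "i \<in> Obj I" for i
    using coconeD(2)[OF kK that] coconeD(2)[OF kL that] by simp_all
  have cF': "colimit I \<M> (comp_functor F (comp_functor G_bar D)) (obj_map G L)
      (\<lambda>i. Comp \<M> (arr_map G (\<delta> i)) (comparison (obj_map D i)))"
    by (rule colimit_iso_diagram[OF DG DF _ _ cG, where \<theta> = "\<lambda>i. comparison_inv (obj_map D i)"])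
      (simp_all add: comparison_iso[OF functorD(3)[OF D]] pspb_comparison_natural[OF D])
  have "\<exists>\<theta> \<theta>'. mutually_inverse \<M> (obj_map F K) (obj_map G L) \<theta> \<theta>' \<and>
    (\<forall>i \<in> Obj I. Comp \<M> \<theta> (arr_map F (\<kappa> i)) =
      Comp \<M> (arr_map G (\<delta> i)) (comparison (obj_map D i)))"
    by (rule colimits_isomorphic[OF DF cF cF']) (intro exI conjI ballI, assumption, simp)
  then obtain \<theta> \<theta>' where \<theta>: "mutually_inverse \<M> (obj_map F K) (obj_map G L) \<theta> \<theta>'"
    "\<And>i. i \<in> Obj I \<Longrightarrow> Comp \<M> \<theta> (arr_map F (\<kappa> i)) =
      Comp \<M> (arr_map G (\<delta> i)) (comparison (obj_map D i))" by blast
  define X where "X = (K, L, obj_map G L, \<theta>, Ident \<M> (obj_map G L))"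
  have X: "X \<in> Obj P" "obj_K X = K" "obj_L X = L" "comparison X = \<theta>"
    unfolding X_def by (rule pspb_obj_of_iso[OF coconeD(1)[OF kK] coconeD(1)[OF kL] \<theta>(1)])+
  have "cocone I \<K> (comp_functor G_bar D) (obj_K X) \<kappa>" "cocone I \<L> (comp_functor F_bar D) (obj_L X) \<delta>"
    using kK kL unfolding X(2,3) .
  moreover have "Comp \<M> (comparison X) (arr_map F (\<kappa> i)) =
      Comp \<M> (arr_map G (\<delta> i)) (comparison (obj_map D i))" if "i \<in> Obj I" for i
    unfolding X(4) by (rule \<theta>(2)[OF that])
  ultimately have "\<exists>\<iota>. cocone I P D X \<iota> \<and> (\<forall>i \<in> Obj I. arr_K (\<iota> i) = \<kappa> i \<and> arr_L (\<iota> i) = \<delta> i)"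
    by (rule pspb_cocone_exists[OF D X(1)])
  then obtain \<iota> where \<iota>: "cocone I P D X \<iota>"
    "\<And>i. i \<in> Obj I \<Longrightarrow> arr_K (\<iota> i) = \<kappa> i" "\<And>i. i \<in> Obj I \<Longrightarrow> arr_L (\<iota> i) = \<delta> i" by blast
  note \<iota>(1)
  moreover have "colimit I \<K> (comp_functor G_bar D) (obj_K X) (\<lambda>i. arr_K (\<iota> i))"
    unfolding X(2) by (rule colimit_cong[THEN iffD2, OF \<iota>(2) cI cK])
  moreover have "colimit I \<L> (comp_functor F_bar D) (obj_L X) (\<lambda>i. arr_L (\<iota> i))"
    unfolding X(3) by (rule colimit_cong[THEN iffD2, OF \<iota>(3) cI cL])
  moreover have "colimit I \<M> (comp_functor F (comp_functor G_bar D)) (obj_map F (obj_K X))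
      (\<lambda>i. arr_map F (arr_K (\<iota> i)))"
    unfolding X(2) by (rule colimit_cong[THEN iffD2, OF _ cI cF]) (simp add: \<iota>(2))
  ultimately have "colimit I P D X \<iota>" by (rule pspb_colimitI[OF D])
  from that[OF this X(2,3) \<iota>(2,3)] show thesis .
qed

text \<open>The third component of the objects is chosen as the image under \<open>G\<close> of the second, with an identity
  as second isomorphism; then only a natural comparison \<open>\<theta>\<close> has to be supplied.\<close>

definition pair_functor :: "('i, 'j) cat \<Rightarrow> ('i, 'j, 'k, 'kk) fctr \<Rightarrow> ('i, 'j, 'l, 'll) fctr \<Rightarrow> ('i \<Rightarrow> 'mm) \<Rightarrow>
    ('i, 'j, ('k, 'l, 'm, 'mm) pspb_obj, ('k, 'kk, 'l, 'll, 'm, 'mm) pspb_arr) fctr" where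
  "pair_functor I DK DL \<theta> =
     (let X = (\<lambda>i. (obj_map DK i, obj_map DL i, obj_map G (obj_map DL i), \<theta> i,
                  Ident \<M> (obj_map G (obj_map DL i))))
      in \<lparr>obj_map = X, arr_map = (\<lambda>u. (X (Dom I u),
           (arr_map DK u, arr_map DL u, arr_map G (arr_map DL u)), X (Cod I u)))\<rparr>)"

lemma pair_functor_simps:
  "obj_K (obj_map (pair_functor I DK DL \<theta>) i) = obj_map DK i"
  "obj_L (obj_map (pair_functor I DK DL \<theta>) i) = obj_map DL i"
  "comp_functor G_bar (pair_functor I DK DL \<theta>) = DK"
  "comp_functor F_bar (pair_functor I DK DL \<theta>) = DL"
  by (simp_all add: pair_functor_def Let_def comp_functor_def comp_def)

lemma pair_functor_is_functor:
  assumes DK: "is_functor I \<K> DK" and DL: "is_functor I \<L> DL"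
    and \<theta>: "\<And>i. i \<in> Obj I \<Longrightarrow>
      mutually_inverse \<M> (obj_map F (obj_map DK i)) (obj_map G (obj_map DL i)) (\<theta> i) (\<theta>' i)"
    and nat: "\<And>i j u. u \<in> hom I i j \<Longrightarrow>
      Comp \<M> (arr_map G (arr_map DL u)) (\<theta> i) = Comp \<M> (\<theta> j) (arr_map F (arr_map DK u))"
  shows "is_functor I P (pair_functor I DK DL \<theta>)"
    and "i \<in> Obj I \<Longrightarrow> comparison (obj_map (pair_functor I DK DL \<theta>) i) = \<theta> i"
proof -
  let ?D = "pair_functor I DK DL \<theta>"
  note cI = functorD(1)[OF DK] and cM = functorD(2)[OF F]
  have X: "obj_map ?D i = (obj_map DK i, obj_map DL i, obj_map G (obj_map DL i), \<theta> i,
      Ident \<M> (obj_map G (obj_map DL i)))" for i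
    by (simp add: pair_functor_def Let_def)
  note o = pspb_obj_of_iso[OF functorD(3)[OF DK] functorD(3)[OF DL] \<theta>, folded X]
  show "comparison (obj_map ?D i) = \<theta> i" if "i \<in> Obj I" for i by (rule o(4)[OF that that that])
  have obj: "obj_map ?D i \<in> Obj P" if "i \<in> Obj I" for i by (rule o(1)[OF that that that])
  have U: "fst (arr_map ?D u) = obj_map ?D (Dom I u)" "snd (snd (arr_map ?D u)) = obj_map ?D (Cod I u)"
    "arr_K (arr_map ?D u) = arr_map DK u" "arr_L (arr_map ?D u) = arr_map DL u"
    "arr_M (arr_map ?D u) = arr_map G (arr_map DL u)" for u
    by (simp_all add: pair_functor_def Let_def)
  have arr: "arr_map ?D u \<in> hom P (obj_map ?D i) (obj_map ?D j)" if u: "u \<in> hom I i j" for i j u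
  proof -
    note ij = hom_objD[OF cI u] and Ku = functorD(4)[OF DK u] and Lu = functorD(4)[OF DL u]
    note Gu = functorD(4)[OF G Lu]
    have "Comp \<M> (arr_map G (arr_map DL u)) (Ident \<M> (obj_map G (obj_map DL i))) =
        Comp \<M> (Ident \<M> (obj_map G (obj_map DL j))) (arr_map G (arr_map DL u))"
      using ident_left[OF cM Gu] ident_right[OF cM Gu] by simp
    then show ?thesis
      unfolding pspb_hom_iff U
      using obj[OF ij(1)] obj[OF ij(2)] Ku Lu Gu nat[OF u] homD[OF u] by (simp add: X)
  qed
  show "is_functor I P ?D"
    unfolding is_functor_def
  proof (intro conjI ballI allI impI cI pspb_category)
    show "obj_map ?D i \<in> Obj P" if "i \<in> Obj I" for i by (rule obj[OF that])
    show "arr_map ?D u \<in> hom P (obj_map ?D i) (obj_map ?D j)" if "u \<in> hom I i j" for i j u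
      by (rule arr[OF that])
    show "arr_map ?D (Ident I i) = Ident P (obj_map ?D i)" if i: "i \<in> Obj I" for i
      by (rule pspb_hom_unique[OF arr[OF ident_hom[OF cI i]] ident_hom[OF pspb_category obj[OF i]]])
        (simp_all add: U functorD(5)[OF DK i] functorD(5)[OF DL i] X)
    show "arr_map ?D (Comp I v u) = Comp P (arr_map ?D v) (arr_map ?D u)"
      if u: "u \<in> hom I i j" and v: "v \<in> hom I j k" for i j k u v
      by (rule pspb_hom_unique[OF arr[OF comp_hom[OF cI u v]] comp_hom[OF pspb_category arr[OF u] arr[OF v]]])
        (simp_all add: U functorD(6)[OF DK u v] functorD(6)[OF DL u v])
  qed
qed

end

section \<open>Accessibility of the pseudopullback\<close>

text \<open>With the legs of \<open>d\<close> precomposed with \<open>\<phi>\<close>, the object \<open>d\<close> is a colimit of the first chain as well: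
  an arrow into \<open>d\<close> factors through a stage of the second chain and hence, by \<open>\<psi>\<close>, through the next stage of
  the first, and an identification after \<open>\<phi>\<close> becomes one in the first chain after composition with \<open>\<psi>\<close>.
  Testing with presentable objects avoids making a coherent choice of the arrows \<open>\<psi>\<close>.\<close>

lemma chain_comparison:
  fixes \<kappa> :: "'u rel" and lam :: "'l rel" and \<M> :: "('m, 'mm) cat"
  assumes \<kappa>: "inaccessible \<kappa>" and lam: "Cinfinite lam" "regularCard lam" "lam <o \<kappa>"
    and \<M>: "class_accessible \<kappa> lam \<M>"
    and D: "is_functor (chain_index lam) \<M> D" and E: "is_functor (chain_index lam) \<M> E"
    and c: "colimit (chain_index lam) \<M> D c \<gamma>" and d: "colimit (chain_index lam) \<M> E d \<delta>"
    and \<phi>: "\<And>p. p \<in> Field lam \<Longrightarrow> \<phi> p \<in> hom \<M> (obj_map D p) (obj_map E p)"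
    and \<psi>: "\<And>p q. (p, q) \<in> lam \<Longrightarrow> p \<noteq> q \<Longrightarrow> \<exists>\<psi> \<in> hom \<M> (obj_map E p) (obj_map D q).
      Comp \<M> \<psi> (\<phi> p) = arr_map D (p, q) \<and> Comp \<M> (\<phi> q) \<psi> = arr_map E (p, q)"
  shows "\<exists>\<theta> \<theta>'. mutually_inverse \<M> c d \<theta> \<theta>' \<and>
    (\<forall>p \<in> Field lam. Comp \<M> \<theta> (\<gamma> p) = Comp \<M> (\<delta> p) (\<phi> p))"
proof -
  let ?I = "chain_index lam"
  note cM = class_accessibleD(2)[OF \<M>] and I = small_filtered_chain_index[OF \<kappa> lam]
  note dc = colimit_imp_cocone[OF d]
  have \<delta>: "\<delta> p \<in> hom \<M> (obj_map E p) d" if "p \<in> Field lam" for p using coconeD(2)[OF dc, of p] that by simp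
  have Dpq: "arr_map D (p, q) \<in> hom \<M> (obj_map D p) (obj_map D q)"
    and Epq: "arr_map E (p, q) \<in> hom \<M> (obj_map E p) (obj_map E q)"
    and \<delta>E: "Comp \<M> (\<delta> q) (arr_map E (p, q)) = \<delta> p" if "(p, q) \<in> lam" for p q
    using functorD(4)[OF D, of "(p, q)"] functorD(4)[OF E, of "(p, q)"] coconeD(3)[OF dc, of "(p, q)"] that
    by (simp_all add: hom_chain_index)
  have nat: "Comp \<M> (\<phi> q) (arr_map D (p, q)) = Comp \<M> (arr_map E (p, q)) (\<phi> p)"
    if pq: "(p, q) \<in> lam" "p \<noteq> q" for p q
  proof -
    have o: "p \<in> Field lam" "q \<in> Field lam" using pq(1) by (auto intro: FieldI1 FieldI2)
    obtain \<psi>' where p: "\<psi>' \<in> hom \<M> (obj_map E p) (obj_map D q)"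
      "Comp \<M> \<psi>' (\<phi> p) = arr_map D (p, q)" "Comp \<M> (\<phi> q) \<psi>' = arr_map E (p, q)" using \<psi>[OF pq] by blast
    show ?thesis using comp_assoc[OF cM \<phi>[OF o(1)] p(1) \<phi>[OF o(2)]] p(2,3) by simp
  qed
  let ?l = "\<lambda>p. Comp \<M> (\<delta> p) (\<phi> p)"
  have cc: "cocone ?I \<M> D d ?l"
    unfolding cocone_def
  proof (intro conjI ballI allI impI)
    show "d \<in> Obj \<M>" by (rule coconeD(1)[OF dc])
    show "?l p \<in> hom \<M> (obj_map D p) d" if "p \<in> Obj ?I" for p
      using comp_hom[OF cM \<phi> \<delta>] that by simp
    fix p q u assume "u \<in> hom ?I p q"
    then have u: "u = (p, q)" "(p, q) \<in> lam" by (simp_all add: hom_chain_index)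
    have o: "p \<in> Field lam" "q \<in> Field lam" using u(2) by (auto intro: FieldI1 FieldI2)
    show "Comp \<M> (?l q) (arr_map D u) = ?l p"
    proof (cases "p = q")
      case True
      have "Ident ?I p = (p, p)" by (simp add: chain_index_def)
      then have "arr_map D u = Ident \<M> (obj_map D p)" using functorD(5)[OF D, of p] o(1) u(1) True by simp
      then show ?thesis using ident_right[OF cM comp_hom[OF cM \<phi>[OF o(1)] \<delta>[OF o(1)]]] True by simp
    next
      case False
      have "Comp \<M> (?l q) (arr_map D (p, q)) = Comp \<M> (\<delta> q) (Comp \<M> (arr_map E (p, q)) (\<phi> p))"
        using comp_assoc[OF cM Dpq[OF u(2)] \<phi>[OF o(2)] \<delta>[OF o(2)]] nat[OF u(2) False] by simp
      also have "\<dots> = ?l p"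
        using comp_assoc[OF cM \<phi>[OF o(1)] Epq[OF u(2)] \<delta>[OF o(2)]] \<delta>E[OF u(2)] by simp
      finally show ?thesis using u(1) by simp
    qed
  qed
  have "colimit ?I \<M> D d ?l"
  proof (rule stagewise_imp_colimit[OF \<kappa> lam(1) \<M> I D cc])
    fix B assume B: "presentable \<kappa> lam \<M> B"
    note st = presentable_stagewise[OF \<kappa> lam(1) class_accessibleD(1)[OF \<M>] B I E d]
    have "\<exists>q \<in> Obj ?I. \<exists>y \<in> hom \<M> B (obj_map D q). Comp \<M> (?l q) y = x" if x: "x \<in> hom \<M> B d" for x
    proof -
      obtain p y where "p \<in> Obj ?I" and y: "y \<in> hom \<M> B (obj_map E p)" "Comp \<M> (\<delta> p) y = x"
        using stagewise_factor[OF st x] .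
      then have p: "p \<in> Field lam" by simp
      obtain q where q: "q \<in> Field lam" "(p, q) \<in> lam" "p \<noteq> q" using strict_successor[OF lam(1,2) p] .
      obtain \<psi>' where p': "\<psi>' \<in> hom \<M> (obj_map E p) (obj_map D q)"
        "Comp \<M> (\<phi> q) \<psi>' = arr_map E (p, q)" using \<psi>[OF q(2,3)] by blast
      note \<psi>y = comp_hom[OF cM y(1) p'(1)]
      have "Comp \<M> (?l q) (Comp \<M> \<psi>' y) = Comp \<M> (\<delta> q) (Comp \<M> (Comp \<M> (\<phi> q) \<psi>') y)"
        using comp_assoc[OF cM \<psi>y \<phi>[OF q(1)] \<delta>[OF q(1)]] comp_assoc[OF cM y(1) p'(1) \<phi>[OF q(1)]] by simp
      also have "\<dots> = x"
        using comp_assoc[OF cM y(1) Epq[OF q(2)] \<delta>[OF q(1)]] \<delta>E[OF q(2)] y(2) p'(2) by simp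
      finally show ?thesis using q(1) \<psi>y by (intro bexI[of _ q] bexI[of _ "Comp \<M> \<psi>' y"]) simp_all
    qed
    moreover have "\<exists>q \<in> Obj ?I. \<exists>u \<in> hom ?I p q. Comp \<M> (arr_map D u) y = Comp \<M> (arr_map D u) z"
      if pI: "p \<in> Obj ?I" and y: "y \<in> hom \<M> B (obj_map D p)" and z: "z \<in> hom \<M> B (obj_map D p)"
        and eq: "Comp \<M> (?l p) y = Comp \<M> (?l p) z" for p y z
    proof -
      have p: "p \<in> Field lam" using pI by simp
      note \<phi>y = comp_hom[OF cM y \<phi>[OF p]] and \<phi>z = comp_hom[OF cM z \<phi>[OF p]]
      have "Comp \<M> (\<delta> p) (Comp \<M> (\<phi> p) y) = Comp \<M> (\<delta> p) (Comp \<M> (\<phi> p) z)"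
        using comp_assoc[OF cM y \<phi>[OF p] \<delta>[OF p]] comp_assoc[OF cM z \<phi>[OF p] \<delta>[OF p]] eq by simp
      then obtain q u where "u \<in> hom ?I p q" and
        u: "Comp \<M> (arr_map E u) (Comp \<M> (\<phi> p) y) = Comp \<M> (arr_map E u) (Comp \<M> (\<phi> p) z)"
        using stagewise_equalize[OF st pI \<phi>y \<phi>z] by metis
      then have pq: "u = (p, q)" "(p, q) \<in> lam" by (simp_all add: hom_chain_index)
      have q: "q \<in> Field lam" using pq(2) by (rule FieldI2)
      obtain r where r: "r \<in> Field lam" "(q, r) \<in> lam" "q \<noteq> r" using strict_successor[OF lam(1,2) q] .
      obtain s where s: "s \<in> Field lam" "(r, s) \<in> lam" "r \<noteq> s" using strict_successor[OF lam(1,2) r(1)] .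
      note fo = Field_order[OF lam(1)]
      have pr: "(p, r) \<in> lam" and ps: "(p, s) \<in> lam" using fo(2) pq(2) r(2) s(2) by blast+
      have pr': "p \<noteq> r" using fo(3)[OF pq(2)] r(2,3) by blast
      obtain \<psi>' where p': "\<psi>' \<in> hom \<M> (obj_map E r) (obj_map D s)"
        "Comp \<M> \<psi>' (\<phi> r) = arr_map D (r, s)" using \<psi>[OF s(2,3)] by blast
      have DD: "arr_map D (p, s) = Comp \<M> (arr_map D (r, s)) (arr_map D (p, r))"
        using functorD(6)[OF D, of "(p, r)" p r "(r, s)" s] pr s(2)
        by (simp add: hom_chain_index) (simp add: chain_index_def)
      have EE: "arr_map E (p, r) = Comp \<M> (arr_map E (q, r)) (arr_map E (p, q))"
        using functorD(6)[OF E, of "(p, q)" p q "(q, r)" r] pq(2) r(2)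
        by (simp add: hom_chain_index) (simp add: chain_index_def)
      have "Comp \<M> (arr_map D (p, s)) x = Comp \<M> \<psi>' (Comp \<M> (arr_map E (q, r))
          (Comp \<M> (arr_map E (p, q)) (Comp \<M> (\<phi> p) x)))" if x: "x \<in> hom \<M> B (obj_map D p)" for x
      proof -
        note \<phi>x = comp_hom[OF cM x \<phi>[OF p]]
        have "arr_map D (p, s) = Comp \<M> \<psi>' (Comp \<M> (arr_map E (p, r)) (\<phi> p))"
          using comp_assoc[OF cM Dpq[OF pr] \<phi>[OF r(1)] p'(1)] nat[OF pr pr'] p'(2) DD by simp
        then have "Comp \<M> (arr_map D (p, s)) x = Comp \<M> \<psi>' (Comp \<M> (arr_map E (p, r)) (Comp \<M> (\<phi> p) x))"
          using comp_assoc[OF cM x comp_hom[OF cM \<phi>[OF p] Epq[OF pr]] p'(1)]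
            comp_assoc[OF cM x \<phi>[OF p] Epq[OF pr]] by simp
        then show ?thesis using EE comp_assoc[OF cM \<phi>x Epq[OF pq(2)] Epq[OF r(2)]] by simp
      qed
      from this[OF y] this[OF z] have "Comp \<M> (arr_map D (p, s)) y = Comp \<M> (arr_map D (p, s)) z"
        using u pq(1) by simp
      then show ?thesis using s(1) ps by (intro bexI[of _ s] bexI[of _ "(p, s)"]) (simp_all add: hom_chain_index)
    qed
    ultimately show "stagewise \<M> ?I D d ?l B" unfolding stagewise_def by blast
  qed
  from colimits_isomorphic[OF D c this] show ?thesis
    by (metis (no_types, lifting) Obj_chain_index)
qed

lemma strongly_class_accessible_functorD:
  assumes "strongly_class_accessible_functor \<kappa> lam C D F"
  shows "class_accessible_functor \<kappa> lam C D F" "class_accessible \<kappa> lam C" "class_accessible \<kappa> lam D"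
    "is_functor C D F" "preserves_filtered_colimits \<kappa> lam C D F"
    "presentable \<kappa> lam C X \<Longrightarrow> presentable \<kappa> lam D (obj_map F X)"
  using assms
  by (auto simp: strongly_class_accessible_functor_def class_accessible_functor_def)

lemma class_sized_Sigma:
  assumes \<kappa>: "inaccessible \<kappa>" and A: "class_sized \<kappa> A" and B: "\<And>a. a \<in> A \<Longrightarrow> class_sized \<kappa> (B a)"
  shows "class_sized \<kappa> (SIGMA a:A. B a)"
  using card_of_Sigma_ordLeq_infinite_Field[of \<kappa> A B] inaccessibleD(1)[OF \<kappa>] A B
  unfolding class_sized_def cinfinite_def by blast

lemma class_sized_subset: "A \<subseteq> B \<Longrightarrow> class_sized \<kappa> B \<Longrightarrow> class_sized \<kappa> A"
  unfolding class_sized_def using card_of_mono1 ordLeq_transitive by blast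

lemma small_imp_class_sized: "small \<kappa> A \<Longrightarrow> class_sized \<kappa> A"
  unfolding small_def class_sized_def by (rule ordLess_imp_ordLeq)

context
  fixes \<kappa> :: "'u rel" and lam :: "'r rel"
    and \<K> :: "('k, 'kk) cat" and \<L> :: "('l, 'll) cat" and \<M> :: "('m, 'mm) cat"
    and F :: "('k, 'kk, 'm, 'mm) fctr" and G :: "('l, 'll, 'm, 'mm) fctr"
  assumes \<kappa>: "inaccessible \<kappa>" and lam: "Cinfinite lam" "regularCard lam" "lam <o \<kappa>"
    and F: "strongly_class_accessible_functor \<kappa> lam \<K> \<M> F"
    and G: "strongly_class_accessible_functor \<kappa> lam \<L> \<M> G"
begin

private abbreviation (input) PB :: "(('k, 'l, 'm, 'mm) pspb_obj, ('k, 'kk, 'l, 'll, 'm, 'mm) pspb_arr) cat" where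
  "PB \<equiv> PsPb \<K> \<L> \<M> F G"

private lemmas F' = strongly_class_accessible_functorD[OF F]
private lemmas G' = strongly_class_accessible_functorD[OF G]
private lemmas fF = F'(4) and fG = G'(4)

lemma pspb_class_category: "class_category \<kappa> PB"
  unfolding class_category_def
proof (intro conjI ballI)
  note cK = class_accessibleD(1)[OF F'(2)] and cL = class_accessibleD(1)[OF G'(2)]
    and cM = class_accessibleD(1)[OF F'(3)]
  show "category PB" by (rule pspb_category[OF fF fG])
  have hM: "class_sized \<kappa> (hom \<M> x y)" if "x \<in> Obj \<M>" "y \<in> Obj \<M>" for x y
    using cM that unfolding class_category_def by (intro small_imp_class_sized) blast
  have "Obj PB \<subseteq> (SIGMA K:Obj \<K>. SIGMA L:Obj \<L>. SIGMA M:Obj \<M>.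
      hom \<M> (obj_map F K) M \<times> hom \<M> (obj_map G L) M)"
    by (auto simp: PsPb_def pspb_objects_def is_iso_def)
  moreover have "class_sized \<kappa> (SIGMA K:Obj \<K>. SIGMA L:Obj \<L>. SIGMA M:Obj \<M>.
      hom \<M> (obj_map F K) M \<times> hom \<M> (obj_map G L) M)"
    using cK cL cM functorD(3)[OF fF] functorD(3)[OF fG]
    by (intro class_sized_Sigma[OF \<kappa>] hM) (auto simp: class_category_def)
  ultimately show "class_sized \<kappa> (Obj PB)" by (rule class_sized_subset)
  fix X Y assume X: "X \<in> Obj PB" and Y: "Y \<in> Obj PB"
  have "inj_on (\<lambda>t. (arr_K t, arr_L t)) (hom PB X Y)"
    by (intro inj_onI) (use pspb_hom_unique[OF fF fG] in blast)
  moreover have "(\<lambda>t. (arr_K t, arr_L t)) ` hom PB X Y \<subseteq>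
      hom \<K> (obj_K X) (obj_K Y) \<times> hom \<L> (obj_L X) (obj_L Y)"
    by (intro image_subsetI SigmaI pspb_homD(3,4)[OF fF fG])
  moreover have "small \<kappa> (hom \<K> (obj_K X) (obj_K Y) \<times> hom \<L> (obj_L X) (obj_L Y))"
    using cK cL pspb_objD[OF fF fG X] pspb_objD[OF fF fG Y]
    by (intro small_Sigma[OF \<kappa>]) (auto simp: class_category_def)
  ultimately show "small \<kappa> (hom PB X Y)" using small_inj by blast
qed

lemma pspb_filtered_colimit:
  assumes I: "small_filtered \<kappa> lam I" and D: "is_functor I PB D"
  obtains X \<iota> where "colimit I PB D X \<iota>"
    "colimit I \<K> (comp_functor G_bar D) (obj_K X) (\<lambda>i. arr_K (\<iota> i))"
    "colimit I \<L> (comp_functor F_bar D) (obj_L X) (\<lambda>i. arr_L (\<iota> i))"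
proof -
  note DK = comp_functor_is_functor[OF D G_bar_functor[OF fF fG]]
    and DL = comp_functor_is_functor[OF D F_bar_functor[OF fF fG]] and cI = functorD(1)[OF D]
  obtain K k where K: "colimit I \<K> (comp_functor G_bar D) K k"
    using filtered_colimit_exists[OF \<kappa> class_accessibleD(3)[OF F'(2)] I DK] .
  obtain L l where L: "colimit I \<L> (comp_functor F_bar D) L l"
    using filtered_colimit_exists[OF \<kappa> class_accessibleD(3)[OF G'(2)] I DL] .
  obtain X \<iota> where X: "colimit I PB D X \<iota>" "obj_K X = K" "obj_L X = L"
    "\<And>i. i \<in> Obj I \<Longrightarrow> arr_K (\<iota> i) = k i" "\<And>i. i \<in> Obj I \<Longrightarrow> arr_L (\<iota> i) = l i"
    by (rule pspb_colimit_exists[OF fF fG D K L filtered_colimit_preserved[OF \<kappa> F'(5) I DK K]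
        filtered_colimit_preserved[OF \<kappa> G'(5) I DL L]]) (rule that, assumption+)
  have "colimit I \<K> (comp_functor G_bar D) (obj_K X) (\<lambda>i. arr_K (\<iota> i))"
    unfolding X(2) by (rule colimit_cong[THEN iffD2, OF X(4) cI K])
  moreover have "colimit I \<L> (comp_functor F_bar D) (obj_L X) (\<lambda>i. arr_L (\<iota> i))"
    unfolding X(3) by (rule colimit_cong[THEN iffD2, OF X(5) cI L])
  ultimately show thesis by (rule that[OF X(1)])
qed

lemma pspb_colimit_components:
  assumes I: "small_filtered \<kappa> lam I" and D: "is_functor I PB D" and c: "colimit I PB D X \<iota>"
  shows "colimit I \<K> (comp_functor G_bar D) (obj_K X) (\<lambda>i. arr_K (\<iota> i))"
    and "colimit I \<L> (comp_functor F_bar D) (obj_L X) (\<lambda>i. arr_L (\<iota> i))"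
proof -
  note gK = G_bar_functor[OF fF fG] and gL = F_bar_functor[OF fF fG] and cI = functorD(1)[OF D]
  note DK = comp_functor_is_functor[OF D gK] and DL = comp_functor_is_functor[OF D gL]
  obtain Y \<delta> where Y: "colimit I PB D Y \<delta>"
    "colimit I \<K> (comp_functor G_bar D) (obj_K Y) (\<lambda>i. arr_K (\<delta> i))"
    "colimit I \<L> (comp_functor F_bar D) (obj_L Y) (\<lambda>i. arr_L (\<delta> i))"
    by (rule pspb_filtered_colimit[OF I D]) (rule that, assumption+)
  have "\<exists>s t. mutually_inverse PB Y X s t \<and> (\<forall>i \<in> Obj I. Comp PB s (\<delta> i) = \<iota> i)"
    by (rule colimits_isomorphic[OF D Y(1) c]) (intro exI conjI ballI, assumption, simp)
  then obtain s t where s: "mutually_inverse PB Y X s t" "\<And>i. i \<in> Obj I \<Longrightarrow> Comp PB s (\<delta> i) = \<iota> i" by blast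
  have sK: "mutually_inverse \<K> (obj_K Y) (obj_K X) (arr_K s) (arr_K t)"
    using functor_mutually_inverse[OF gK s(1)] by simp
  have sL: "mutually_inverse \<L> (obj_L Y) (obj_L X) (arr_L s) (arr_L t)"
    using functor_mutually_inverse[OF gL s(1)] by simp
  have e: "Comp \<K> (arr_K s) (arr_K (\<delta> i)) = arr_K (\<iota> i)" "Comp \<L> (arr_L s) (arr_L (\<delta> i)) = arr_L (\<iota> i)"
    if "i \<in> Obj I" for i
    using s(2)[OF that, symmetric] by (simp_all add: pspb_comp[OF fF fG])
  show "colimit I \<K> (comp_functor G_bar D) (obj_K X) (\<lambda>i. arr_K (\<iota> i))"
    by (rule colimit_cong[THEN iffD1, OF e(1) cI colimit_iso_apex[OF DK Y(2) sK]])
  show "colimit I \<L> (comp_functor F_bar D) (obj_L X) (\<lambda>i. arr_L (\<iota> i))"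
    by (rule colimit_cong[THEN iffD1, OF e(2) cI colimit_iso_apex[OF DL Y(3) sL]])
qed

text \<open>The components of an arrow into a filtered colimit factor through a common stage. The two ways
  around the comparisons are then parallel arrows \<open>F K \<rightarrow> G L'\<close> into a stage which agree in the colimit; as
  \<open>F K\<close> is presentable, they agree later.\<close>

lemma pspb_presentable:
  assumes mu: "Cinfinite mu" "lam \<le>o mu" and X: "X \<in> Obj PB"
    and K: "presentable \<kappa> mu \<K> (obj_K X)" and L: "presentable \<kappa> mu \<L> (obj_L X)"
    and FK: "presentable \<kappa> mu \<M> (obj_map F (obj_K X))"
  shows "presentable \<kappa> mu PB X"
proof (rule presentableI[OF \<kappa> mu(1) pspb_class_category X])
  note gK = G_bar_functor[OF fF fG] and gL = F_bar_functor[OF fF fG]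
  note cP = pspb_category[OF fF fG] and cM = functorD(2)[OF fF]
  note cK = functorD(1)[OF fF] and cL = functorD(1)[OF fG]
  fix I :: "('u, 'u) cat" and D Y \<iota>
  assume I: "small_filtered \<kappa> mu I" and D: "is_functor I PB D" and Y: "colimit I PB D Y \<iota>"
  note I' = small_filtered_mono[OF I mu(2)] and fI = small_filteredD(1)[OF I] and cI = functorD(1)[OF D]
  note DK = comp_functor_is_functor[OF D gK] and DL = comp_functor_is_functor[OF D gL]
  note colK = pspb_colimit_components(1)[OF I' D Y] and colL = pspb_colimit_components(2)[OF I' D Y]
  note colG = filtered_colimit_preserved[OF \<kappa> G'(5) I' DL colL]
  note stK = presentable_stagewise[OF \<kappa> mu(1) class_accessibleD(1)[OF F'(2)] K I DK colK]
  note stL = presentable_stagewise[OF \<kappa> mu(1) class_accessibleD(1)[OF G'(2)] L I DL colL]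
  note stG = presentable_stagewise[OF \<kappa> mu(1) class_accessibleD(1)[OF F'(3)] FK I
      comp_functor_is_functor[OF DL fG] colG]
  note \<iota> = coconeD(2)[OF colimit_imp_cocone[OF Y]] and Du = functorD(4)[OF D]
  note hK = pspb_homD(3)[OF fF fG] and hL = pspb_homD(4)[OF fF fG]
  have "\<exists>i \<in> Obj I. \<exists>y \<in> hom PB X (obj_map D i). Comp PB (\<iota> i) y = x" if x: "x \<in> hom PB X Y" for x
  proof -
    obtain i1 a where "i1 \<in> Obj I" "a \<in> hom \<K> (obj_K X) (obj_map (comp_functor G_bar D) i1)"
      and a': "Comp \<K> (arr_K (\<iota> i1)) a = arr_K x" using stagewise_factor[OF stK hK[OF x]] .
    then have i1: "i1 \<in> Obj I" and a: "a \<in> hom \<K> (obj_K X) (obj_K (obj_map D i1))" by simp_all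
    obtain i2 b where "i2 \<in> Obj I" "b \<in> hom \<L> (obj_L X) (obj_map (comp_functor F_bar D) i2)"
      and b': "Comp \<L> (arr_L (\<iota> i2)) b = arr_L x" using stagewise_factor[OF stL hL[OF x]] .
    then have i2: "i2 \<in> Obj I" and b: "b \<in> hom \<L> (obj_L X) (obj_L (obj_map D i2))" by simp_all
    obtain i u v where i: "i \<in> Obj I" and u: "u \<in> hom I i1 i" and v: "v \<in> hom I i2 i"
      using filtered_bound2[OF fI mu(1) i1 i2] .
    note Ku = hK[OF Du[OF u]] and Lv = hL[OF Du[OF v]]
    define a1 where "a1 = Comp \<K> (arr_K (arr_map D u)) a"
    define b1 where "b1 = Comp \<L> (arr_L (arr_map D v)) b"
    have a1: "a1 \<in> hom \<K> (obj_K X) (obj_K (obj_map D i))" unfolding a1_def by (rule comp_hom[OF cK a Ku])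
    have b1: "b1 \<in> hom \<L> (obj_L X) (obj_L (obj_map D i))" unfolding b1_def by (rule comp_hom[OF cL b Lv])
    have \<iota>a: "Comp \<K> (arr_K (\<iota> i)) a1 = arr_K x"
      unfolding a1_def using comp_assoc[OF cK a Ku hK[OF \<iota>[OF i]]] a'
        coconeD(3)[OF colimit_imp_cocone[OF colK] u] by simp
    have \<iota>b: "Comp \<L> (arr_L (\<iota> i)) b1 = arr_L x"
      unfolding b1_def using comp_assoc[OF cL b Lv hL[OF \<iota>[OF i]]] b'
        coconeD(3)[OF colimit_imp_cocone[OF colL] v] by simp
    note \<theta>X = comparison_hom[OF fF fG X] and \<theta>i = comparison_hom[OF fF fG functorD(3)[OF D i]]
    note Fa = functorD(4)[OF fF a1] and Gb = functorD(4)[OF fG b1]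
    note F\<iota> = functorD(4)[OF fF hK[OF \<iota>[OF i]]] and G\<iota> = functorD(4)[OF fG hL[OF \<iota>[OF i]]]
    note \<theta>Y = comparison_hom[OF fF fG coconeD(1)[OF colimit_imp_cocone[OF Y]]]
    have p1: "Comp \<M> (arr_map G b1) (comparison \<M> G X) \<in>
        hom \<M> (obj_map F (obj_K X)) (obj_map G (obj_L (obj_map D i)))" by (rule comp_hom[OF cM \<theta>X Gb])
    have p2: "Comp \<M> (comparison \<M> G (obj_map D i)) (arr_map F a1) \<in>
        hom \<M> (obj_map F (obj_K X)) (obj_map G (obj_L (obj_map D i)))" by (rule comp_hom[OF cM Fa \<theta>i])
    have "Comp \<M> (arr_map G (arr_L (\<iota> i))) (Comp \<M> (arr_map G b1) (comparison \<M> G X)) =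
        Comp \<M> (arr_map G (arr_L x)) (comparison \<M> G X)"
      using comp_assoc[OF cM \<theta>X Gb G\<iota>] functorD(6)[OF fG b1 hL[OF \<iota>[OF i]]] \<iota>b by simp
    also have "\<dots> = Comp \<M> (comparison \<M> G Y) (arr_map F (arr_K x))"
      by (rule pspb_hom_compatible[OF fF fG x])
    also have "\<dots> = Comp \<M> (Comp \<M> (comparison \<M> G Y) (arr_map F (arr_K (\<iota> i)))) (arr_map F a1)"
      using comp_assoc[OF cM Fa F\<iota> \<theta>Y] functorD(6)[OF fF a1 hK[OF \<iota>[OF i]]] \<iota>a by simp
    also have "\<dots> = Comp \<M> (arr_map G (arr_L (\<iota> i)))
        (Comp \<M> (comparison \<M> G (obj_map D i)) (arr_map F a1))"
      using pspb_hom_compatible[OF fF fG \<iota>[OF i]] comp_assoc[OF cM Fa \<theta>i G\<iota>] by simp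
    finally obtain j w where j: "j \<in> Obj I" "w \<in> hom I i j" and
      "Comp \<M> (arr_map (comp_functor G (comp_functor F_bar D)) w) (Comp \<M> (arr_map G b1) (comparison \<M> G X)) =
       Comp \<M> (arr_map (comp_functor G (comp_functor F_bar D)) w)
         (Comp \<M> (comparison \<M> G (obj_map D i)) (arr_map F a1))"
      using stagewise_equalize[OF stG i, of "Comp \<M> (arr_map G b1) (comparison \<M> G X)"
          "Comp \<M> (comparison \<M> G (obj_map D i)) (arr_map F a1)"] p1 p2
      unfolding comp_functor_simps bar_simps by blast
    then have w: "Comp \<M> (arr_map G (arr_L (arr_map D w))) (Comp \<M> (arr_map G b1) (comparison \<M> G X)) =
       Comp \<M> (arr_map G (arr_L (arr_map D w)))
         (Comp \<M> (comparison \<M> G (obj_map D i)) (arr_map F a1))" by simp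
    note Kw = hK[OF Du[OF j(2)]] and Lw = hL[OF Du[OF j(2)]]
    note Fw = functorD(4)[OF fF Kw] and Gw = functorD(4)[OF fG Lw]
    let ?a = "Comp \<K> (arr_K (arr_map D w)) a1" and ?b = "Comp \<L> (arr_L (arr_map D w)) b1"
    have "Comp \<M> (arr_map G ?b) (comparison \<M> G X) =
        Comp \<M> (arr_map G (arr_L (arr_map D w))) (Comp \<M> (comparison \<M> G (obj_map D i)) (arr_map F a1))"
      using functorD(6)[OF fG b1 Lw] comp_assoc[OF cM \<theta>X Gb Gw] w by simp
    also have "\<dots> = Comp \<M> (Comp \<M> (comparison \<M> G (obj_map D j)) (arr_map F (arr_K (arr_map D w))))
        (arr_map F a1)"
      using comp_assoc[OF cM Fa \<theta>i Gw] pspb_hom_compatible[OF fF fG Du[OF j(2)]] by simp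
    also have "\<dots> = Comp \<M> (comparison \<M> G (obj_map D j)) (arr_map F ?a)"
      using comp_assoc[OF cM Fa Fw comparison_hom[OF fF fG functorD(3)[OF D j(1)]]]
        functorD(6)[OF fF a1 Kw] by simp
    finally have ab: "Comp \<M> (arr_map G ?b) (comparison \<M> G X) =
      Comp \<M> (comparison \<M> G (obj_map D j)) (arr_map F ?a)" .
    obtain y where y: "y \<in> hom PB X (obj_map D j)" "arr_K y = ?a" "arr_L y = ?b"
      using pspb_hom_exists[OF fF fG X functorD(3)[OF D j(1)] comp_hom[OF cK a1 Kw] comp_hom[OF cL b1 Lw] ab] .
    have "Comp PB (\<iota> j) y = x"
    proof (rule pspb_hom_unique[OF fF fG comp_hom[OF cP y(1) \<iota>[OF j(1)]] x])
      show "arr_K (Comp PB (\<iota> j) y) = arr_K x"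
        using comp_assoc[OF cK a1 Kw hK[OF \<iota>[OF j(1)]]] coconeD(3)[OF colimit_imp_cocone[OF colK] j(2)] \<iota>a y(2)
        by (simp add: pspb_comp[OF fF fG])
      show "arr_L (Comp PB (\<iota> j) y) = arr_L x"
        using comp_assoc[OF cL b1 Lw hL[OF \<iota>[OF j(1)]]] coconeD(3)[OF colimit_imp_cocone[OF colL] j(2)] \<iota>b y(3)
        by (simp add: pspb_comp[OF fF fG])
    qed
    then show ?thesis using j(1) y(1) by blast
  qed
  moreover have "\<exists>j \<in> Obj I. \<exists>u \<in> hom I i j. Comp PB (arr_map D u) y = Comp PB (arr_map D u) z"
    if i: "i \<in> Obj I" and y: "y \<in> hom PB X (obj_map D i)" and z: "z \<in> hom PB X (obj_map D i)"
      and eq: "Comp PB (\<iota> i) y = Comp PB (\<iota> i) z" for i y z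
  proof -
    have eK: "Comp \<K> (arr_K (\<iota> i)) (arr_K y) = Comp \<K> (arr_K (\<iota> i)) (arr_K z)"
      and eL: "Comp \<L> (arr_L (\<iota> i)) (arr_L y) = Comp \<L> (arr_L (\<iota> i)) (arr_L z)"
      using arg_cong[OF eq, of arr_K] arg_cong[OF eq, of arr_L] by (simp_all add: pspb_comp[OF fF fG])
    obtain j1 u1 where u1: "u1 \<in> hom I i j1"
      "Comp \<K> (arr_K (arr_map D u1)) (arr_K y) = Comp \<K> (arr_K (arr_map D u1)) (arr_K z)"
      using stagewise_equalize[OF stK i _ _ eK] hK[OF y] hK[OF z] unfolding comp_functor_simps bar_simps
      by blast
    obtain j2 u2 where u2: "u2 \<in> hom I i j2"
      "Comp \<L> (arr_L (arr_map D u2)) (arr_L y) = Comp \<L> (arr_L (arr_map D u2)) (arr_L z)"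
      using stagewise_equalize[OF stL i _ _ eL] hL[OF y] hL[OF z] unfolding comp_functor_simps bar_simps
      by blast
    let ?j = "\<lambda>b. if b then j1 else j2" and ?u = "\<lambda>b. if b then u1 else u2"
    have "\<exists>k w v. w \<in> hom I i k \<and> (\<forall>s \<in> UNIV. v s \<in> hom I (?j s) k \<and> Comp I (v s) (?u s) = w)"
      by (rule filtered_span[OF fI mu(1) i, of UNIV ?u ?j])
        (auto simp: u1(1) u2(1) intro: card_less_finite[OF mu(1)])
    then obtain k w v where w: "w \<in> hom I i k" and v: "\<And>s. v s \<in> hom I (?j s) k \<and> Comp I (v s) (?u s) = w"
      by blast
    have v1: "v True \<in> hom I j1 k" "w = Comp I (v True) u1" using v[of True] by auto
    have v2: "v False \<in> hom I j2 k" "w = Comp I (v False) u2" using v[of False] by auto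
    have "Comp PB (arr_map D w) y = Comp PB (arr_map D w) z"
    proof (rule pspb_hom_unique[OF fF fG comp_hom[OF cP y Du[OF w]] comp_hom[OF cP z Du[OF w]]])
      have wK: "arr_K (arr_map D w) = Comp \<K> (arr_K (arr_map D (v True))) (arr_K (arr_map D u1))"
        unfolding v1(2) functorD(6)[OF D u1(1) v1(1)] by (simp add: pspb_comp[OF fF fG])
      note h = hK[OF Du[OF u1(1)]] hK[OF Du[OF v1(1)]]
      show "arr_K (Comp PB (arr_map D w) y) = arr_K (Comp PB (arr_map D w) z)"
        using comp_assoc[OF cK hK[OF y] h] comp_assoc[OF cK hK[OF z] h] u1(2) wK
        by (simp add: pspb_comp[OF fF fG])
      have wL: "arr_L (arr_map D w) = Comp \<L> (arr_L (arr_map D (v False))) (arr_L (arr_map D u2))"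
        unfolding v2(2) functorD(6)[OF D u2(1) v2(1)] by (simp add: pspb_comp[OF fF fG])
      note h' = hL[OF Du[OF u2(1)]] hL[OF Du[OF v2(1)]]
      show "arr_L (Comp PB (arr_map D w) y) = arr_L (Comp PB (arr_map D w) z)"
        using comp_assoc[OF cL hL[OF y] h'] comp_assoc[OF cL hL[OF z] h'] u2(2) wL
        by (simp add: pspb_comp[OF fF fG])
    qed
    then show ?thesis using hom_objD(2)[OF cI w] w by blast
  qed
  ultimately show "stagewise PB I D Y \<iota> X" unfolding stagewise_def by blast
qed

text \<open>The systems exhausting the two components of an object are interleaved. The colimits of the
  chains in the interleaved system form pseudopullback objects, because along a chain the comparisons
  back and forth become mutually inverse in the colimit, and they exhaust both components because
  the interleaved system is cofinal in each of the two given ones.\<close>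

lemma pspb_approximation:
  assumes X: "X \<in> Obj PB"
  obtains I :: "('u, 'u) cat" and D \<iota> where
    "filtered_diagram \<kappa> (cardSuc lam) I PB D" "colimit I PB D X \<iota>"
    "\<And>i. i \<in> Obj I \<Longrightarrow> presentable \<kappa> (cardSuc lam) \<K> (obj_K (obj_map D i))"
    "\<And>i. i \<in> Obj I \<Longrightarrow> presentable \<kappa> (cardSuc lam) \<L> (obj_L (obj_map D i))"
    "\<And>i. i \<in> Obj I \<Longrightarrow> presentable \<kappa> (cardSuc lam) \<M> (obj_map F (obj_K (obj_map D i)))"
proof -
  note cK = class_accessibleD(1)[OF F'(2)] and cL = class_accessibleD(1)[OF G'(2)]
    and cM = class_accessibleD(1)[OF F'(3)]
  note catM = functorD(2)[OF fF]
  note o = pspb_objD[OF fF fG X]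
  have mu: "Cinfinite (cardSuc lam)" by (rule Cinfinite_cardSuc[OF lam(1)])
  have le: "lam \<le>o cardSuc lam" using lam(1) by (simp add: cardSuc_ordLeq)
  let ?h = "comparison \<M> G X" and ?h' = "comparison_inv \<M> F X"
  note h = comparison_iso[OF fF fG X]
  obtain V :: "'u set set" and ltV A a \<alpha> where V: "small \<kappa> V" "strictly_directed lam V ltV"
    "system \<K> V ltV A a (obj_K X) \<alpha>"
    and pA: "\<And>v. v \<in> V \<Longrightarrow> presentable \<kappa> lam \<K> (A v)"
    and stA: "\<And>B. presentable \<kappa> lam \<K> B \<Longrightarrow> system_stagewise \<K> V ltV A a (obj_K X) \<alpha> B"
    and stFA: "\<And>B. presentable \<kappa> lam \<M> B \<Longrightarrow> system_stagewise \<M> V ltV (\<lambda>v. obj_map F (A v))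
      (\<lambda>v w. arr_map F (a v w)) (obj_map F (obj_K X)) (\<lambda>v. arr_map F (\<alpha> v)) B"
    by (rule accessible_system[OF \<kappa> lam(1,2) F'(1) o(1)]) (rule that, assumption+)
  obtain W :: "'u set set" and ltW B b \<beta> where W: "small \<kappa> W" "strictly_directed lam W ltW"
    "system \<L> W ltW B b (obj_L X) \<beta>"
    and pB: "\<And>w. w \<in> W \<Longrightarrow> presentable \<kappa> lam \<L> (B w)"
    and stB: "\<And>Z. presentable \<kappa> lam \<L> Z \<Longrightarrow> system_stagewise \<L> W ltW B b (obj_L X) \<beta> Z"
    and stGB: "\<And>Z. presentable \<kappa> lam \<M> Z \<Longrightarrow> system_stagewise \<M> W ltW (\<lambda>w. obj_map G (B w))
      (\<lambda>v w. arr_map G (b v w)) (obj_map G (obj_L X)) (\<lambda>w. arr_map G (\<beta> w)) Z"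
    by (rule accessible_system[OF \<kappa> lam(1,2) G'(1) o(2)]) (rule that, assumption+)
  note sFA = functor_system[OF fF V(3)] and sGB = functor_system[OF fG W(3)]
  \<comment> \<open>The interleaved system, projected to both factors by \<open>\<pi>\<close> and \<open>\<rho>\<close>.\<close>
  define U where "U = interleavings \<M> V (\<lambda>v. obj_map F (A v)) (\<lambda>v. arr_map F (\<alpha> v))
    W (\<lambda>w. obj_map G (B w)) (\<lambda>w. arr_map G (\<beta> w)) ?h"
  define lt where "lt = interleaved_lt \<M> ltV (\<lambda>v. obj_map F (A v)) (\<lambda>v w. arr_map F (a v w))
    ltW (\<lambda>w. obj_map G (B w)) (\<lambda>v w. arr_map G (b v w))"
  define \<pi> where "\<pi> u = fst u" for u :: "'u set \<times> 'u set \<times> 'mm"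
  define \<rho> where "\<rho> u = fst (snd u)" for u :: "'u set \<times> 'u set \<times> 'mm"
  define \<phi> where "\<phi> u = snd (snd u)" for u :: "'u set \<times> 'u set \<times> 'mm"
  have UD: "\<pi> u \<in> V" "\<rho> u \<in> W" "\<phi> u \<in> hom \<M> (obj_map F (A (\<pi> u))) (obj_map G (B (\<rho> u)))"
    "Comp \<M> (arr_map G (\<beta> (\<rho> u))) (\<phi> u) = Comp \<M> ?h (arr_map F (\<alpha> (\<pi> u)))" if "u \<in> U" for u
    using that unfolding U_def interleavings_def \<pi>_def \<rho>_def \<phi>_def by auto
  have ltD: "ltV (\<pi> u) (\<pi> v)" "ltW (\<rho> u) (\<rho> v)"
    "\<exists>\<psi> \<in> hom \<M> (obj_map G (B (\<rho> u))) (obj_map F (A (\<pi> v))).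
      Comp \<M> \<psi> (\<phi> u) = arr_map F (a (\<pi> u) (\<pi> v)) \<and> Comp \<M> (\<phi> v) \<psi> = arr_map G (b (\<rho> u) (\<rho> v))"
    if "lt u v" for u v
    using that unfolding lt_def interleaved_lt_def \<pi>_def \<rho>_def \<phi>_def by (auto simp: split_beta)
  have bound: "\<exists>u \<in> U. ltV v (\<pi> u) \<and> ltW w (\<rho> u) \<and> (\<forall>s \<in> S. lt s u)"
    if S: "S \<subseteq> U" "|S| <o lam" and v: "v \<in> V" and w: "w \<in> W" for S v w
  proof -
    have "\<exists>v' w' \<phi>'. (v', w', \<phi>') \<in> U \<and> ltV v v' \<and> ltW w w' \<and> (\<forall>s \<in> S. lt s (v', w', \<phi>'))"
      unfolding U_def lt_def
      by (rule interleavings_bound[OF lam(1) V(2) W(2) sFA sGB h])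
        (use S v w pA pB F'(6) G'(6) stFA stGB in \<open>simp_all add: U_def\<close>)
    then obtain v' w' \<phi>' where "(v', w', \<phi>') \<in> U" "ltV v v'" "ltW w w'" "\<forall>s \<in> S. lt s (v', w', \<phi>')"
      by blast
    then show ?thesis by (intro bexI[of _ "(v', w', \<phi>')"]) (simp_all add: \<pi>_def \<rho>_def)
  qed
  obtain v0 where v0: "v0 \<in> V"
    by (rule strictly_directed_bound[OF V(2), of "{}"]) (auto intro: card_less_finite[OF lam(1)])
  obtain w0 where w0: "w0 \<in> W"
    by (rule strictly_directed_bound[OF W(2), of "{}"]) (auto intro: card_less_finite[OF lam(1)])
  have dU: "strictly_directed lam U lt"
    unfolding strictly_directed_def
  proof (intro conjI ballI allI impI)
    show "lt x z" if "x \<in> U" "y \<in> U" "z \<in> U" "lt x y" "lt y z" for x y z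
      using interleaved_lt_trans[OF V(2) W(2) sFA sGB] that unfolding U_def lt_def by blast
    show "\<exists>u \<in> U. \<forall>s \<in> S. lt s u" if "S \<subseteq> U" "|S| <o lam" for S
      using bound[OF that v0 w0] by blast
  qed
  have sU: "small \<kappa> U" unfolding U_def by (rule small_interleavings[OF \<kappa> cM V(1) W(1) sFA sGB])
  have one: "|{u}| <o lam" for u :: "'u set \<times> 'u set \<times> 'mm"
    by (rule card_less_finite[OF lam(1)]) simp
  have none: "|{} :: ('u set \<times> 'u set \<times> 'mm) set| <o lam"
    by (rule card_less_finite[OF lam(1)]) simp
  have sysK: "system \<K> U lt (\<lambda>u. A (\<pi> u)) (\<lambda>u v. a (\<pi> u) (\<pi> v)) (obj_K X) (\<lambda>u. \<alpha> (\<pi> u))"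
    by (rule system_pullback[OF V(3)]) (use UD(1) ltD(1) in auto)
  have sysL: "system \<L> U lt (\<lambda>u. B (\<rho> u)) (\<lambda>u v. b (\<rho> u) (\<rho> v)) (obj_L X) (\<lambda>u. \<beta> (\<rho> u))"
    by (rule system_pullback[OF W(3)]) (use UD(2) ltD(2) in auto)
  have stK: "system_stagewise \<K> U lt (\<lambda>u. A (\<pi> u)) (\<lambda>u v. a (\<pi> u) (\<pi> v)) (obj_K X) (\<lambda>u. \<alpha> (\<pi> u)) Z"
    if Z: "presentable \<kappa> lam \<K> Z" for Z
  proof (rule system_stagewise_pullback[OF V(3) stA[OF Z]])
    show "\<exists>w \<in> U. ltV v (\<pi> w)" if "v \<in> V" for v using bound[OF _ none that w0] by blast
    show "\<exists>w' \<in> U. lt w w' \<and> ltV v (\<pi> w')" if "w \<in> U" "v \<in> V" for w v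
      using bound[OF _ one[of w] that(2) w0] that(1) by blast
  qed (use UD(1) ltD(1) in auto)
  have stL: "system_stagewise \<L> U lt (\<lambda>u. B (\<rho> u)) (\<lambda>u v. b (\<rho> u) (\<rho> v)) (obj_L X) (\<lambda>u. \<beta> (\<rho> u)) Z"
    if Z: "presentable \<kappa> lam \<L> Z" for Z
  proof (rule system_stagewise_pullback[OF W(3) stB[OF Z]])
    show "\<exists>w \<in> U. ltW v (\<rho> w)" if "v \<in> W" for v using bound[OF _ none v0 that] by blast
    show "\<exists>w' \<in> U. lt w w' \<and> ltW v (\<rho> w')" if "w \<in> U" "v \<in> W" for w v
      using bound[OF _ one[of w] v0 that(2)] that(1) by blast
  qed (use UD(2) ltD(2) in auto)
  \<comment> \<open>Colimits of the chains in both factors, compared by \<open>\<theta>\<close>.\<close>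
  let ?T = "chains lam U lt"
  let ?I = "thin ?T (chain_le lam lt)"
  let ?J = "chain_index lam"
  obtain NK lK \<nu>K mK where NK: "chain_colimits lam \<K> U lt (\<lambda>u. A (\<pi> u)) (\<lambda>u v. a (\<pi> u) (\<pi> v))
      (obj_K X) (\<lambda>u. \<alpha> (\<pi> u)) NK lK \<nu>K mK"
    by (rule chain_colimits_exist[OF lam(1,2) dU sysK \<kappa> lam(3) class_accessibleD(3)[OF F'(2)]])
  obtain NL lL \<nu>L mL where NL: "chain_colimits lam \<L> U lt (\<lambda>u. B (\<rho> u)) (\<lambda>u v. b (\<rho> u) (\<rho> v))
      (obj_L X) (\<lambda>u. \<beta> (\<rho> u)) NL lL \<nu>L mL"
    by (rule chain_colimits_exist[OF lam(1,2) dU sysL \<kappa> lam(3) class_accessibleD(3)[OF G'(2)]])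
  note nK = chain_colimitsD[OF lam(1,2) dU sysK NK] and nL = chain_colimitsD[OF lam(1,2) dU sysL NL]
  define DA where "DA w = chain_diagram \<K> (\<lambda>u. A (\<pi> u)) (\<lambda>u v. a (\<pi> u) (\<pi> v)) w" for w :: "'r \<Rightarrow> _"
  define DB where "DB w = chain_diagram \<L> (\<lambda>u. B (\<rho> u)) (\<lambda>u v. b (\<rho> u) (\<rho> v)) w" for w :: "'r \<Rightarrow> _"
  have fA: "is_functor ?J \<K> (DA w)" and cA: "colimit ?J \<K> (DA w) (NK w) (lK w)"
    and fB: "is_functor ?J \<L> (DB w)" and cB: "colimit ?J \<L> (DB w) (NL w) (lL w)" if "w \<in> ?T" for w
    using chain_diagram_functor[OF lam(1,2) dU sysK that] nK(1)[OF that]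
      chain_diagram_functor[OF lam(1,2) dU sysL that] nL(1)[OF that] unfolding DA_def DB_def by blast+
  note J = small_filtered_chain_index[OF \<kappa> lam]
  note cFA = filtered_colimit_preserved[OF \<kappa> F'(5) J fA cA]
    and cGB = filtered_colimit_preserved[OF \<kappa> G'(5) J fB cB]
  have fFA: "is_functor ?J \<M> (comp_functor F (DA w))" and fGB: "is_functor ?J \<M> (comp_functor G (DB w))"
    if "w \<in> ?T" for w
    using comp_functor_is_functor[OF fA[OF that] fF] comp_functor_is_functor[OF fB[OF that] fG] .
  have "\<exists>\<theta> \<theta>'. mutually_inverse \<M> (obj_map F (NK w)) (obj_map G (NL w)) \<theta> \<theta>' \<and>
      (\<forall>p \<in> Field lam. Comp \<M> \<theta> (arr_map F (lK w p)) = Comp \<M> (arr_map G (lL w p)) (\<phi> (w p)))"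
    if w: "w \<in> ?T" for w
  proof (rule chain_comparison[OF \<kappa> lam F'(3) fFA[OF w] fGB[OF w] cFA[OF w w] cGB[OF w w]])
    show "\<phi> (w p) \<in> hom \<M> (obj_map (comp_functor F (DA w)) p) (obj_map (comp_functor G (DB w)) p)"
      if "p \<in> Field lam" for p
      using UD(3)[OF chainsD(1)[OF w that]] by (simp add: DA_def DB_def)
    show "\<exists>\<psi> \<in> hom \<M> (obj_map (comp_functor G (DB w)) p) (obj_map (comp_functor F (DA w)) q).
        Comp \<M> \<psi> (\<phi> (w p)) = arr_map (comp_functor F (DA w)) (p, q) \<and>
        Comp \<M> (\<phi> (w q)) \<psi> = arr_map (comp_functor G (DB w)) (p, q)"
      if "(p, q) \<in> lam" "p \<noteq> q" for p q
      using ltD(3)[OF chainsD(2)[OF w that]] that(2) by (simp add: DA_def DB_def)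
  qed
  then obtain \<theta> \<theta>' where \<theta>: "\<And>w. w \<in> ?T \<Longrightarrow>
      mutually_inverse \<M> (obj_map F (NK w)) (obj_map G (NL w)) (\<theta> w) (\<theta>' w)"
    and \<theta>_leg: "\<And>w p. w \<in> ?T \<Longrightarrow> p \<in> Field lam \<Longrightarrow>
      Comp \<M> (\<theta> w) (arr_map F (lK w p)) = Comp \<M> (arr_map G (lL w p)) (\<phi> (w p))" by metis
  note \<theta>h = mutually_inverseD(1)[OF \<theta>]
  have UT: "w p \<in> U" if "w \<in> ?T" "p \<in> Field lam" for w p by (rule chainsD(1)[OF that])
  note Fl = functorD(4)[OF fF nK(6)] and Gl = functorD(4)[OF fG nL(6)]
  let ?DK = "chain_functor NK mK" and ?DL = "chain_functor NL mL"
  have DK: "is_functor ?I \<K> ?DK" by (rule chain_functor_is_functor[OF lam(1,2) dU sysK NK])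
  have DL: "is_functor ?I \<L> ?DL" by (rule chain_functor_is_functor[OF lam(1,2) dU sysL NL])
  have nat: "Comp \<M> (arr_map G (arr_map ?DL t)) (\<theta> v) = Comp \<M> (\<theta> w) (arr_map F (arr_map ?DK t))"
    if "t \<in> hom ?I v w" for v w t
  proof -
    have t: "t = (v, w)" and v: "v \<in> ?T" and w: "w \<in> ?T" and vw: "chain_le lam lt v w"
      using that by (simp_all add: hom_thin)
    note mKh = functorD(4)[OF fF nK(4)[OF v w vw]] and mLh = functorD(4)[OF fG nL(4)[OF v w vw]]
    have "Comp \<M> (arr_map G (mL v w)) (\<theta> v) = Comp \<M> (\<theta> w) (arr_map F (mK v w))"
    proof (rule colimit_ext[OF fFA[OF v] cFA[OF v v] comp_hom[OF catM \<theta>h[OF v] mLh]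
          comp_hom[OF catM mKh \<theta>h[OF w]]])
      fix p assume "p \<in> Obj ?J"
      then have p: "p \<in> Field lam" by simp
      obtain q where q: "q \<in> Field lam" "lt (v p) (w q)" using vw p unfolding chain_le_def by blast
      note vp = UT[OF v p] and wq = UT[OF w q(1)]
      obtain \<psi> where \<psi>: "\<psi> \<in> hom \<M> (obj_map G (B (\<rho> (v p)))) (obj_map F (A (\<pi> (w q))))"
        "Comp \<M> \<psi> (\<phi> (v p)) = arr_map F (a (\<pi> (v p)) (\<pi> (w q)))"
        "Comp \<M> (\<phi> (w q)) \<psi> = arr_map G (b (\<rho> (v p)) (\<rho> (w q)))" using ltD(3)[OF q(2)] by blast
      note av = systemD(4)[OF sysK vp wq q(2)] and bv = systemD(4)[OF sysL vp wq q(2)]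
      note Fa = functorD(4)[OF fF av] and Gb = functorD(4)[OF fG bv]
      note \<phi>v = UD(3)[OF vp] and \<phi>w = UD(3)[OF wq]
      have sq: "Comp \<M> (\<phi> (w q)) (arr_map F (a (\<pi> (v p)) (\<pi> (w q)))) =
          Comp \<M> (arr_map G (b (\<rho> (v p)) (\<rho> (w q)))) (\<phi> (v p))"
        using comp_assoc[OF catM \<phi>v \<psi>(1) \<phi>w] \<psi>(2,3) by simp
      have "Comp \<M> (Comp \<M> (arr_map G (mL v w)) (\<theta> v)) (arr_map F (lK v p)) =
          Comp \<M> (arr_map G (mL v w)) (Comp \<M> (arr_map G (lL v p)) (\<phi> (v p)))"
        using comp_assoc[OF catM Fl[OF v p] \<theta>h[OF v] mLh] \<theta>_leg[OF v p] by simp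
      also have "\<dots> = Comp \<M> (arr_map G (Comp \<L> (mL v w) (lL v p))) (\<phi> (v p))"
        using comp_assoc[OF catM \<phi>v Gl[OF v p] mLh] functorD(6)[OF fG nL(6)[OF v p] nL(4)[OF v w vw]]
        by simp
      also have "\<dots> = Comp \<M> (arr_map G (lL w q)) (Comp \<M> (arr_map G (b (\<rho> (v p)) (\<rho> (w q)))) (\<phi> (v p)))"
        using nL(5)[OF v w vw p q] functorD(6)[OF fG bv nL(6)[OF w q(1)]]
          comp_assoc[OF catM \<phi>v Gb Gl[OF w q(1)]] by simp
      also have "\<dots> = Comp \<M> (Comp \<M> (arr_map G (lL w q)) (\<phi> (w q))) (arr_map F (a (\<pi> (v p)) (\<pi> (w q))))"
        using sq comp_assoc[OF catM Fa \<phi>w Gl[OF w q(1)]] by simp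
      also have "\<dots> = Comp \<M> (\<theta> w) (Comp \<M> (arr_map F (lK w q)) (arr_map F (a (\<pi> (v p)) (\<pi> (w q)))))"
        using \<theta>_leg[OF w q(1)] comp_assoc[OF catM Fa Fl[OF w q(1)] \<theta>h[OF w]] by simp
      also have "\<dots> = Comp \<M> (\<theta> w) (arr_map F (Comp \<K> (mK v w) (lK v p)))"
        using nK(5)[OF v w vw p q] functorD(6)[OF fF av nK(6)[OF w q(1)]] by simp
      also have "\<dots> = Comp \<M> (Comp \<M> (\<theta> w) (arr_map F (mK v w))) (arr_map F (lK v p))"
        using functorD(6)[OF fF nK(6)[OF v p] nK(4)[OF v w vw]] comp_assoc[OF catM Fl[OF v p] mKh \<theta>h[OF w]]
        by simp
      finally show "Comp \<M> (Comp \<M> (arr_map G (mL v w)) (\<theta> v)) (arr_map F (lK v p)) =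
        Comp \<M> (Comp \<M> (\<theta> w) (arr_map F (mK v w))) (arr_map F (lK v p))" .
    qed
    then show ?thesis by (simp add: t chain_functor_def)
  qed
  have \<theta>I: "mutually_inverse \<M> (obj_map F (obj_map ?DK w)) (obj_map G (obj_map ?DL w)) (\<theta> w) (\<theta>' w)"
    if "w \<in> Obj ?I" for w
    using \<theta>[of w] that by (simp add: chain_functor_def)
  \<comment> \<open>The diagram of the chains in the pseudopullback and its cocone to \<open>X\<close>.\<close>
  define D where "D = pair_functor \<M> G ?I ?DK ?DL \<theta>"
  have D: "is_functor ?I PB D"
    unfolding D_def by (rule pair_functor_is_functor(1)[OF fF fG DK DL \<theta>I nat])
  have cD: "comparison \<M> G (obj_map D w) = \<theta> w" if "w \<in> ?T" for w
    unfolding D_def by (rule pair_functor_is_functor(2)[OF fF fG DK DL \<theta>I nat]) (simp_all add: that)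
  have DKL: "comp_functor G_bar D = ?DK" "comp_functor F_bar D = ?DL"
    "obj_K (obj_map D w) = NK w" "obj_L (obj_map D w) = NL w" for w
    unfolding D_def pair_functor_simps[OF fF fG] by (simp_all add: chain_functor_def)
  have kK: "cocone ?I \<K> ?DK (obj_K X) \<nu>K" by (rule chain_functor_cocone[OF lam(1,2) dU sysK NK])
  have kL: "cocone ?I \<L> ?DL (obj_L X) \<nu>L" by (rule chain_functor_cocone[OF lam(1,2) dU sysL NL])
  have compat: "Comp \<M> ?h (arr_map F (\<nu>K w)) = Comp \<M> (arr_map G (\<nu>L w)) (comparison \<M> G (obj_map D w))"
    if "w \<in> Obj ?I" for w
  proof -
    have w: "w \<in> ?T" using that by simp
    note F\<nu> = functorD(4)[OF fF nK(2)[OF w]] and G\<nu> = functorD(4)[OF fG nL(2)[OF w]]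
    note hh = mutually_inverseD(1)[OF h]
    show ?thesis
      unfolding cD[OF w]
    proof (rule colimit_ext[OF fFA[OF w] cFA[OF w w] comp_hom[OF catM F\<nu> hh] comp_hom[OF catM \<theta>h[OF w] G\<nu>]])
      fix p assume "p \<in> Obj ?J"
      then have p: "p \<in> Field lam" by simp
      note wp = UT[OF w p]
      have "Comp \<M> (Comp \<M> ?h (arr_map F (\<nu>K w))) (arr_map F (lK w p)) = Comp \<M> ?h (arr_map F (\<alpha> (\<pi> (w p))))"
        using comp_assoc[OF catM Fl[OF w p] F\<nu> hh] functorD(6)[OF fF nK(6)[OF w p] nK(2)[OF w]] nK(3)[OF w p]
        by simp
      also have "\<dots> = Comp \<M> (arr_map G (Comp \<L> (\<nu>L w) (lL w p))) (\<phi> (w p))"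
        using UD(4)[OF wp] nL(3)[OF w p] by simp
      also have "\<dots> = Comp \<M> (arr_map G (\<nu>L w)) (Comp \<M> (arr_map G (lL w p)) (\<phi> (w p)))"
        using functorD(6)[OF fG nL(6)[OF w p] nL(2)[OF w]] comp_assoc[OF catM UD(3)[OF wp] Gl[OF w p] G\<nu>]
        by simp
      also have "\<dots> = Comp \<M> (Comp \<M> (arr_map G (\<nu>L w)) (\<theta> w)) (arr_map F (lK w p))"
        using \<theta>_leg[OF w p] comp_assoc[OF catM Fl[OF w p] \<theta>h[OF w] G\<nu>] by simp
      finally show "Comp \<M> (Comp \<M> ?h (arr_map F (\<nu>K w))) (arr_map F (lK w p)) =
          Comp \<M> (Comp \<M> (arr_map G (\<nu>L w)) (\<theta> w)) (arr_map F (lK w p))" .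
    qed
  qed
  have "\<exists>\<iota>. cocone ?I PB D X \<iota> \<and> (\<forall>i \<in> Obj ?I. arr_K (\<iota> i) = \<nu>K i \<and> arr_L (\<iota> i) = \<nu>L i)"
    by (rule pspb_cocone_exists[OF fF fG D X kK[folded DKL] kL[folded DKL] compat])
  then obtain \<iota> where \<iota>: "cocone ?I PB D X \<iota>"
    "\<And>i. i \<in> Obj ?I \<Longrightarrow> arr_K (\<iota> i) = \<nu>K i" "\<And>i. i \<in> Obj ?I \<Longrightarrow> arr_L (\<iota> i) = \<nu>L i" by blast
  have I: "small_filtered \<kappa> (cardSuc lam) ?I" by (rule small_filtered_chains[OF \<kappa> lam dU sU])
  note I' = small_filtered_mono[OF I le] and catI = small_filteredD(2)[OF I]
  have colK: "colimit ?I \<K> ?DK (obj_K X) \<nu>K"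
    by (rule stagewise_imp_colimit[OF \<kappa> lam(1) F'(2) I' DK kK])
      (rule chain_functor_stagewise[OF lam(1,2) dU sysK \<kappa> lam(3) cK NK _ stK])
  have colL: "colimit ?I \<L> ?DL (obj_L X) \<nu>L"
    by (rule stagewise_imp_colimit[OF \<kappa> lam(1) G'(2) I' DL kL])
      (rule chain_functor_stagewise[OF lam(1,2) dU sysL \<kappa> lam(3) cL NL _ stL])
  have col: "colimit ?I PB D X \<iota>"
  proof (rule pspb_colimitI[OF fF fG D \<iota>(1)])
    show "colimit ?I \<K> (comp_functor G_bar D) (obj_K X) (\<lambda>i. arr_K (\<iota> i))"
      unfolding DKL by (rule colimit_cong[THEN iffD2, OF \<iota>(2) catI colK])
    show "colimit ?I \<L> (comp_functor F_bar D) (obj_L X) (\<lambda>i. arr_L (\<iota> i))"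
      unfolding DKL by (rule colimit_cong[THEN iffD2, OF \<iota>(3) catI colL])
    show "colimit ?I \<M> (comp_functor F (comp_functor G_bar D)) (obj_map F (obj_K X))
        (\<lambda>i. arr_map F (arr_K (\<iota> i)))"
      unfolding DKL
      by (rule colimit_cong[THEN iffD2, OF _ catI filtered_colimit_preserved[OF \<kappa> F'(5) I' DK colK]])
        (simp add: \<iota>(2))
  qed
  \<comment> \<open>Each approximating object is a colimit of only \<open>lam\<close> many \<open>lam\<close>-presentable objects.\<close>
  have pres: "presentable \<kappa> (cardSuc lam) \<K> (NK w)" "presentable \<kappa> (cardSuc lam) \<L> (NL w)"
    "presentable \<kappa> (cardSuc lam) \<M> (obj_map F (NK w))" if w: "w \<in> ?T" for w
  proof -
    have pA': "presentable \<kappa> lam \<K> (obj_map (DA w) p)" and pB': "presentable \<kappa> lam \<L> (obj_map (DB w) p)"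
      if "p \<in> Obj ?J" for p
      using pA[OF UD(1)[OF UT[OF w]]] pB[OF UD(2)[OF UT[OF w]]] that by (simp_all add: DA_def DB_def)
    show "presentable \<kappa> (cardSuc lam) \<K> (NK w)"
      by (rule presentable_colimit[OF \<kappa> mu cK fA[OF w] card_chain_index[OF lam(1)]
            presentable_mono[OF \<kappa> lam(1) mu le cK pA'] cA[OF w]])
    show "presentable \<kappa> (cardSuc lam) \<L> (NL w)"
      by (rule presentable_colimit[OF \<kappa> mu cL fB[OF w] card_chain_index[OF lam(1)]
            presentable_mono[OF \<kappa> lam(1) mu le cL pB'] cB[OF w]])
    show "presentable \<kappa> (cardSuc lam) \<M> (obj_map F (NK w))"
      by (rule presentable_colimit[OF \<kappa> mu cM fFA[OF w] card_chain_index[OF lam(1)] _ cFA[OF w w]])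
        (simp add: presentable_mono[OF \<kappa> lam(1) mu le cM F'(6)[OF pA']])
  qed
  obtain R and I0 :: "('u, 'u) cat" where R: "reindexing I0 ?I R"
    "filtered_diagram \<kappa> (cardSuc lam) I0 PB (comp_functor D R)"
    using small_filtered_reindexing[OF \<kappa> I D] by metis
  have Rob: "obj_map R i \<in> ?T" if "i \<in> Obj I0" for i
    using R(1) that functorD(3)[of I0 ?I R] unfolding reindexing_def by simp
  show thesis
  proof (rule that[OF R(2)])
    show "colimit I0 PB (comp_functor D R) X (\<lambda>i. \<iota> (obj_map R i))"
      using reindexing_colimit_iff[OF R(1)] col by (rule iffD2)
  qed (simp_all add: DKL pres[OF Rob])
qed

lemma pspb_class_accessible: "class_accessible \<kappa> (cardSuc lam) PB"
  unfolding class_accessible_def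
proof (intro conjI exI[of _ "{A \<in> Obj PB. presentable \<kappa> (cardSuc lam) PB A}"] ballI)
  have mu: "Cinfinite (cardSuc lam)" by (rule Cinfinite_cardSuc[OF lam(1)])
  have le: "lam \<le>o cardSuc lam" using lam(1) by (simp add: cardSuc_ordLeq)
  let ?\<A> = "{A \<in> Obj PB. presentable \<kappa> (cardSuc lam) PB A}"
  show "class_category \<kappa> PB" by (rule pspb_class_category)
  show "has_filtered_colimits \<kappa> (cardSuc lam) PB"
    unfolding has_filtered_colimits_def filtered_diagram_iff
    using pspb_filtered_colimit small_filtered_mono[OF _ le] by metis
  show "class_sized \<kappa> ?\<A>"
    by (rule class_sized_subset[of ?\<A> "Obj PB"])
      (use pspb_class_category in \<open>auto simp: class_category_def\<close>)
  show "presentable \<kappa> (cardSuc lam) PB A" if "A \<in> ?\<A>" for A using that by simp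
  fix X assume X: "X \<in> Obj PB"
  obtain I :: "('u, 'u) cat" and D \<iota> where D: "filtered_diagram \<kappa> (cardSuc lam) I PB D" "colimit I PB D X \<iota>"
    "\<And>i. i \<in> Obj I \<Longrightarrow> presentable \<kappa> (cardSuc lam) \<K> (obj_K (obj_map D i))"
    "\<And>i. i \<in> Obj I \<Longrightarrow> presentable \<kappa> (cardSuc lam) \<L> (obj_L (obj_map D i))"
    "\<And>i. i \<in> Obj I \<Longrightarrow> presentable \<kappa> (cardSuc lam) \<M> (obj_map F (obj_K (obj_map D i)))"
    by (rule pspb_approximation[OF X]) (rule that, assumption+)
  have fD: "is_functor I PB D" using D(1) by (simp add: filtered_diagram_iff)
  have "obj_map D i \<in> ?\<A>" if i: "i \<in> Obj I" for i
    using functorD(3)[OF fD i] pspb_presentable[OF mu le functorD(3)[OF fD i] D(3-5)[OF i]] by simp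
  then show "\<exists>I D \<iota>. filtered_diagram \<kappa> (cardSuc lam) I PB D \<and> (\<forall>i \<in> Obj I. obj_map D i \<in> ?\<A>) \<and>
      colimit I PB D X \<iota>" using D(1,2) by blast
qed

lemma pspb_projections_preserve_colimits:
  "preserves_filtered_colimits \<kappa> (cardSuc lam) PB \<K> G_bar"
  "preserves_filtered_colimits \<kappa> (cardSuc lam) PB \<L> F_bar"
proof -
  have le: "lam \<le>o cardSuc lam" using lam(1) by (simp add: cardSuc_ordLeq)
  show "preserves_filtered_colimits \<kappa> (cardSuc lam) PB \<K> G_bar"
    "preserves_filtered_colimits \<kappa> (cardSuc lam) PB \<L> F_bar"
    unfolding preserves_filtered_colimits_def filtered_diagram_iff comp_def bar_simps
    by (intro allI impI; elim conjE; rule pspb_colimit_components[OF small_filtered_mono[OF _ le]]; assumption)+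
qed

text \<open>A presentable object of the pseudopullback is a retract of one of the approximating objects,
  and retracts of presentable objects are presentable.\<close>

lemma pspb_projections_preserve_presentable:
  assumes X: "presentable \<kappa> (cardSuc lam) PB X"
  shows "presentable \<kappa> (cardSuc lam) \<K> (obj_K X)" "presentable \<kappa> (cardSuc lam) \<L> (obj_L X)"
proof -
  have mu: "Cinfinite (cardSuc lam)" by (rule Cinfinite_cardSuc[OF lam(1)])
  note cP = pspb_category[OF fF fG]
  note oX = presentable_obj[OF X]
  obtain I :: "('u, 'u) cat" and D \<iota> where D: "filtered_diagram \<kappa> (cardSuc lam) I PB D" "colimit I PB D X \<iota>"
    "\<And>i. i \<in> Obj I \<Longrightarrow> presentable \<kappa> (cardSuc lam) \<K> (obj_K (obj_map D i))"
    "\<And>i. i \<in> Obj I \<Longrightarrow> presentable \<kappa> (cardSuc lam) \<L> (obj_L (obj_map D i))"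
    "\<And>i. i \<in> Obj I \<Longrightarrow> presentable \<kappa> (cardSuc lam) \<M> (obj_map F (obj_K (obj_map D i)))"
    by (rule pspb_approximation[OF oX]) (rule that, assumption+)
  have I: "small_filtered \<kappa> (cardSuc lam) I" and fD: "is_functor I PB D"
    using D(1) by (simp_all add: filtered_diagram_iff)
  obtain i y where i: "i \<in> Obj I" and y: "y \<in> hom PB X (obj_map D i)" and r: "Comp PB (\<iota> i) y = Ident PB X"
    using stagewise_factor[OF presentable_stagewise[OF \<kappa> mu pspb_class_category X I fD D(2)]
        ident_hom[OF cP oX]] .
  note \<iota> = coconeD(2)[OF colimit_imp_cocone[OF D(2)] i]
  have rK: "Comp \<K> (arr_K (\<iota> i)) (arr_K y) = Ident \<K> (obj_K X)"
    and rL: "Comp \<L> (arr_L (\<iota> i)) (arr_L y) = Ident \<L> (obj_L X)"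
    using arg_cong[OF r, of arr_K] arg_cong[OF r, of arr_L]
    by (simp_all add: pspb_comp[OF fF fG] pspb_ident[OF fF fG])
  show "presentable \<kappa> (cardSuc lam) \<K> (obj_K X)"
    by (rule presentable_retract[OF \<kappa> mu class_accessibleD(1)[OF F'(2)] D(3)[OF i]
          pspb_homD(3)[OF fF fG y] pspb_homD(3)[OF fF fG \<iota>] rK])
  show "presentable \<kappa> (cardSuc lam) \<L> (obj_L X)"
    by (rule presentable_retract[OF \<kappa> mu class_accessibleD(1)[OF G'(2)] D(4)[OF i]
          pspb_homD(4)[OF fF fG y] pspb_homD(4)[OF fF fG \<iota>] rL])
qed

end

text \<open>A category is equivalent to the pseudopullback of two copies of its identity functor, so that the
  approximation of objects by chains applies to it. The object \<open>X\<close> is approximated as the first component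
  of \<open>(X, X, X, id, id)\<close>.\<close>

lemma class_accessible_cardSuc:
  fixes \<kappa> :: "'u rel" and C :: "('o, 'a) cat"
  assumes \<kappa>: "inaccessible \<kappa>" and lam: "Cinfinite lam" "regularCard lam" "lam <o \<kappa>"
    and C: "class_accessible \<kappa> lam C"
  shows "class_accessible \<kappa> (cardSuc lam) C"
proof -
  let ?Id = "\<lparr>obj_map = (\<lambda>x. x), arr_map = (\<lambda>f. f)\<rparr> :: ('o, 'a, 'o, 'a) fctr"
  have le: "lam \<le>o cardSuc lam" using lam(1) by (simp add: cardSuc_ordLeq)
  note cC = class_accessibleD[OF C]
  have fId: "is_functor C C ?Id" using cC(2) by (simp add: is_functor_def)
  have "comp_functor ?Id D = D" for D :: "('u, 'u, 'o, 'a) fctr" by (simp add: comp_functor_def comp_def)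
  then have Id: "strongly_class_accessible_functor \<kappa> lam C C ?Id"
    using C fId by (simp add: strongly_class_accessible_functor_def class_accessible_functor_def
        preserves_filtered_colimits_def comp_def)
  let ?\<A> = "{A \<in> Obj C. presentable \<kappa> (cardSuc lam) C A}"
  show ?thesis
    unfolding class_accessible_def
  proof (intro conjI exI[of _ ?\<A>] ballI)
    show "class_category \<kappa> C" by (rule cC(1))
    show "has_filtered_colimits \<kappa> (cardSuc lam) C"
      using cC(3) small_filtered_mono[OF _ le] unfolding has_filtered_colimits_def filtered_diagram_iff
      by blast
    show "class_sized \<kappa> ?\<A>"
      by (rule class_sized_subset[of ?\<A> "Obj C"]) (use cC(1) in \<open>auto simp: class_category_def\<close>)
    show "presentable \<kappa> (cardSuc lam) C A" if "A \<in> ?\<A>" for A using that by simp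
    fix X assume X: "X \<in> Obj C"
    let ?PB = "PsPb C C C ?Id ?Id" and ?X = "(X, X, X, Ident C X, Ident C X)"
    have "is_iso C X X (Ident C X)" unfolding is_iso_iff by (rule exI, rule mutually_inverse_ident[OF cC(2) X])
    then have X': "?X \<in> Obj ?PB" using X by (simp add: PsPb_def pspb_objects_def)
    obtain I :: "('u, 'u) cat" and D \<iota> where D: "filtered_diagram \<kappa> (cardSuc lam) I ?PB D"
      "colimit I ?PB D ?X \<iota>"
      "\<And>i. i \<in> Obj I \<Longrightarrow> presentable \<kappa> (cardSuc lam) C (obj_K (obj_map D i))"
      "\<And>i. i \<in> Obj I \<Longrightarrow> presentable \<kappa> (cardSuc lam) C (obj_L (obj_map D i))"
      "\<And>i. i \<in> Obj I \<Longrightarrow> presentable \<kappa> (cardSuc lam) C (obj_map ?Id (obj_K (obj_map D i)))"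
      by (rule pspb_approximation[OF \<kappa> lam Id Id X']) (rule that, assumption+)
    have I: "small_filtered \<kappa> (cardSuc lam) I" and fD: "is_functor I ?PB D"
      using D(1) by (simp_all add: filtered_diagram_iff)
    let ?D = "comp_functor (G_bar :: (('o, 'o, 'o, 'a) pspb_obj, ('o, 'a, 'o, 'a, 'o, 'a) pspb_arr, 'o, 'a) fctr) D"
    have "filtered_diagram \<kappa> (cardSuc lam) I C ?D"
      using I comp_functor_is_functor[OF fD G_bar_functor[OF fId fId]] by (simp add: filtered_diagram_iff)
    moreover have "colimit I C ?D X (\<lambda>i. arr_K (\<iota> i))"
      using pspb_colimit_components(1)[OF \<kappa> lam Id Id small_filtered_mono[OF I le] fD D(2)] by simp
    moreover have "\<forall>i \<in> Obj I. obj_map ?D i \<in> ?\<A>" using D(3) presentable_obj[OF D(3)] by auto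
    ultimately show "\<exists>I D \<iota>. filtered_diagram \<kappa> (cardSuc lam) I C D \<and>
      (\<forall>i \<in> Obj I. obj_map D i \<in> ?\<A>) \<and> colimit I C D X \<iota>" by blast
  qed
qed

theorem proposition3p1:
  fixes \<kappa> :: "'u rel" and lam :: "'r rel"
    and \<K> :: "('k, 'kk) cat" and \<L> :: "('l, 'll) cat" and \<M> :: "('m, 'mm) cat"
    and F :: "('k, 'kk, 'm, 'mm) fctr" and G :: "('l, 'll, 'm, 'mm) fctr"
  assumes "inaccessible \<kappa>" and "regular_cardinal \<kappa> lam"
    and "strongly_class_accessible_functor \<kappa> lam \<K> \<M> F"
    and "strongly_class_accessible_functor \<kappa> lam \<L> \<M> G"
  shows "class_accessible \<kappa> (cardSuc lam) (PsPb \<K> \<L> \<M> F G) \<and>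
    strongly_class_accessible_functor \<kappa> (cardSuc lam) (PsPb \<K> \<L> \<M> F G) \<L> F_bar \<and>
    strongly_class_accessible_functor \<kappa> (cardSuc lam) (PsPb \<K> \<L> \<M> F G) \<K> G_bar"
proof -
  have lam: "Cinfinite lam" "regularCard lam" "lam <o \<kappa>"
    using assms(2) by (auto simp: regular_cardinal_def)
  note F = strongly_class_accessible_functorD[OF assms(3)]
    and G = strongly_class_accessible_functorD[OF assms(4)]
  note setting = assms(1) lam assms(3,4)
  show ?thesis
    unfolding strongly_class_accessible_functor_def class_accessible_functor_def bar_simps
    using pspb_class_accessible[OF setting] class_accessible_cardSuc[OF assms(1) lam F(2)]
      class_accessible_cardSuc[OF assms(1) lam G(2)] G_bar_functor[OF F(4) G(4)] F_bar_functor[OF F(4) G(4)]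
      pspb_projections_preserve_colimits[OF setting] pspb_projections_preserve_presentable[OF setting]
    by blast
qed

end
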